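(* Let $A\to A'$ be a flat extension of normal noetherian integral domains and $p:\operatorname{Spec} A'\to\operatorname{Spec} A$ the induced morphism. If $D$ is a coaffine Weil divisor on $\operatorname{Spec} A$, then the pulled back divisor $p^*D$ on $\operatorname{Spec} A'$ is also coaffine. If $A\to A'$ is faithfully flat, then the converse also holds: if $p^*D$ is coaffine, so is $D$.
   Context: On a noetherian, separated, integral, normal scheme $X$, a Weil divisor $D$ is called coaffine if for every effective divisor $D'$ linearly equivalent to $D$ the complement $X\setminus\operatorname{supp} D'$ is affine. For a flat extension $A\to A'$ of normal noetherian domains the pull back $p^*$ of Weil divisors is defined by linear extension of $p^*(\mathfrak{p})=\sum_{\mathfrak{P}}e(\mathfrak{P}/\mathfrak{p})\,\mathfrak{P}$, where $\mathfrak{P}$ runs through the height one primes of $A'$ with $\mathfrak{P}\cap A=\mathfrak{p}$ and $e(\mathfrak{P}/\mathfrak{p})$ is the ramification index of the extension of discrete valuation rings $A_{\mathfrak{p}}\to A'_{\mathfrak{P}}$. *)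

theory Defs
  imports
    "HOL-Algebra.Ring_Divisibility"
    "HOL-Algebra.Module"
    "HOL-Algebra.Free_Abelian_Groups"
    "HOL-Computational_Algebra.Polynomial_Factorial"
    "HOL-Analysis.Abstract_Topology"
    "HOL-Library.Extended_Nat"
begin

section \<open>Rings given by a type\<close>

text \<open>The domains \<open>A\<close> and \<open>A'\<close> of the theorem are types of class \<^class>\<open>idom\<close>, so that
  \<open>A fract\<close> is their field of fractions; \<open>ring_of_type\<close> makes the notions of HOL-Algebra
  available for them.\<close>

definition ring_of_type :: "'a::comm_ring_1 ring" where
  "ring_of_type = \<lparr>carrier = UNIV, monoid.mult = (*), monoid.one = 1, ring.zero = 0, ring.add = (+)\<rparr>"

lemma cring_ring_of_type: "cring (ring_of_type :: 'a::comm_ring_1 ring)"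
proof (rule cringI)
  show "abelian_group (ring_of_type :: 'a ring)"
    by (rule abelian_groupI)
       (auto simp: ring_of_type_def algebra_simps intro: exI[of _ "- x" for x])
  show "comm_monoid (ring_of_type :: 'a ring)"
    by (rule comm_monoidI) (auto simp: ring_of_type_def algebra_simps)
qed (auto simp: ring_of_type_def algebra_simps)

text \<open>A domain is normal if it is integrally closed in its field of fractions.\<close>

definition normal_domain :: "'a::idom itself \<Rightarrow> bool" where
  "normal_domain _ \<longleftrightarrow>
     (\<forall>x :: 'a fract. (\<exists>p :: 'a poly. lead_coeff p = 1 \<and> poly (map_poly to_fract p) x = 0)
        \<longrightarrow> x \<in> range to_fract)"

section \<open>Flatness\<close>

definition linear_map ::
  "('r, 'k) ring_scheme \<Rightarrow> ('r, 'm) module \<Rightarrow> ('r, 'n) module \<Rightarrow> ('m \<Rightarrow> 'n) \<Rightarrow> bool" where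
  "linear_map R M N g \<longleftrightarrow> g \<in> carrier M \<rightarrow> carrier N \<and>
     (\<forall>x\<in>carrier M. \<forall>y\<in>carrier M. g (x \<oplus>\<^bsub>M\<^esub> y) = g x \<oplus>\<^bsub>N\<^esub> g y) \<and>
     (\<forall>r\<in>carrier R. \<forall>x\<in>carrier M. g (r \<odot>\<^bsub>M\<^esub> x) = r \<odot>\<^bsub>N\<^esub> g x)"

definition tensor_relators ::
  "('r, 'k) ring_scheme \<Rightarrow> ('r, 'm) module \<Rightarrow> ('r, 'l) module \<Rightarrow> ('m \<times> 'l \<Rightarrow>\<^sub>0 int) set" where
  "tensor_relators R M L =
     {frag_of (x \<oplus>\<^bsub>M\<^esub> y, l) - frag_of (x, l) - frag_of (y, l) | x y l.
        x \<in> carrier M \<and> y \<in> carrier M \<and> l \<in> carrier L} \<union>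
     {frag_of (x, k \<oplus>\<^bsub>L\<^esub> l) - frag_of (x, k) - frag_of (x, l) | x k l.
        x \<in> carrier M \<and> k \<in> carrier L \<and> l \<in> carrier L} \<union>
     {frag_of (r \<odot>\<^bsub>M\<^esub> x, l) - frag_of (x, r \<odot>\<^bsub>L\<^esub> l) | r x l.
        r \<in> carrier R \<and> x \<in> carrier M \<and> l \<in> carrier L}"

definition tensor_relations ::
  "('r, 'k) ring_scheme \<Rightarrow> ('r, 'm) module \<Rightarrow> ('r, 'l) module \<Rightarrow> ('m \<times> 'l \<Rightarrow>\<^sub>0 int) set" where
  "tensor_relations R M L =
     generate (free_Abelian_group (carrier M \<times> carrier L)) (tensor_relators R M L)"

text \<open>The abelian group underlying the tensor product; its \<open>R\<close>-module structure plays no role for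
  exactness.\<close>

definition tensor ::
  "('r, 'k) ring_scheme \<Rightarrow> ('r, 'm) module \<Rightarrow> ('r, 'l) module \<Rightarrow> ('m \<times> 'l \<Rightarrow>\<^sub>0 int) set monoid" where
  "tensor R M L = free_Abelian_group (carrier M \<times> carrier L) Mod tensor_relations R M L"

text \<open>The map \<open>g \<otimes> id\<close> from \<open>M \<otimes> L\<close> to \<open>N \<otimes> L\<close>. All representatives of a class have
  images in one and the same coset, so the union is that coset.\<close>

definition tensor_map ::
  "('r, 'k) ring_scheme \<Rightarrow> ('r, 'n) module \<Rightarrow> ('r, 'l) module \<Rightarrow> ('m \<Rightarrow> 'n) \<Rightarrow>
     ('m \<times> 'l \<Rightarrow>\<^sub>0 int) set \<Rightarrow> ('n \<times> 'l \<Rightarrow>\<^sub>0 int) set" where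
  "tensor_map R N L g C =
     (\<Union>c\<in>C. tensor_relations R N L #>\<^bsub>free_Abelian_group (carrier N \<times> carrier L)\<^esub>
               frag_extend (\<lambda>(x, l). frag_of (g x, l)) c)"

definition exact_modules ::
  "('r, 'm) module \<Rightarrow> ('r, 'n) module \<Rightarrow> ('r, 'p) module \<Rightarrow> ('m \<Rightarrow> 'n) \<Rightarrow> ('n \<Rightarrow> 'p) \<Rightarrow> bool" where
  "exact_modules M N P g h \<longleftrightarrow> g ` carrier M = {y \<in> carrier N. h y = \<zero>\<^bsub>P\<^esub>}"

definition exact_tensored ::
  "('r, 'k) ring_scheme \<Rightarrow> ('r, 'l) module \<Rightarrow> ('r, 'm) module \<Rightarrow> ('r, 'n) module \<Rightarrow>
     ('r, 'p) module \<Rightarrow> ('m \<Rightarrow> 'n) \<Rightarrow> ('n \<Rightarrow> 'p) \<Rightarrow> bool" where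
  "exact_tensored R L M N P g h \<longleftrightarrow>
     tensor_map R N L g ` carrier (tensor R M L) =
     {y \<in> carrier (tensor R N L). tensor_map R P L h y = \<one>\<^bsub>tensor R P L\<^esub>}"

text \<open>HOL cannot quantify over modules on all types. The test modules range over the type
  \<open>(nat \<Rightarrow> 'r) set\<close>, which contains an isomorphic copy of every quotient of a submodule of
  \<open>R\<^sup>n\<close>, in particular of all ideals and of all finitely generated modules. Since a module is flat
  as soon as tensoring preserves injectivity of ideals \<open>I \<rightarrow> R\<close>, and a flat module is faithfully flat
  as soon as it kills no nonzero \<open>R/m\<close>, this is no restriction.\<close>

definition flat_module :: "('r, 'k) ring_scheme \<Rightarrow> ('r, 'l) module \<Rightarrow> bool" where
  "flat_module R L \<longleftrightarrow> module R L \<and>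
     (\<forall>(M :: ('r, (nat \<Rightarrow> 'r) set) module) (N :: ('r, (nat \<Rightarrow> 'r) set) module)
       (P :: ('r, (nat \<Rightarrow> 'r) set) module) g h.
        module R M \<and> module R N \<and> module R P \<and> linear_map R M N g \<and> linear_map R N P h \<longrightarrow>
        exact_modules M N P g h \<longrightarrow> exact_tensored R L M N P g h)"

definition faithfully_flat_module :: "('r, 'k) ring_scheme \<Rightarrow> ('r, 'l) module \<Rightarrow> bool" where
  "faithfully_flat_module R L \<longleftrightarrow> module R L \<and>
     (\<forall>(M :: ('r, (nat \<Rightarrow> 'r) set) module) (N :: ('r, (nat \<Rightarrow> 'r) set) module)
       (P :: ('r, (nat \<Rightarrow> 'r) set) module) g h.
        module R M \<and> module R N \<and> module R P \<and> linear_map R M N g \<and> linear_map R N P h \<longrightarrow>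
        (exact_modules M N P g h \<longleftrightarrow> exact_tensored R L M N P g h))"

definition module_along :: "('a::comm_ring_1 \<Rightarrow> 'b::comm_ring_1) \<Rightarrow> ('a, 'b) module" where
  "module_along f =
     \<lparr>carrier = UNIV, monoid.mult = (*), monoid.one = 1, ring.zero = 0, ring.add = (+),
      module.smult = (\<lambda>a b. f a * b)\<rparr>"

section \<open>The spectrum of a commutative ring\<close>

definition Spec :: "('a, 'm) ring_scheme \<Rightarrow> 'a set set" where
  "Spec R = {P. primeideal P R}"

definition zariski :: "('a, 'm) ring_scheme \<Rightarrow> 'a set topology" where
  "zariski R = topology (\<lambda>U. \<exists>E. E \<subseteq> carrier R \<and> U = {P \<in> Spec R. \<not> E \<subseteq> P})"

lemma openin_zariski:
  "openin (zariski R) U \<longleftrightarrow> (\<exists>E. E \<subseteq> carrier R \<and> U = {P \<in> Spec R. \<not> E \<subseteq> P})"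
proof -
  let ?open = "\<lambda>U. \<exists>E. E \<subseteq> carrier R \<and> U = {P \<in> Spec R. \<not> E \<subseteq> P}"
  have inter: "?open (U \<inter> V)" if U: "?open U" and V: "?open V" for U V
  proof -
    obtain E where E: "E \<subseteq> carrier R" "U = {P \<in> Spec R. \<not> E \<subseteq> P}" using U by blast
    obtain F where F: "F \<subseteq> carrier R" "V = {P \<in> Spec R. \<not> F \<subseteq> P}" using V by blast
    define G where "G = {x \<otimes>\<^bsub>R\<^esub> y | x y. x \<in> E \<and> y \<in> F}"
    have iff: "G \<subseteq> P \<longleftrightarrow> E \<subseteq> P \<or> F \<subseteq> P" if "P \<in> Spec R" for P
    proof -
      interpret primeideal P R using that by (simp add: Spec_def)
      show ?thesis
      proof
        assume G: "G \<subseteq> P"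
        show "E \<subseteq> P \<or> F \<subseteq> P"
        proof (rule ccontr)
          assume "\<not> (E \<subseteq> P \<or> F \<subseteq> P)"
          then obtain x y where xy: "x \<in> E" "x \<notin> P" "y \<in> F" "y \<notin> P" by blast
          then have "x \<otimes>\<^bsub>R\<^esub> y \<in> P" using G by (auto simp: G_def)
          then show False using xy E(1) F(1) I_prime[of x y] by blast
        qed
      next
        assume EF: "E \<subseteq> P \<or> F \<subseteq> P"
        show "G \<subseteq> P"
        proof
          fix z assume "z \<in> G"
          then obtain x y where "z = x \<otimes>\<^bsub>R\<^esub> y" "x \<in> E" "y \<in> F" by (auto simp: G_def)
          then show "z \<in> P" using EF E(1) F(1) I_l_closed[of y x] I_r_closed[of x y] by blast
        qed
      qed
    qed
    have "G \<subseteq> carrier R \<or> Spec R = {}"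
    proof (cases "Spec R = {}")
      case False
      then obtain P where "primeideal P R" by (auto simp: Spec_def)
      then interpret primeideal P R .
      show ?thesis using E(1) F(1) by (auto simp: G_def)
    qed simp
    then show ?thesis
    proof
      assume "G \<subseteq> carrier R"
      moreover have "U \<inter> V = {P \<in> Spec R. \<not> G \<subseteq> P}" using iff E(2) F(2) by blast
      ultimately show ?thesis by blast
    next
      assume "Spec R = {}"
      then show ?thesis using E by blast
    qed
  qed
  have union: "?open (\<Union>\<K>)" if "\<forall>K\<in>\<K>. ?open K" for \<K>
  proof -
    obtain E where E: "\<And>K. K \<in> \<K> \<Longrightarrow> E K \<subseteq> carrier R \<and> K = {P \<in> Spec R. \<not> E K \<subseteq> P}"
      using \<open>\<forall>K\<in>\<K>. ?open K\<close> by metis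
    have "\<Union>\<K> = {P \<in> Spec R. \<not> (\<Union>K\<in>\<K>. E K) \<subseteq> P}"
    proof (rule equalityI; rule subsetI)
      fix P assume "P \<in> \<Union>\<K>"
      then obtain K where "K \<in> \<K>" "P \<in> K" by blast
      then show "P \<in> {P \<in> Spec R. \<not> (\<Union>K\<in>\<K>. E K) \<subseteq> P}" using E[of K] by blast
    next
      fix P assume "P \<in> {P \<in> Spec R. \<not> (\<Union>K\<in>\<K>. E K) \<subseteq> P}"
      then obtain K where "K \<in> \<K>" "\<not> E K \<subseteq> P" "P \<in> Spec R" by blast
      then show "P \<in> \<Union>\<K>" using E[of K] by blast
    qed
    moreover have "(\<Union>K\<in>\<K>. E K) \<subseteq> carrier R" using E by blast
    ultimately show ?thesis by blast
  qed
  have "istopology ?open"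
    unfolding istopology_def using inter union by blast
  then show ?thesis by (simp add: zariski_def topology_inverse')
qed

lemma topspace_zariski: "topspace (zariski R) = Spec R"
proof -
  have "P \<in> topspace (zariski R)" if "P \<in> Spec R" for P
  proof -
    interpret primeideal P R using that by (simp add: Spec_def)
    have "openin (zariski R) {Q \<in> Spec R. \<not> carrier R \<subseteq> Q}"
      unfolding openin_zariski by blast
    moreover have "\<not> carrier R \<subseteq> P" using I_notcarr Icarr by blast
    ultimately show ?thesis using that openin_subset by blast
  qed
  moreover have "topspace (zariski R) \<subseteq> Spec R"
    by (auto simp: topspace_def openin_zariski)
  ultimately show ?thesis by blast
qed

text \<open>The localization of \<open>R\<close> at a prime \<open>P\<close>, with fractions as equivalence classes of pairs.\<close>

definition fraction_rel :: "('a, 'm) ring_scheme \<Rightarrow> 'a set \<Rightarrow> (('a \<times> 'a) \<times> ('a \<times> 'a)) set" where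
  "fraction_rel R P = {((a, s), (b, t)).
     a \<in> carrier R \<and> b \<in> carrier R \<and> s \<in> carrier R - P \<and> t \<in> carrier R - P \<and>
     (\<exists>u \<in> carrier R - P. u \<otimes>\<^bsub>R\<^esub> (a \<otimes>\<^bsub>R\<^esub> t \<ominus>\<^bsub>R\<^esub> b \<otimes>\<^bsub>R\<^esub> s) = \<zero>\<^bsub>R\<^esub>)}"

definition fraction :: "('a, 'm) ring_scheme \<Rightarrow> 'a set \<Rightarrow> 'a \<Rightarrow> 'a \<Rightarrow> ('a \<times> 'a) set" where
  "fraction R P a s = fraction_rel R P `` {(a, s)}"

definition stalk :: "('a, 'm) ring_scheme \<Rightarrow> 'a set \<Rightarrow> ('a \<times> 'a) set ring" where
  "stalk R P =
     \<lparr>carrier = (carrier R \<times> (carrier R - P)) // fraction_rel R P,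
      monoid.mult = (\<lambda>X Y. \<Union>(a, s)\<in>X. \<Union>(b, t)\<in>Y. fraction R P (a \<otimes>\<^bsub>R\<^esub> b) (s \<otimes>\<^bsub>R\<^esub> t)),
      monoid.one = fraction R P \<one>\<^bsub>R\<^esub> \<one>\<^bsub>R\<^esub>,
      ring.zero = fraction R P \<zero>\<^bsub>R\<^esub> \<one>\<^bsub>R\<^esub>,
      ring.add = (\<lambda>X Y. \<Union>(a, s)\<in>X. \<Union>(b, t)\<in>Y.
               fraction R P (a \<otimes>\<^bsub>R\<^esub> t \<oplus>\<^bsub>R\<^esub> b \<otimes>\<^bsub>R\<^esub> s) (s \<otimes>\<^bsub>R\<^esub> t))\<rparr>"

text \<open>The structure sheaf: sections over \<open>V\<close> are the functions into the stalks that are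
  locally given by a fraction.\<close>

definition structure_sheaf ::
  "('a, 'm) ring_scheme \<Rightarrow> 'a set set \<Rightarrow> ('a set \<Rightarrow> ('a \<times> 'a) set) ring" where
  "structure_sheaf R V =
     \<lparr>carrier = {s \<in> \<Pi>\<^sub>E P\<in>V. carrier (stalk R P).
        \<forall>P\<in>V. \<exists>W a b. openin (zariski R) W \<and> P \<in> W \<and> W \<subseteq> V \<and> a \<in> carrier R \<and> b \<in> carrier R \<and>
          (\<forall>Q\<in>W. b \<notin> Q \<and> s Q = fraction R Q a b)},
      monoid.mult = (\<lambda>s t. \<lambda>P\<in>V. s P \<otimes>\<^bsub>stalk R P\<^esub> t P),
      monoid.one = (\<lambda>P\<in>V. \<one>\<^bsub>stalk R P\<^esub>),
      ring.zero = (\<lambda>P\<in>V. \<zero>\<^bsub>stalk R P\<^esub>),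
      ring.add = (\<lambda>s t. \<lambda>P\<in>V. s P \<oplus>\<^bsub>stalk R P\<^esub> t P)\<rparr>"

text \<open>Isomorphism of spaces with sheaves of rings of (dependent) functions, where the restriction
  maps are restriction of functions. Between locally ringed spaces, an isomorphism of ringed spaces
  is automatically one of locally ringed spaces.\<close>

definition ringed_space_isomorphic ::
  "'x topology \<Rightarrow> ('x set \<Rightarrow> ('x \<Rightarrow> 'c) ring) \<Rightarrow> 'y topology \<Rightarrow> ('y set \<Rightarrow> ('y \<Rightarrow> 'd) ring) \<Rightarrow> bool"
  where
  "ringed_space_isomorphic X \<O>X Y \<O>Y \<longleftrightarrow>
     (\<exists>\<phi> \<theta>. homeomorphic_map X Y \<phi> \<and>
        (\<forall>V. openin Y V \<longrightarrow> \<theta> V \<in> ring_iso (\<O>Y V) (\<O>X {x \<in> topspace X. \<phi> x \<in> V})) \<and>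
        (\<forall>V W. openin Y V \<longrightarrow> openin Y W \<longrightarrow> W \<subseteq> V \<longrightarrow>
           (\<forall>s \<in> carrier (\<O>Y V).
              \<theta> W (restrict s W) = restrict (\<theta> V s) {x \<in> topspace X. \<phi> x \<in> W})))"

text \<open>An open subset \<open>U\<close> of \<open>Spec R\<close> is affine if the open subscheme it carries is isomorphic
  to the spectrum of a commutative ring \<open>B\<close>. Such a \<open>B\<close> is isomorphic to the ring of sections over
  \<open>U\<close>, so the choice of the type of its elements is no restriction.\<close>

definition affine_open :: "('a, 'm) ring_scheme \<Rightarrow> 'a set set \<Rightarrow> bool" where
  "affine_open R U \<longleftrightarrow> openin (zariski R) U \<and>
     (\<exists>B :: ('a set \<Rightarrow> ('a \<times> 'a) set) ring. cring B \<and>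
        ringed_space_isomorphic (subtopology (zariski R) U) (structure_sheaf R)
          (zariski B) (structure_sheaf B))"

section \<open>Weil divisors\<close>

definition height :: "('a, 'm) ring_scheme \<Rightarrow> 'a set \<Rightarrow> enat" where
  "height R P = Sup {enat n | n. \<exists>Q. Q n = P \<and> (\<forall>i\<le>n. Q i \<in> Spec R) \<and> (\<forall>i<n. Q i \<subset> Q (Suc i))}"

definition height_one_primes :: "'a::idom set set" where
  "height_one_primes = {P \<in> Spec ring_of_type. height ring_of_type P = 1}"

text \<open>Prime divisors on \<open>Spec A\<close> correspond to the height one primes of \<open>A\<close>.\<close>

definition weil_divisors :: "('a::idom set \<Rightarrow>\<^sub>0 int) set" where
  "weil_divisors = carrier (free_Abelian_group height_one_primes)"

text \<open>The discrete valuation ring \<open>A\<^sub>P\<close>, as a subring of the field of fractions, its maximal ideal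
  and its normalized valuation.\<close>

definition local_ring :: "'a::idom set \<Rightarrow> 'a fract set" where
  "local_ring P = {Fract a s | a s. s \<notin> P}"

definition local_max_ideal :: "'a::idom set \<Rightarrow> 'a fract set" where
  "local_max_ideal P = {Fract a s | a s. a \<in> P \<and> s \<notin> P}"

definition uniformizer :: "'a::idom set \<Rightarrow> 'a fract \<Rightarrow> bool" where
  "uniformizer P \<pi> \<longleftrightarrow> local_max_ideal P = {\<pi> * x | x. x \<in> local_ring P}"

definition ord_at :: "'a::idom set \<Rightarrow> 'a fract \<Rightarrow> int" where
  "ord_at P x = (THE n. \<exists>\<pi> u. uniformizer P \<pi> \<and>
     u \<noteq> 0 \<and> u \<in> local_ring P \<and> inverse u \<in> local_ring P \<and> x = u * \<pi> powi n)"

text \<open>The ramification index of \<open>A\<^sub>p \<rightarrow> A'\<^sub>P\<close> is the value at \<open>P\<close> of the image of a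
  uniformizer \<open>a/s\<close> of \<open>A\<^sub>p\<close>.\<close>

definition ramification_index :: "('a::idom \<Rightarrow> 'b::idom) \<Rightarrow> 'b set \<Rightarrow> 'a set \<Rightarrow> int" where
  "ramification_index f P p =
     (THE e. \<exists>a s. s \<notin> p \<and> uniformizer p (Fract a s) \<and> e = ord_at P (Fract (f a) (f s)))"

definition divisor_pullback ::
  "('a::idom \<Rightarrow> 'b::idom) \<Rightarrow> ('a set \<Rightarrow>\<^sub>0 int) \<Rightarrow> ('b set \<Rightarrow>\<^sub>0 int)" where
  "divisor_pullback f =
     frag_extend (\<lambda>p. \<Sum>P | P \<in> height_one_primes \<and> f -` P = p.
       frag_cmul (ramification_index f P p) (frag_of P))"

definition linearly_equivalent :: "('a::idom set \<Rightarrow>\<^sub>0 int) \<Rightarrow> ('a set \<Rightarrow>\<^sub>0 int) \<Rightarrow> bool" where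
  "linearly_equivalent D E \<longleftrightarrow>
     (\<exists>x. x \<noteq> 0 \<and> (\<forall>P\<in>height_one_primes. Poly_Mapping.lookup (D - E) P = ord_at P x))"

definition effective :: "('a::idom set \<Rightarrow>\<^sub>0 int) \<Rightarrow> bool" where
  "effective D \<longleftrightarrow> (\<forall>P. 0 \<le> Poly_Mapping.lookup D P)"

definition divisor_support :: "('a::idom set \<Rightarrow>\<^sub>0 int) \<Rightarrow> 'a set set" where
  "divisor_support D = {Q \<in> Spec ring_of_type. \<exists>P\<in>Poly_Mapping.keys D. P \<subseteq> Q}"

definition coaffine :: "('a::idom set \<Rightarrow>\<^sub>0 int) \<Rightarrow> bool" where
  "coaffine D \<longleftrightarrow> D \<in> weil_divisors \<and>
     (\<forall>E\<in>weil_divisors. effective E \<longrightarrow> linearly_equivalent E D \<longrightarrow>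
        affine_open ring_of_type (Spec ring_of_type - divisor_support E))"

end

theory Submission
  imports Defs
begin

text \<open>Write \<open>A(D)\<close> for the set of all \<open>q\<close> in the field of fractions with \<open>div q + D \<ge> 0\<close>. The
  effective divisors equivalent to \<open>D\<close> are the \<open>E = div q + D\<close> with \<open>0 \<noteq> q \<in> A(D)\<close>. The ideal
  \<open>A(-E)\<close> has zero set \<open>supp E\<close>, so \<open>U = Spec A - supp E\<close> is affine iff \<open>A(-E)\<close> generates the unit
  ideal of \<open>\<Gamma>(U)\<close>, the union of all \<open>A(nE)\<close>. As \<open>A(kE)\<close> is \<open>A(kD)\<close> divided by the \<open>k\<close>-th power
  of \<open>q\<close>, this says that some \<open>q ^ m\<close> lies in \<open>A(-D) A((m + 1)D)\<close>. The \<open>q\<close> with this property are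
  closed under sums and multiples, being the radical of a homogeneous ideal in one degree.

  Flatness gives \<open>B(p\<^sup>*D) = A(D) B\<close>, so the property passes from \<open>A(D)\<close> to \<open>B(p\<^sup>*D)\<close>. Conversely
  \<open>A(-D) A((m + 1)D)\<close> is recovered from its extension to \<open>B\<close> if \<open>B\<close> is faithfully flat.\<close>

section \<open>Ideals of a domain given by a type\<close>

text \<open>The sections of p*D form a B-module with far more elements than the images of A(D), so
  coaffineness of D says nothing directly about most effective divisors equivalent to p*D; stability
  under sums is what bridges the gap. The equality of B(p*D) and A(D)B has two sources. A height one
  prime of B contracts to zero or to a height one prime, so orders pull back with the ramification
  index as factor. And A(D) is the dual (A : A(-D)), up to a common denominator a colon by a
  finitely generated ideal, which flatness preserves. Normality enters through the associated primes
  of principal ideals: their localizations have principal maximal ideals, which yields the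
  valuations, height one, and A as the intersection of its local rings without Krull's principal
  ideal theorem. The product A(-D) A((m + 1)D) need not be reflexive, so orders do not detect
  membership in it; this is why the converse asks for faithful flatness.\<close>

lemma ring_of_type_simps [simp]:
  "carrier (ring_of_type :: 'a::comm_ring_1 ring) = UNIV"
  "x \<otimes>\<^bsub>ring_of_type\<^esub> y = x * y" "x \<oplus>\<^bsub>ring_of_type\<^esub> y = x + y"
  "\<one>\<^bsub>ring_of_type\<^esub> = (1::'a)" "\<zero>\<^bsub>ring_of_type\<^esub> = (0::'a)"
  by (simp_all add: ring_of_type_def)

lemma ring_ring_of_type: "ring (ring_of_type :: 'a::comm_ring_1 ring)"
  using cring_ring_of_type cring.axioms(1) by blast

lemma ideal_ring_of_type_iff:
  "ideal I (ring_of_type :: 'a::comm_ring_1 ring) \<longleftrightarrow>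
     0 \<in> I \<and> (\<forall>x\<in>I. \<forall>y\<in>I. x + y \<in> I) \<and> (\<forall>r. \<forall>x\<in>I. r * x \<in> I)"
proof
  assume "ideal I (ring_of_type :: 'a ring)"
  then interpret ideal I "ring_of_type :: 'a ring" .
  show "0 \<in> I \<and> (\<forall>x\<in>I. \<forall>y\<in>I. x + y \<in> I) \<and> (\<forall>r. \<forall>x\<in>I. r * x \<in> I)"
    using additive_subgroup.zero_closed[OF is_additive_subgroup]
      additive_subgroup.a_closed[OF is_additive_subgroup] I_l_closed by auto
next
  assume I: "0 \<in> I \<and> (\<forall>x\<in>I. \<forall>y\<in>I. x + y \<in> I) \<and> (\<forall>r. \<forall>x\<in>I. r * x \<in> I)"
  have grp: "group (add_monoid (ring_of_type :: 'a ring))"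
    using ring_ring_of_type abelian_group.a_group ring.is_abelian_group by blast
  have inv: "inv\<^bsub>add_monoid (ring_of_type :: 'a ring)\<^esub> x = - x" for x :: 'a
    by (rule group.inv_equality[OF grp]) auto
  have "- x \<in> I" if "x \<in> I" for x
    using I that mult_minus1[of x] by metis
  then have "subgroup I (add_monoid (ring_of_type :: 'a ring))"
    using I by (intro subgroup.intro) (simp_all only: inv, simp_all)
  moreover have "r * a \<in> I" "a * r \<in> I" if "a \<in> I" for a r
    using I that by (auto simp: mult.commute[of a r])
  ultimately show "ideal I (ring_of_type :: 'a ring)"
    by (intro idealI ring_ring_of_type) simp_all
qed

lemma ideal_ring_of_typeI:
  fixes I :: "'a::comm_ring_1 set"
  assumes "0 \<in> I" "\<And>x y. x \<in> I \<Longrightarrow> y \<in> I \<Longrightarrow> x + y \<in> I" "\<And>r x. x \<in> I \<Longrightarrow> r * x \<in> I"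
  shows "ideal I ring_of_type"
  using assms by (simp add: ideal_ring_of_type_iff)

lemma ideal_ring_of_typeD:
  fixes I :: "'a::comm_ring_1 set"
  assumes "ideal I ring_of_type"
  shows "0 \<in> I" "x \<in> I \<Longrightarrow> y \<in> I \<Longrightarrow> x + y \<in> I" "x \<in> I \<Longrightarrow> r * x \<in> I" "x \<in> I \<Longrightarrow> x * r \<in> I"
  using assms by (auto simp: ideal_ring_of_type_iff mult.commute)

lemma Spec_ring_of_type_iff:
  "P \<in> Spec (ring_of_type :: 'a::comm_ring_1 ring) \<longleftrightarrow>
     ideal P ring_of_type \<and> 1 \<notin> P \<and> (\<forall>x y. x * y \<in> P \<longrightarrow> x \<in> P \<or> y \<in> P)"
proof
  assume "P \<in> Spec (ring_of_type :: 'a ring)"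
  then interpret primeideal P "ring_of_type :: 'a ring" by (simp add: Spec_def)
  show "ideal P ring_of_type \<and> 1 \<notin> P \<and> (\<forall>x y. x * y \<in> P \<longrightarrow> x \<in> P \<or> y \<in> P)"
    using I_prime I_notcarr one_imp_carrier is_ideal by auto
next
  assume P: "ideal P ring_of_type \<and> 1 \<notin> P \<and> (\<forall>x y. x * y \<in> P \<longrightarrow> x \<in> P \<or> y \<in> P)"
  then show "P \<in> Spec (ring_of_type :: 'a ring)"
    unfolding Spec_def mem_Collect_eq by (intro primeidealI cring_ring_of_type) (simp_all, blast+)
qed

lemma SpecD:
  fixes P :: "'a::comm_ring_1 set"
  assumes "P \<in> Spec ring_of_type"
  shows "ideal P ring_of_type" "1 \<notin> P" "x * y \<in> P \<Longrightarrow> x \<in> P \<or> y \<in> P" "0 \<in> P"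
    "x \<in> P \<Longrightarrow> y \<in> P \<Longrightarrow> x + y \<in> P" "x \<in> P \<Longrightarrow> r * x \<in> P" "x \<in> P \<Longrightarrow> x * r \<in> P"
  using assms by (auto simp: Spec_ring_of_type_iff ideal_ring_of_typeD)

lemma Spec_mult_notin:
  fixes P :: "'a::comm_ring_1 set"
  assumes "P \<in> Spec ring_of_type" "x \<notin> P" "y \<notin> P"
  shows "x * y \<notin> P"
  using assms SpecD(3) by blast

lemma Spec_power_notin:
  fixes P :: "'a::comm_ring_1 set"
  assumes "P \<in> Spec ring_of_type" "x \<notin> P"
  shows "x ^ n \<notin> P"
  using assms by (induction n) (auto simp: SpecD Spec_mult_notin)

lemma zero_in_Spec: "{0} \<in> Spec (ring_of_type :: 'a::idom ring)"
  by (auto simp: Spec_ring_of_type_iff ideal_ring_of_type_iff)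

text \<open>\<open>{0}\<close> is prime in a domain, so every nonzero prime tops a chain of length
  one, and a chain of length two exists exactly when another nonzero prime lies strictly
  inside.\<close>

lemma height_one_primes_iff:
  fixes P :: "'a::idom set"
  shows "P \<in> height_one_primes \<longleftrightarrow> P \<in> Spec ring_of_type \<and> P \<noteq> {0} \<and>
     (\<forall>Q\<in>Spec ring_of_type. Q \<noteq> {0} \<longrightarrow> Q \<subseteq> P \<longrightarrow> Q = P)"
proof -
  let ?S = "Spec (ring_of_type :: 'a ring)"
  let ?chain = "\<lambda>n Q. Q n = P \<and> (\<forall>i\<le>n. Q i \<in> ?S) \<and> (\<forall>i<n. Q i \<subset> Q (Suc i))"
  let ?H = "{enat n | n. \<exists>Q. ?chain n Q}"
  have H: "height ring_of_type P = Sup ?H" unfolding height_def ..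
  show ?thesis
  proof
    assume P: "P \<in> height_one_primes"
    then have PS: "P \<in> ?S" and h: "Sup ?H = 1" by (auto simp: height_one_primes_def H)
    have le: "n \<le> 1" if "?chain n Q" for n Q
      using that h Sup_upper[of "enat n" ?H] by (auto simp: one_enat_def)
    have "\<exists>n Q. n \<noteq> 0 \<and> ?chain n Q"
    proof (rule ccontr)
      assume no: "\<not> ?thesis"
      have "x \<le> 0" if "x \<in> ?H" for x
      proof -
        obtain n where n: "x = enat n" "\<exists>Q. ?chain n Q" using \<open>x \<in> ?H\<close> by blast
        then have "n = 0" using no by metis
        then show ?thesis using n by (simp add: zero_enat_def)
      qed
      then have "Sup ?H \<le> 0" by (rule Sup_least)
      with h show False by simp
    qed
    then obtain n Q where "n \<noteq> 0" "?chain n Q" by blast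
    moreover from this have "n \<le> 1" by (intro le)
    ultimately have n1: "n = 1" and chn: "?chain n Q" by simp_all
    from chn have ch: "?chain 1 Q" unfolding n1 .
    then have "Q 0 \<in> ?S" by simp
    moreover have "Q 0 \<subset> P" using ch by (metis One_nat_def less_one)
    ultimately have "P \<noteq> {0}" using SpecD(4) by blast
    moreover have "R = P" if R: "R \<in> ?S" "R \<noteq> {0}" "R \<subseteq> P" for R
    proof (rule ccontr)
      assume "R \<noteq> P"
      define Q where "Q = (\<lambda>i::nat. if i = 0 then {0} else if i = 1 then R else P)"
      have "{0} \<subset> R" using SpecD(4)[OF R(1)] R(2) by blast
      moreover have "R \<subset> P" using R(3) \<open>R \<noteq> P\<close> by blast
      ultimately have "?chain 2 Q"
        using R(1) PS zero_in_Spec by (auto simp: Q_def less_2_cases_iff)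
      from le[OF this] show False by simp
    qed
    ultimately show "P \<in> ?S \<and> P \<noteq> {0} \<and> (\<forall>Q\<in>?S. Q \<noteq> {0} \<longrightarrow> Q \<subseteq> P \<longrightarrow> Q = P)"
      using PS by blast
  next
    assume P: "P \<in> ?S \<and> P \<noteq> {0} \<and> (\<forall>Q\<in>?S. Q \<noteq> {0} \<longrightarrow> Q \<subseteq> P \<longrightarrow> Q = P)"
    define Q where "Q = (\<lambda>i::nat. if i = 0 then {0} else P)"
    have "{0} \<subset> P" using P SpecD(4) by blast
    then have "?chain 1 Q" using P zero_in_Spec by (auto simp: Q_def)
    then have "1 \<in> ?H" unfolding one_enat_def by blast
    then have "1 \<le> Sup ?H" by (rule Sup_upper)
    moreover have "n \<le> 1" if ch: "?chain n Q" for n Q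
    proof (rule ccontr)
      assume "\<not> n \<le> 1"
      then have "2 \<le> n" by simp
      then obtain m where "n = 2 + m" using le_Suc_ex by blast
      then have m: "n = Suc (Suc m)" by simp
      have b: "Q m \<in> ?S" "Q (Suc m) \<in> ?S" using ch m by simp_all
      have step: "Q i \<subset> Q (Suc i)" if "i < n" for i using ch that by blast
      have "Q m \<subset> Q (Suc m)" "Q (Suc m) \<subset> Q n" using step[of m] step[of "Suc m"] m by simp_all
      moreover have "Q n = P" using ch by blast
      ultimately have a: "Q m \<subset> Q (Suc m)" "Q (Suc m) \<subset> P" by simp_all
      \<comment> \<open>The last three members of a longer chain suffice: the middle one is a
        nonzero prime strictly inside \<open>P\<close>.\<close>
      have "Q (Suc m) \<noteq> {0}" using a b SpecD(4)[of "Q m"] by auto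
      then show False using a b P by auto
    qed
    then have "Sup ?H \<le> 1" by (intro Sup_least) (auto simp: one_enat_def)
    ultimately show "P \<in> height_one_primes" using P by (simp add: height_one_primes_def H)
  qed
qed

lemma height_one_primesD:
  assumes "P \<in> height_one_primes"
  shows "P \<in> Spec ring_of_type" "P \<noteq> {0}" "\<exists>a\<in>P. a \<noteq> 0"
    "Q \<in> Spec ring_of_type \<Longrightarrow> Q \<noteq> {0} \<Longrightarrow> Q \<subseteq> P \<Longrightarrow> Q = P"
  using assms SpecD(4)[of P] by (auto simp: height_one_primes_iff)

section \<open>Noetherian normal domains\<close>

locale noetherian_normal_domain =
  fixes ty :: "'a::idom itself"
  assumes noetherian: "noetherian_ring (ring_of_type :: 'a ring)"
    and normal: "normal_domain TYPE('a)"
begin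

text \<open>By the noetherian condition a nonempty chain of ideals contains its own union, so Zorn's
  lemma applies to every nonempty family of ideals. The noetherian inductions below all start
  here.\<close>

lemma maximal_ideal_in_family:
  fixes F :: "'a set set"
  assumes "F \<noteq> {}" and F: "\<And>I. I \<in> F \<Longrightarrow> ideal I ring_of_type"
  obtains M where "M \<in> F" "\<And>I. I \<in> F \<Longrightarrow> M \<subseteq> I \<Longrightarrow> I = M"
proof -
  have "\<exists>U\<in>F. \<forall>X\<in>C. X \<subseteq> U" if C: "subset.chain F C" for C
  proof (cases "C = {}")
    case False
    have "subset.chain {I. ideal I (ring_of_type :: 'a ring)} C"
      using C F by (auto simp: subset.chain_def)
    then have "\<Union>C \<in> C"
      using noetherian_ring.ideal_chain_is_trivial[OF noetherian False] by blast
    then show ?thesis using C by (auto simp: subset.chain_def)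
  qed (use \<open>F \<noteq> {}\<close> in auto)
  from subset_Zorn[OF this] obtain M where "M \<in> F" "\<forall>X\<in>F. M \<subseteq> X \<longrightarrow> X = M" by blast
  then show thesis using that by blast
qed

text \<open>Generation is expressed by minimality because that is how it is used: a divisibility
  checked on \<open>S\<close> extends to \<open>I\<close> through a colon ideal
  \<open>{r. a dvd r * c}\<close>.\<close>

lemma ideal_finitely_generated:
  fixes I :: "'a set"
  assumes "ideal I ring_of_type"
  obtains S where "finite S" "S \<subseteq> I" "\<And>J. ideal J ring_of_type \<Longrightarrow> S \<subseteq> J \<Longrightarrow> I \<subseteq> J"
proof -
  interpret noetherian_ring "ring_of_type :: 'a ring" by (rule noetherian)
  obtain S where S: "finite S" "I = Idl\<^bsub>ring_of_type\<^esub> S" using finetely_gen[OF assms] by blast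
  have "S \<subseteq> I" using genideal_self[of S] S by simp
  moreover have "I \<subseteq> J" if "ideal J ring_of_type" "S \<subseteq> J" for J
    using genideal_minimal[of J S] that S by simp
  ultimately show thesis using that S(1) by blast
qed

text \<open>The values at \<open>x\<close> of polynomials of degree at most n, multiplied by
  \<open>a\<close>, give an ascending chain of ideals. Once it stabilizes, \<open>x ^ Suc n\<close>
  equals a polynomial of lower degree in \<open>x\<close>, which is a monic equation.\<close>

lemma integral_if_powers_bounded:
  assumes "a \<noteq> (0::'a)" and bd: "\<And>n. x ^ n * to_fract a \<in> range to_fract"
  shows "x \<in> range to_fract"
proof -
  define I where "I n = {b :: 'a. \<exists>p :: 'a poly. degree p \<le> n \<and>
    to_fract b = poly (map_poly to_fract p) x * to_fract a}" for n
  have map_add: "map_poly to_fract (p + q) = map_poly to_fract p + map_poly to_fract q" for p q :: "'a poly"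
    by (rule poly_eqI) (simp add: coeff_map_poly)
  have map_smult: "map_poly to_fract (smult c p) = smult (to_fract c) (map_poly to_fract p)" for c and p :: "'a poly"
    by (rule poly_eqI) (simp add: coeff_map_poly)
  have ideal: "ideal (I n) ring_of_type" for n
  proof (rule ideal_ring_of_typeI)
    show "0 \<in> I n" by (auto simp: I_def intro!: exI[of _ 0])
    show "u + v \<in> I n" if "u \<in> I n" "v \<in> I n" for u v
    proof -
      obtain p q where "degree p \<le> n" "to_fract u = poly (map_poly to_fract p) x * to_fract a"
        "degree q \<le> n" "to_fract v = poly (map_poly to_fract q) x * to_fract a"
        using \<open>u \<in> I n\<close> \<open>v \<in> I n\<close> by (auto simp: I_def)
      then show ?thesis unfolding I_def
        by (auto simp: map_add algebra_simps degree_add_le intro!: exI[of _ "p + q"])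
    qed
    show "r * u \<in> I n" if "u \<in> I n" for r u
    proof -
      obtain p where "degree p \<le> n" "to_fract u = poly (map_poly to_fract p) x * to_fract a"
        using \<open>u \<in> I n\<close> by (auto simp: I_def)
      then show ?thesis unfolding I_def
        by (auto simp: map_smult algebra_simps degree_smult_le intro!: exI[of _ "smult r p"] order_trans[OF degree_smult_le])
    qed
  qed
  obtain M where "M \<in> range I" and max: "\<And>J. J \<in> range I \<Longrightarrow> M \<subseteq> J \<Longrightarrow> J = M"
    using maximal_ideal_in_family[of "range I"] ideal by blast
  then obtain n where M: "M = I n" by blast
  have "I n \<subseteq> I (Suc n)" by (force simp: I_def)
  then have eq: "I (Suc n) = I n" using max M by blast
  obtain b where b: "to_fract b = x ^ Suc n * to_fract a" using bd[of "Suc n"] by auto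
  then have "b \<in> I (Suc n)"
    by (auto simp: I_def map_poly_monom poly_monom degree_monom_le intro!: exI[of _ "monom 1 (Suc n)"])
  then obtain p where p: "degree p \<le> n" "to_fract b = poly (map_poly to_fract p) x * to_fract a"
    using eq by (auto simp: I_def)
  \<comment> \<open>This stays monic because \<open>p\<close> has degree at most n.\<close>
  define q where "q = monom 1 (Suc n) + smult (- 1) p"
  have "poly (map_poly to_fract p) x = x ^ Suc n" using b p(2) \<open>a \<noteq> 0\<close> by simp
  then have "poly (map_poly to_fract q) x = 0"
    unfolding q_def map_add map_smult by (simp add: map_poly_monom poly_monom)
  moreover have "degree q = Suc n"
    unfolding q_def using p(1) by (subst degree_add_eq_left) (auto simp: degree_monom_eq)
  then have "lead_coeff q = 1" using p(1) by (simp add: q_def coeff_eq_0)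
  ultimately show ?thesis using normal unfolding normal_domain_def by blast
qed

subsection \<open>Associated primes of principal ideals\<close>

lemma ideal_colon: "ideal {r::'a. a dvd r * b} ring_of_type"
  by (rule ideal_ring_of_typeI) (auto simp: distrib_right mult.assoc)

text \<open>Among the colon ideals \<open>(a : b * c)\<close> that miss the multiplicative set
  \<open>T\<close>, a maximal one is prime. The uses take \<open>T\<close> as \<open>{1}\<close> or
  as the complement of a prime.\<close>

lemma associated_prime_exists:
  assumes "1 \<in> T" and T: "\<And>s t. s \<in> T \<Longrightarrow> t \<in> T \<Longrightarrow> s * t \<in> T"
    and b: "\<And>t. t \<in> T \<Longrightarrow> \<not> (a::'a) dvd t * b"
  obtains c where "{r. a dvd r * (b * c)} \<in> Spec ring_of_type" "{r. a dvd r * (b * c)} \<inter> T = {}"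
proof -
  define colon where "colon c = {r. a dvd r * (b * c)}" for c
  define F where "F = {colon c | c. colon c \<inter> T = {}}"
  have "colon 1 \<inter> T = {}" using b by (auto simp: colon_def)
  then have "colon 1 \<in> F" unfolding F_def by blast
  moreover have "ideal I ring_of_type" if "I \<in> F" for I
    using that ideal_colon unfolding F_def colon_def by blast
  ultimately obtain M where "M \<in> F" and max: "\<And>I. I \<in> F \<Longrightarrow> M \<subseteq> I \<Longrightarrow> I = M"
    using maximal_ideal_in_family[of F] by blast
  then obtain c where c: "M = colon c" "colon c \<inter> T = {}" by (auto simp: F_def)
  \<comment> \<open>The ideal of \<open>c * d\<close> contains that of \<open>c\<close> and also
    \<open>y\<close>, so by maximality it must meet \<open>T\<close>.\<close>
  have enlarge: "\<exists>t\<in>T. d * t \<in> colon c" if "y * d \<in> colon c" "y \<notin> colon c" for y d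
  proof (rule ccontr)
    assume no: "\<not> ?thesis"
    have mem: "r \<in> colon (c * d) \<longleftrightarrow> r * d \<in> colon c" for r
      by (simp add: colon_def mult_ac)
    have "colon (c * d) \<in> F" using no by (auto simp: F_def mem mult.commute intro!: exI[of _ "c * d"])
    moreover have "colon c \<subseteq> colon (c * d)"
      by (auto simp: colon_def mult.assoc[symmetric] intro: dvd_mult2)
    ultimately have "colon (c * d) = colon c" using max c by blast
    then show False using that mem by blast
  qed
  have "colon c \<in> Spec ring_of_type"
    unfolding Spec_ring_of_type_iff
  proof (intro conjI allI impI)
    show "ideal (colon c) ring_of_type" unfolding colon_def by (rule ideal_colon)
    show "1 \<notin> colon c" using c(2) \<open>1 \<in> T\<close> by blast
    fix x y assume xy: "x * y \<in> colon c"
    show "x \<in> colon c \<or> y \<in> colon c"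
    proof (rule ccontr)
      assume n: "\<not> ?thesis"
      \<comment> \<open>\<open>enlarge\<close> is applied twice, trading first \<open>x\<close> and
        then \<open>y\<close> for an element of \<open>T\<close>.\<close>
      then obtain t where t: "t \<in> T" "y * t \<in> colon c" using enlarge[of x y] xy by blast
      then obtain s where "s \<in> T" "t * s \<in> colon c" using enlarge[of y t] n by (auto simp: mult.commute)
      then show False using t T c(2) by blast
    qed
  qed
  then show thesis using that c(2) unfolding colon_def by blast
qed

text \<open>Some associated prime of \<open>a\<close> avoids the complement of \<open>P\<close>,
  that is, lies inside \<open>P\<close>; it contains \<open>a\<close>, so minimality makes it equal
  to \<open>P\<close>.\<close>

lemma height_one_associated:
  assumes P: "P \<in> height_one_primes" and a: "(a::'a) \<in> P" "a \<noteq> 0"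
  obtains b where "P = {r. a dvd r * b}"
proof -
  note PS = height_one_primesD(1)[OF P]
  have "\<not> a dvd t * 1" if "t \<in> - P" for t
    using that a(1) SpecD(7)[OF PS] by (auto elim: dvdE)
  then obtain c where c: "{r. a dvd r * (1 * c)} \<in> Spec ring_of_type" "{r. a dvd r * (1 * c)} \<inter> - P = {}"
    using associated_prime_exists[of "- P" a 1] Spec_mult_notin[OF PS] SpecD(2)[OF PS] by auto
  have "a \<in> {r. a dvd r * (1 * c)}" by simp
  then have "{r. a dvd r * (1 * c)} = P"
    using c height_one_primesD(4)[OF P c(1)] a(2) by blast
  then show thesis using that by auto
qed

text \<open>If \<open>b/a\<close> mapped \<open>P\<close> into itself, it would be integral over \<open>A\<close>; hence it maps some
  element of \<open>P\<close> to a unit of \<open>A\<^sub>P\<close>.\<close>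

lemma associated_prime_uniformizer:
  assumes PS: "P \<in> Spec ring_of_type" and P: "P = {r::'a. a dvd r * b}" and a: "a \<noteq> 0"
  obtains \<pi> where "\<pi> \<in> P" "\<pi> \<noteq> 0" "\<And>p. p \<in> P \<Longrightarrow> \<exists>s. s \<notin> P \<and> \<pi> dvd s * p"
proof -
  define x where "x = Fract b a"
  have ax: "x * to_fract a = to_fract b" using a by (simp add: x_def Fract_conv_to_fract)
  have "\<exists>p\<in>P. \<exists>r. r \<notin> P \<and> p * b = a * r"
  proof (rule ccontr)
    assume n: "\<not> ?thesis"
    \<comment> \<open>The powers of \<open>x\<close> keep \<open>a\<close> inside \<open>P\<close>,
      so \<open>a\<close> is a common denominator for all of them.\<close>
    have "\<exists>r\<in>P. x ^ k * to_fract a = to_fract r" for k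
    proof (induction k)
      case 0 then show ?case using P by auto
    next
      case (Suc k)
      then obtain r where r: "r \<in> P" "x ^ k * to_fract a = to_fract r" by blast
      then obtain r' where r': "r * b = a * r'" using P by (auto elim: dvdE)
      have "x ^ Suc k * to_fract a * to_fract a = to_fract r * to_fract b"
        using r(2) ax by (simp add: ax[symmetric] mult_ac)
      also have "\<dots> = to_fract r' * to_fract a" using r' by (metis to_fract_mult mult.commute)
      finally have "x ^ Suc k * to_fract a = to_fract r'" using a by simp
      moreover have "r' \<in> P" using n r(1) r' by blast
      ultimately show ?case by blast
    qed
    then have "x \<in> range to_fract" using integral_if_powers_bounded[OF a] by blast
    then obtain c where "x = to_fract c" by blast
    then have "to_fract (c * a) = to_fract b" using ax by simp
    then have "1 * b = a * c" by (metis to_fract_eq_iff mult.commute mult_1)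
    then have "1 \<in> P" using P by auto
    then show False using SpecD(2)[OF PS] by blast
  qed
  then obtain \<pi> r where pi: "\<pi> \<in> P" "r \<notin> P" "\<pi> * b = a * r" by blast
  have "r \<noteq> 0" using pi SpecD(4)[OF PS] by blast
  then have "\<pi> \<noteq> 0" using pi a by auto
  moreover have "\<exists>s. s \<notin> P \<and> \<pi> dvd s * p" if p: "p \<in> P" for p
  proof -
    \<comment> \<open>The witness is \<open>s = r\<close>: from \<open>p * b = a * c\<close> and
      \<open>\<pi> * b = a * r\<close>, cancelling \<open>a\<close> gives
      \<open>r * p = \<pi> * c\<close>.\<close>
    obtain c where "p * b = a * c" using p P by (auto elim: dvdE)
    moreover have "a * (r * p) = (a * r) * p" "\<pi> * b * p = \<pi> * (p * b)" "\<pi> * (a * c) = a * (\<pi> * c)"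
      by (simp_all only: mult_ac)
    ultimately have "a * (r * p) = a * (\<pi> * c)" using pi(3) by simp
    then have "r * p = \<pi> * c" using a by simp
    then show ?thesis using pi by auto
  qed
  ultimately show thesis using that pi by blast
qed

text \<open>Dividing by \<open>\<pi>\<close> must come to an end: among the nonzero elements that
  are not a power of \<open>\<pi>\<close> up to factors outside \<open>P\<close>, take one with
  maximal local ideal. Its quotient by \<open>\<pi>\<close> is another one with the same ideal,
  which would make \<open>\<pi>\<close> a unit at \<open>P\<close>.\<close>

lemma order_exists:
  assumes PS: "P \<in> Spec ring_of_type" and pi: "\<pi> \<in> P" "\<pi> \<noteq> (0::'a)"
    "\<And>p. p \<in> P \<Longrightarrow> \<exists>s. s \<notin> P \<and> \<pi> dvd s * p" and "r \<noteq> 0"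
  shows "\<exists>n s t. s \<notin> P \<and> t \<notin> P \<and> s * r = t * \<pi> ^ n"
proof (rule ccontr)
  let ?bad = "\<lambda>r. r \<noteq> 0 \<and> \<not> (\<exists>n s t. s \<notin> P \<and> t \<notin> P \<and> s * r = t * \<pi> ^ n)"
  \<comment> \<open>The contraction to A of the principal ideal generated by \<open>q\<close> in the
    localization at \<open>P\<close>.\<close>
  define J where "J q = {r. \<exists>s. s \<notin> P \<and> q dvd s * r}" for q
  have idl: "ideal (J q) ring_of_type" for q
  proof (rule ideal_ring_of_typeI)
    show "0 \<in> J q" using SpecD(2)[OF PS] by (auto simp: J_def)
    show "u + v \<in> J q" if uv: "u \<in> J q" "v \<in> J q" for u v
    proof -
      obtain s where s: "s \<notin> P" "q dvd s * u" using uv(1) unfolding J_def by blast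
      obtain t where t: "t \<notin> P" "q dvd t * v" using uv(2) unfolding J_def by blast
      have "q dvd t * (s * u) + s * (t * v)" using s t by (intro dvd_add dvd_mult[OF s(2)] dvd_mult[OF t(2)])
      then have "q dvd (s * t) * (u + v)" by (simp add: algebra_simps)
      then show ?thesis using Spec_mult_notin[OF PS s(1) t(1)] unfolding J_def by blast
    qed
    show "r * u \<in> J q" if "u \<in> J q" for r u
      using that by (auto simp: J_def) (metis dvd_mult mult.left_commute)
  qed
  assume "\<not> ?thesis"
  with \<open>r \<noteq> 0\<close> have "J ` {q. ?bad q} \<noteq> {}" by blast
  then obtain M where "M \<in> J ` {q. ?bad q}" and max: "\<And>I. I \<in> J ` {q. ?bad q} \<Longrightarrow> M \<subseteq> I \<Longrightarrow> I = M"
    by (rule maximal_ideal_in_family[of "J ` {q. ?bad q}"]) (use idl in blast)+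
  then obtain q where q: "M = J q" "?bad q" by blast
  have "q \<in> P"
  proof (rule ccontr)
    assume "q \<notin> P"
    moreover have "1 * q = q * \<pi> ^ 0" by simp
    ultimately show False using q(2) SpecD(2)[OF PS] by blast
  qed
  then obtain s where "s \<notin> P" "\<pi> dvd s * q" using pi(3) by blast
  then obtain c where s: "s \<notin> P" "s * q = \<pi> * c" by (auto elim: dvdE)
  have "?bad c"
  proof (intro conjI notI)
    assume "c = 0" then show False using s q(2) SpecD(4)[OF PS] by auto
  next
    assume "\<exists>n s t. s \<notin> P \<and> t \<notin> P \<and> s * c = t * \<pi> ^ n"
    then obtain n s' t where "s' \<notin> P" "t \<notin> P" "s' * c = t * \<pi> ^ n" by blast
    moreover have "(s' * s) * q = t * \<pi> ^ Suc n"
    proof -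
      have "(s' * s) * q = \<pi> * (s' * c)" using s(2) by (simp only: mult.assoc mult.left_commute)
      also have "\<dots> = t * \<pi> ^ Suc n" using \<open>s' * c = t * \<pi> ^ n\<close> by (simp add: mult_ac)
      finally show ?thesis .
    qed
    ultimately show False using q(2) s(1) Spec_mult_notin[OF PS] by blast
  qed
  moreover have "J q \<subseteq> J c"
  proof
    fix r assume "r \<in> J q"
    then obtain t where t: "t \<notin> P" "q dvd t * r" by (auto simp: J_def)
    have "c dvd s * q" using s by simp
    then have "c dvd s * (t * r)" using t(2) by (meson dvd_trans mult_dvd_mono dvd_refl)
    then show "r \<in> J c" using Spec_mult_notin[OF PS s(1) t(1)] by (auto simp: J_def mult.assoc)
  qed
  ultimately have "J c = J q" using max q by blast
  moreover have "c \<in> J c" using SpecD(2)[OF PS] by (auto simp: J_def)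
  ultimately have "\<exists>t. t \<notin> P \<and> q dvd t * c" unfolding J_def by blast
  then obtain t where "t \<notin> P" "q dvd t * c" by blast
  then obtain k where t: "t \<notin> P" "t * c = q * k" by (auto elim: dvdE)
  \<comment> \<open>Cancelling \<open>q\<close> in the combination of
    \<open>s * q = \<pi> * c\<close> and \<open>t * c = q * k\<close> puts \<open>s * t\<close> into
    \<open>P\<close>.\<close>
  have "q * (s * t) = q * (\<pi> * k)" 
  proof -
    have "q * (s * t) = (s * q) * t" by (simp add: mult_ac)
    also have "\<dots> = \<pi> * (t * c)" using s by (simp add: mult_ac)
    also have "\<dots> = q * (\<pi> * k)" using t by (simp add: mult_ac)
    finally show ?thesis .
  qed
  then have "s * t = \<pi> * k" using q(2) by simp
  then show False using Spec_mult_notin[OF PS s(1) t(1)] SpecD(7)[OF PS pi(1)] by simp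
qed

text \<open>The localization at \<open>P\<close> is a discrete valuation ring: a nonzero element of
  a smaller prime \<open>Q\<close> is a power of \<open>\<pi>\<close> up to factors outside
  \<open>P\<close>, so a nonzero \<open>Q\<close> contains \<open>\<pi>\<close> and then all of
  \<open>P\<close>.\<close>

lemma associated_prime_height_one:
  assumes PS: "P \<in> Spec ring_of_type" and P: "P = {r::'a. a dvd r * b}" and a: "a \<noteq> 0"
  shows "P \<in> height_one_primes"
proof -
  obtain \<pi> where pi: "\<pi> \<in> P" "\<pi> \<noteq> 0" "\<And>p. p \<in> P \<Longrightarrow> \<exists>s. s \<notin> P \<and> \<pi> dvd s * p"
    using associated_prime_uniformizer[OF PS P a] by blast
  have "Q = P" if Q: "Q \<in> Spec ring_of_type" "Q \<noteq> {0}" "Q \<subseteq> P" for Q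
  proof -
    obtain q where q: "q \<in> Q" "q \<noteq> 0" using Q SpecD(4)[OF Q(1)] by blast
    obtain n s t where st: "s \<notin> P" "t \<notin> P" "s * q = t * \<pi> ^ n"
      using order_exists[OF PS pi q(2)] by blast
    have "t * \<pi> ^ n \<in> Q" using st(3) SpecD(6)[OF Q(1) q(1)] by metis
    then have "\<pi> ^ n \<in> Q" using SpecD(3)[OF Q(1)] st(2) Q(3) by blast
    then have piQ: "\<pi> \<in> Q" using Spec_power_notin[OF Q(1)] by blast
    have "p \<in> Q" if p: "p \<in> P" for p
    proof -
      obtain s where "s \<notin> P" "\<pi> dvd s * p" using pi(3)[OF p] by blast
      moreover from this have "s * p \<in> Q" using SpecD(7)[OF Q(1) piQ] by (auto elim: dvdE)
      ultimately show ?thesis using SpecD(3)[OF Q(1)] Q(3) by blast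
    qed
    then show ?thesis using Q(3) by blast
  qed
  moreover have "P \<noteq> {0}" using pi by blast
  ultimately show ?thesis using PS by (auto simp: height_one_primes_iff)
qed

text \<open>A failure of \<open>a dvd b\<close> is witnessed by an associated prime of
  \<open>a\<close>, which has height one, so the failure already shows in one localization.\<close>

lemma hartogs_dvd:
  assumes "a \<noteq> (0::'a)" and "\<And>P. P \<in> height_one_primes \<Longrightarrow> \<exists>s. s \<notin> P \<and> a dvd s * b"
  shows "a dvd b"
proof (rule ccontr)
  assume "\<not> a dvd b"
  then obtain c where c: "{r. a dvd r * (b * c)} \<in> Spec ring_of_type"
    using associated_prime_exists[of "{1}" a b] by auto
  from associated_prime_height_one[OF this refl assms(1)] assms(2)
  obtain s where "\<not> a dvd s * (b * c)" "a dvd s * b" by blast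
  then show False by (metis dvd_mult2 mult.assoc)
qed

text \<open>By noetherian induction every ideal has finitely many primes over it such that each
  prime over it contains one of them. For the principal ideal of \<open>a\<close>, these include all
  height one primes that contain \<open>a\<close>.\<close>

lemma finite_height_one_primes_containing:
  assumes "a \<noteq> (0::'a)"
  shows "finite {P \<in> height_one_primes. a \<in> P}"
proof -
  define good where "good I \<longleftrightarrow> (\<exists>S. finite S \<and> S \<subseteq> Spec ring_of_type \<and> (\<forall>Q\<in>S. I \<subseteq> Q) \<and>
    (\<forall>P\<in>Spec ring_of_type. I \<subseteq> P \<longrightarrow> (\<exists>Q\<in>S. Q \<subseteq> P)))" for I :: "'a set"
  have all_good: "good I" if I: "ideal I ring_of_type" for I :: "'a set"
  proof (rule ccontr)
    assume "\<not> good I"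
    then have "{I. ideal I ring_of_type \<and> \<not> good I} \<noteq> {}" using I by blast
    then obtain M where "M \<in> {I. ideal I ring_of_type \<and> \<not> good I}"
      and max: "\<And>I. I \<in> {I. ideal I ring_of_type \<and> \<not> good I} \<Longrightarrow> M \<subseteq> I \<Longrightarrow> I = M"
      by (rule maximal_ideal_in_family[of "{I. ideal I ring_of_type \<and> \<not> good I}"]) blast+
    then have M: "ideal M ring_of_type" "\<not> good M" by auto
    have "1 \<notin> M"
    proof
      assume "1 \<in> M"
      then have "good M" unfolding good_def using SpecD(2) by (intro exI[of _ "{}"]) auto
      then show False using M by blast
    qed
    moreover have "M \<notin> Spec ring_of_type"
    proof
      assume "M \<in> Spec ring_of_type"
      then have "good M" unfolding good_def by (intro exI[of _ "{M}"]) auto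
      then show False using M by blast
    qed
    ultimately obtain x y where xy: "x * y \<in> M" "x \<notin> M" "y \<notin> M"
      using M(1) by (auto simp: Spec_ring_of_type_iff)
    \<comment> \<open>The ideal \<open>M + (z)\<close> is strictly larger than \<open>M\<close>,
      hence good.\<close>
    have ext: "good {m + r * z | m r. m \<in> M}" (is "good ?E") if "z \<notin> M" for z
    proof (rule ccontr)
      assume ng: "\<not> good ?E"
      have "ideal ?E ring_of_type"
      proof (rule ideal_ring_of_typeI)
        show "0 \<in> ?E" using ideal_ring_of_typeD(1)[OF M(1)] by (auto intro!: exI[of _ 0])
        show "u + v \<in> ?E" if uv: "u \<in> ?E" "v \<in> ?E" for u v
        proof -
          obtain m r m' r' where "u = m + r * z" "v = m' + r' * z" "m \<in> M" "m' \<in> M" using uv by blast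
          then have "u + v = (m + m') + (r + r') * z" "m + m' \<in> M"
            using ideal_ring_of_typeD(2)[OF M(1)] by (auto simp: algebra_simps)
          then show ?thesis by blast
        qed
        show "k * u \<in> ?E" if u: "u \<in> ?E" for k u
        proof -
          obtain m r where "u = m + r * z" "m \<in> M" using u by blast
          then have "k * u = k * m + (k * r) * z" "k * m \<in> M"
            using ideal_ring_of_typeD(3)[OF M(1)] by (simp_all add: distrib_left mult.assoc)
          then show ?thesis by blast
        qed
      qed
      moreover have "M \<subseteq> ?E" by (force intro: exI[of _ 0])
      ultimately have "?E = M" using max ng by blast
      moreover have "z \<in> ?E" using ideal_ring_of_typeD(1)[OF M(1)] by (force intro: exI[of _ 0] exI[of _ 1])
      ultimately show False using that by blast
    qed
    obtain S where S: "finite S" "S \<subseteq> Spec ring_of_type" "\<forall>Q\<in>S. {m + r * x | m r. m \<in> M} \<subseteq> Q"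
      "\<forall>P\<in>Spec ring_of_type. {m + r * x | m r. m \<in> M} \<subseteq> P \<longrightarrow> (\<exists>Q\<in>S. Q \<subseteq> P)"
      using ext[OF xy(2)] unfolding good_def by blast
    obtain S' where S': "finite S'" "S' \<subseteq> Spec ring_of_type" "\<forall>Q\<in>S'. {m + r * y | m r. m \<in> M} \<subseteq> Q"
      "\<forall>P\<in>Spec ring_of_type. {m + r * y | m r. m \<in> M} \<subseteq> P \<longrightarrow> (\<exists>Q\<in>S'. Q \<subseteq> P)"
      using ext[OF xy(3)] unfolding good_def by blast
    have sub: "M \<subseteq> {m + r * z | m r. m \<in> M}" for z by (force intro: exI[of _ 0])
    have "\<exists>Q\<in>S \<union> S'. Q \<subseteq> P" if P: "P \<in> Spec ring_of_type" "M \<subseteq> P" for P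
    proof -
      have sub: "{m + r * z | m r. m \<in> M} \<subseteq> P" if "z \<in> P" for z
        using that P(2) SpecD(5,6)[OF P(1)] by blast
      have "x \<in> P \<or> y \<in> P" using xy(1) P SpecD(3)[OF P(1)] by blast
      then show ?thesis
      proof
        assume "x \<in> P"
        from S(4)[rule_format, OF P(1) sub[OF this]] show ?thesis by blast
      next
        assume "y \<in> P"
        from S'(4)[rule_format, OF P(1) sub[OF this]] show ?thesis by blast
      qed
    qed
    moreover have "\<forall>Q\<in>S \<union> S'. M \<subseteq> Q" 
    proof
      fix Q assume "Q \<in> S \<union> S'"
      then show "M \<subseteq> Q"
      proof
        assume "Q \<in> S"
        with S(3) have "{m + r * x | m r. m \<in> M} \<subseteq> Q" by (rule bspec)
        then show ?thesis by (rule order_trans[OF sub])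
      next
        assume "Q \<in> S'"
        with S'(3) have "{m + r * y | m r. m \<in> M} \<subseteq> Q" by (rule bspec)
        then show ?thesis by (rule order_trans[OF sub])
      qed
    qed
    ultimately have "good M" unfolding good_def using S(1,2) S'(1,2)
      by (intro exI[of _ "S \<union> S'"]) simp
    then show False using M(2) by blast
  qed
  have idl: "ideal {r. a dvd r * 1} ring_of_type" by (rule ideal_colon)
  obtain S where S: "finite S" "S \<subseteq> Spec ring_of_type" "\<forall>Q\<in>S. {r. a dvd r * 1} \<subseteq> Q"
    "\<forall>P\<in>Spec ring_of_type. {r. a dvd r * 1} \<subseteq> P \<longrightarrow> (\<exists>Q\<in>S. Q \<subseteq> P)"
    using all_good[OF idl] unfolding good_def by blast
  have "P \<in> S" if P: "P \<in> height_one_primes" "a \<in> P" for P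
  proof -
    note PS = height_one_primesD(1)[OF P(1)]
    have "{r. a dvd r * 1} \<subseteq> P" using SpecD(7)[OF PS P(2)] by (auto elim: dvdE)
    then obtain Q where Q: "Q \<in> S" "Q \<subseteq> P" using S(4) PS by blast
    then have "Q \<in> Spec ring_of_type" "{r. a dvd r * 1} \<subseteq> Q" using S(2,3) by blast+
    then have "Q \<in> Spec ring_of_type" "a \<in> Q" by auto
    then show ?thesis using height_one_primesD(4)[OF P(1), of Q] Q assms by auto
  qed
  then show ?thesis using S(1) by (auto intro: finite_subset[of _ S])
qed

end

section \<open>Stalks of the structure sheaf\<close>

context primeideal
begin

lemma one_notin: "\<one> \<notin> I"
  using I_notcarr one_imp_carrier by blast

lemma mult_notin: "s \<in> carrier R - I \<Longrightarrow> t \<in> carrier R - I \<Longrightarrow> s \<otimes> t \<in> carrier R - I"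
  using I_prime by auto

text \<open>Subtraction is removed so that associativity and commutativity settle most identities
  between representatives.\<close>

lemma fraction_rel_iff:
  "((a, s), (b, t)) \<in> fraction_rel R I \<longleftrightarrow>
     a \<in> carrier R \<and> b \<in> carrier R \<and> s \<in> carrier R - I \<and> t \<in> carrier R - I \<and>
     (\<exists>u \<in> carrier R - I. u \<otimes> (a \<otimes> t) = u \<otimes> (b \<otimes> s))"
proof -
  have "u \<otimes> (x \<ominus> y) = \<zero> \<longleftrightarrow> u \<otimes> x = u \<otimes> y"
    if c: "u \<in> carrier R" "x \<in> carrier R" "y \<in> carrier R" for u x y
  proof -
    have "u \<otimes> (x \<ominus> y) = u \<otimes> x \<ominus> u \<otimes> y" using c by (simp add: minus_eq r_distr r_minus)
    then show ?thesis using c r_right_minus_eq[of "u \<otimes> x" "u \<otimes> y"] by simp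
  qed
  then show ?thesis by (auto simp: fraction_rel_def)
qed

lemma fraction_rel_equiv: "equiv (carrier R \<times> (carrier R - I)) (fraction_rel R I)"
proof (rule equivI)
  show "fraction_rel R I \<subseteq> (carrier R \<times> (carrier R - I)) \<times> (carrier R \<times> (carrier R - I))"
    by (auto simp: fraction_rel_iff)
  show "refl_on (carrier R \<times> (carrier R - I)) (fraction_rel R I)"
    using one_notin by (auto simp: refl_on_def fraction_rel_iff)
  show "sym (fraction_rel R I)"
  proof (rule symI)
    fix x y assume xy: "(x, y) \<in> fraction_rel R I"
    obtain a s b t where xyz: "x = (a, s)" "y = (b, t)" by (cases x; cases y)
    show "(y, x) \<in> fraction_rel R I"
      using xy unfolding xyz fraction_rel_iff by (metis (no_types))
  qed
  show "trans (fraction_rel R I)"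
  proof (rule transI)
    fix x y z assume xy: "(x, y) \<in> fraction_rel R I" and yz: "(y, z) \<in> fraction_rel R I"
    obtain a s b t c r where xyz: "x = (a, s)" "y = (b, t)" "z = (c, r)" by (cases x; cases y; cases z)
    obtain u where u: "u \<in> carrier R - I" "u \<otimes> (a \<otimes> t) = u \<otimes> (b \<otimes> s)"
      using xy xyz by (auto simp: fraction_rel_iff)
    obtain v where v: "v \<in> carrier R - I" "v \<otimes> (b \<otimes> r) = v \<otimes> (c \<otimes> t)"
      using yz xyz by (auto simp: fraction_rel_iff)
    have c: "a \<in> carrier R" "b \<in> carrier R" "c \<in> carrier R" "s \<in> carrier R - I" "t \<in> carrier R - I"
      "r \<in> carrier R - I" using xy yz xyz by (auto simp: fraction_rel_iff)
    \<comment> \<open>The factor \<open>t\<close> is there to pass through the denominator of the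
      middle fraction.\<close>
    have "(u \<otimes> v \<otimes> t) \<otimes> (a \<otimes> r) = (v \<otimes> r) \<otimes> (u \<otimes> (a \<otimes> t))" using c u(1) v(1) by (simp add: m_ac)
    also have "\<dots> = (u \<otimes> s) \<otimes> (v \<otimes> (b \<otimes> r))" unfolding u(2) using c u(1) v(1) by (simp add: m_ac)
    also have "\<dots> = (u \<otimes> v \<otimes> t) \<otimes> (c \<otimes> s)" unfolding v(2) using c u(1) v(1) by (simp add: m_ac)
    finally have "(u \<otimes> v \<otimes> t) \<otimes> (a \<otimes> r) = (u \<otimes> v \<otimes> t) \<otimes> (c \<otimes> s)" .
    moreover have "u \<otimes> v \<otimes> t \<in> carrier R - I" using mult_notin u(1) v(1) c by blast
    ultimately show "(x, z) \<in> fraction_rel R I" using c xyz by (auto simp: fraction_rel_iff)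
  qed
qed

lemma fraction_mem: "(b, t) \<in> fraction R I a s \<longleftrightarrow> ((a, s), (b, t)) \<in> fraction_rel R I"
  by (simp add: fraction_def)

lemma fraction_eqI:
  "((a, s), (b, t)) \<in> fraction_rel R I \<Longrightarrow> fraction R I a s = fraction R I b t"
  unfolding fraction_def by (rule equiv_class_eq[OF fraction_rel_equiv])

lemma fraction_self: "a \<in> carrier R \<Longrightarrow> s \<in> carrier R - I \<Longrightarrow> (a, s) \<in> fraction R I a s"
  using one_notin by (auto simp: fraction_mem fraction_rel_iff)

lemma fraction_cancel:
  "a \<in> carrier R \<Longrightarrow> s \<in> carrier R - I \<Longrightarrow> t \<in> carrier R - I \<Longrightarrow>
     fraction R I (t \<otimes> a) (t \<otimes> s) = fraction R I a s"
  using one_notin mult_notin[of t s]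
  by (intro fraction_eqI) (auto simp: fraction_rel_iff m_ac intro!: bexI[of _ \<one>])

lemma carrier_stalk: "carrier (stalk R I) = {fraction R I a s | a s. a \<in> carrier R \<and> s \<in> carrier R - I}"
  by (auto simp: stalk_def fraction_def quotient_def)

lemma stalk_one: "\<one>\<^bsub>stalk R I\<^esub> = fraction R I \<one> \<one>"
  by (simp add: stalk_def)

text \<open>The stalk operations are unions over all pairs of representatives; \<open>cong\<close>
  says that all sets in the union coincide.\<close>

lemma fraction_union:
  assumes a: "a \<in> carrier R" "s \<in> carrier R - I" and b: "b \<in> carrier R" "t \<in> carrier R - I"
    and cong: "\<And>a' s' b' t'. ((a, s), (a', s')) \<in> fraction_rel R I \<Longrightarrow>
      ((b, t), (b', t')) \<in> fraction_rel R I \<Longrightarrow> F a' s' b' t' = F a s b t"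
  shows "(\<Union>(a, s)\<in>fraction R I a s. \<Union>(b, t)\<in>fraction R I b t. F a s b t) = F a s b t"
proof (intro equalityI subsetI)
  fix x assume "x \<in> (\<Union>(a, s)\<in>fraction R I a s. \<Union>(b, t)\<in>fraction R I b t. F a s b t)"
  then obtain a' s' b' t' where "(a', s') \<in> fraction R I a s" "(b', t') \<in> fraction R I b t" "x \<in> F a' s' b' t'"
    by blast
  then show "x \<in> F a s b t" using cong[of a' s' b' t'] by (simp add: fraction_mem)
next
  fix x assume "x \<in> F a s b t"
  then show "x \<in> (\<Union>(a, s)\<in>fraction R I a s. \<Union>(b, t)\<in>fraction R I b t. F a s b t)"
    using fraction_self[OF a] fraction_self[OF b] by blast
qed

lemma stalk_mult:
  assumes a: "a \<in> carrier R" "s \<in> carrier R - I" and b: "b \<in> carrier R" "t \<in> carrier R - I"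
  shows "fraction R I a s \<otimes>\<^bsub>stalk R I\<^esub> fraction R I b t = fraction R I (a \<otimes> b) (s \<otimes> t)"
  unfolding stalk_def monoid.simps
proof (rule fraction_union[OF a b], rule fraction_eqI)
  fix a' s' b' t' assume r: "((a, s), (a', s')) \<in> fraction_rel R I" "((b, t), (b', t')) \<in> fraction_rel R I"
  obtain u where u: "u \<in> carrier R - I" "u \<otimes> (a \<otimes> s') = u \<otimes> (a' \<otimes> s)"
    using r by (auto simp: fraction_rel_iff)
  obtain v where v: "v \<in> carrier R - I" "v \<otimes> (b \<otimes> t') = v \<otimes> (b' \<otimes> t)"
    using r by (auto simp: fraction_rel_iff)
  have c: "a' \<in> carrier R" "s' \<in> carrier R - I" "b' \<in> carrier R" "t' \<in> carrier R - I"
    using r by (auto simp: fraction_rel_iff)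
  have "(u \<otimes> v) \<otimes> ((a' \<otimes> b') \<otimes> (s \<otimes> t)) = (u \<otimes> (a' \<otimes> s)) \<otimes> (v \<otimes> (b' \<otimes> t))"
    using a b c u(1) v(1) by (simp add: m_ac)
  also have "\<dots> = (u \<otimes> v) \<otimes> ((a \<otimes> b) \<otimes> (s' \<otimes> t'))"
    unfolding u(2)[symmetric] v(2)[symmetric] using a b c u(1) v(1) by (simp add: m_ac)
  finally show "((a' \<otimes> b', s' \<otimes> t'), (a \<otimes> b, s \<otimes> t)) \<in> fraction_rel R I"
    unfolding fraction_rel_iff using mult_notin[OF u(1) v(1)] mult_notin a b c by blast
qed

lemma stalk_add:
  assumes a: "a \<in> carrier R" "s \<in> carrier R - I" and b: "b \<in> carrier R" "t \<in> carrier R - I"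
  shows "fraction R I a s \<oplus>\<^bsub>stalk R I\<^esub> fraction R I b t = fraction R I (a \<otimes> t \<oplus> b \<otimes> s) (s \<otimes> t)"
  unfolding stalk_def ring.simps
proof (rule fraction_union[OF a b], rule fraction_eqI)
  fix a' s' b' t' assume r: "((a, s), (a', s')) \<in> fraction_rel R I" "((b, t), (b', t')) \<in> fraction_rel R I"
  obtain u where u: "u \<in> carrier R - I" "u \<otimes> (a \<otimes> s') = u \<otimes> (a' \<otimes> s)"
    using r by (auto simp: fraction_rel_iff)
  obtain v where v: "v \<in> carrier R - I" "v \<otimes> (b \<otimes> t') = v \<otimes> (b' \<otimes> t)"
    using r by (auto simp: fraction_rel_iff)
  have c: "a' \<in> carrier R" "s' \<in> carrier R - I" "b' \<in> carrier R" "t' \<in> carrier R - I"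
    using r by (auto simp: fraction_rel_iff)
  have "(u \<otimes> v) \<otimes> ((a' \<otimes> t' \<oplus> b' \<otimes> s') \<otimes> (s \<otimes> t)) =
      (u \<otimes> (a' \<otimes> s)) \<otimes> (v \<otimes> t' \<otimes> t) \<oplus> (v \<otimes> (b' \<otimes> t)) \<otimes> (u \<otimes> s \<otimes> s')"
    using a b c u(1) v(1) by (simp add: m_ac l_distr r_distr)
  also have "\<dots> = (u \<otimes> v) \<otimes> ((a \<otimes> t \<oplus> b \<otimes> s) \<otimes> (s' \<otimes> t'))"
    unfolding u(2)[symmetric] v(2)[symmetric] using a b c u(1) v(1) by (simp add: m_ac l_distr r_distr)
  finally have *: "(u \<otimes> v) \<otimes> ((a' \<otimes> t' \<oplus> b' \<otimes> s') \<otimes> (s \<otimes> t)) = (u \<otimes> v) \<otimes> ((a \<otimes> t \<oplus> b \<otimes> s) \<otimes> (s' \<otimes> t'))" .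
  have "a' \<otimes> t' \<oplus> b' \<otimes> s' \<in> carrier R" "a \<otimes> t \<oplus> b \<otimes> s \<in> carrier R" using a b c by auto
  then show "((a' \<otimes> t' \<oplus> b' \<otimes> s', s' \<otimes> t'), (a \<otimes> t \<oplus> b \<otimes> s, s \<otimes> t)) \<in> fraction_rel R I"
    unfolding fraction_rel_iff using mult_notin[OF u(1) v(1)] mult_notin[of s' t'] mult_notin[of s t] a b c * by blast
qed

end

lemma structure_sheaf_simps:
  "s \<otimes>\<^bsub>structure_sheaf R V\<^esub> t = (\<lambda>P\<in>V. s P \<otimes>\<^bsub>stalk R P\<^esub> t P)"
  "s \<oplus>\<^bsub>structure_sheaf R V\<^esub> t = (\<lambda>P\<in>V. s P \<oplus>\<^bsub>stalk R P\<^esub> t P)"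
  "\<one>\<^bsub>structure_sheaf R V\<^esub> = (\<lambda>P\<in>V. \<one>\<^bsub>stalk R P\<^esub>)"
  by (simp_all add: structure_sheaf_def)

lemma Spec_primeideal: "P \<in> Spec R \<Longrightarrow> primeideal P R"
  by (simp add: Spec_def)

lemma fraction_section:
  assumes V: "openin (zariski R) V" and b: "b \<in> carrier R" "\<And>Q. Q \<in> V \<Longrightarrow> b \<notin> Q" and a: "a \<in> carrier R"
  shows "(\<lambda>P\<in>V. fraction R P a b) \<in> carrier (structure_sheaf R V)"
proof -
  have "V \<subseteq> Spec R" using openin_subset[OF V] by (simp add: topspace_zariski)
  have "fraction R P a b \<in> carrier (stalk R P)" if P: "P \<in> V" for P
  proof -
    have "primeideal P R" using P \<open>V \<subseteq> Spec R\<close> Spec_primeideal by blast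
    from primeideal.carrier_stalk[OF this] show ?thesis using a b P by blast
  qed
  then show ?thesis using assms by (auto simp: structure_sheaf_def intro!: exI[of _ V])
qed

lemma openin_basic: "openin (zariski R) V \<Longrightarrow> b \<in> carrier R \<Longrightarrow> openin (zariski R) {Q \<in> V. b \<notin> Q}"
proof -
  assume V: "openin (zariski R) V" and b: "b \<in> carrier R"
  have "V \<subseteq> Spec R" using openin_subset[OF V] by (simp add: topspace_zariski)
  then have "{Q \<in> V. b \<notin> Q} = V \<inter> {Q \<in> Spec R. \<not> {b} \<subseteq> Q}" by auto
  moreover have "openin (zariski R) {Q \<in> Spec R. \<not> {b} \<subseteq> Q}"
    unfolding openin_zariski using b by blast
  ultimately show ?thesis using V by (simp add: openin_Int)
qed

section \<open>The structure sheaf of a domain inside its field of fractions\<close>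

text \<open>Serves twice: for A with \<open>to_fract\<close>, and for a copy of \<Gamma>(U) embedded
  in the same field. Stalks and sections of both spectra then become elements of one field and can
  be compared.\<close>

locale field_embedding = cring R for R (structure) +
  fixes e :: "'a \<Rightarrow> 'k::field"
  assumes e_inj: "inj_on e (carrier R)"
    and e_one: "e \<one> = 1"
    and e_mult: "x \<in> carrier R \<Longrightarrow> y \<in> carrier R \<Longrightarrow> e (x \<otimes> y) = e x * e y"
    and e_add: "x \<in> carrier R \<Longrightarrow> y \<in> carrier R \<Longrightarrow> e (x \<oplus> y) = e x + e y"
begin

lemma e_zero: "e \<zero> = 0"
  using e_add[of \<zero> \<zero>] by (simp only: zero_closed r_zero add_cancel_right_right simp_thms)

lemma e_eq_iff: "x \<in> carrier R \<Longrightarrow> y \<in> carrier R \<Longrightarrow> e x = e y \<longleftrightarrow> x = y"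
  using e_inj by (auto dest: inj_onD)

lemma e_eq_0_iff: "x \<in> carrier R \<Longrightarrow> e x = 0 \<longleftrightarrow> x = \<zero>"
  using e_eq_iff[of x \<zero>] e_zero by simp

lemma zero_Spec: "{\<zero>} \<in> Spec R"
proof -
  have "domain R"
  proof (intro domain.intro domain_axioms.intro is_cring)
    show "\<one> \<noteq> \<zero>" using e_one e_zero by auto
    show "a = \<zero> \<or> b = \<zero>" if "a \<otimes> b = \<zero>" "a \<in> carrier R" "b \<in> carrier R" for a b
      using that e_mult[of a b] e_zero by (auto simp: e_eq_0_iff)
  qed
  then show ?thesis by (simp add: Spec_def domain.zeroprimeideal)
qed

definition loc :: "'a set \<Rightarrow> 'k set" where
  "loc P = {e a / e s | a s. a \<in> carrier R \<and> s \<in> carrier R - P}"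

text \<open>The element of the stalk at \<open>P\<close> with value \<open>k\<close>; at a prime
  \<open>P\<close> it is empty unless \<open>k\<close> lies in \<open>loc P\<close>.\<close>

definition germ :: "'a set \<Rightarrow> 'k \<Rightarrow> ('a \<times> 'a) set" where
  "germ P k = {(a, s). a \<in> carrier R \<and> s \<in> carrier R - P \<and> e a = k * e s}"

definition germ_value :: "('a \<times> 'a) set \<Rightarrow> 'k" where
  "germ_value X = (THE k. \<exists>(a, s)\<in>X. k = e a / e s)"

lemma zero_in_Spec: "P \<in> Spec R \<Longrightarrow> \<zero> \<in> P"
  using additive_subgroup.zero_closed ideal.axioms(1) primeideal.axioms(1) by (fastforce simp: Spec_def)

lemma e_nonzero: "P \<in> Spec R \<Longrightarrow> s \<in> carrier R - P \<Longrightarrow> e s \<noteq> 0"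
  using zero_in_Spec e_eq_0_iff by auto

lemma locE:
  assumes "k \<in> loc P"
  obtains a s where "k = e a / e s" "a \<in> carrier R" "s \<in> carrier R - P"
  using assms by (auto simp: loc_def)

text \<open>In a domain the extra factor \<open>u\<close> of \<open>fraction_rel\<close> cancels, so
  a fraction is determined by its value in the field.\<close>

lemma fraction_eq_germ:
  assumes P: "P \<in> Spec R" and a: "a \<in> carrier R" "s \<in> carrier R - P"
  shows "fraction R P a s = germ P (e a / e s)"
proof -
  interpret primeideal P R using P by (simp add: Spec_def)
  have "((a, s), (b, t)) \<in> fraction_rel R P \<longleftrightarrow> (b, t) \<in> germ P (e a / e s)" for b t
  proof -
    have "(\<exists>u\<in>carrier R - P. u \<otimes> (a \<otimes> t) = u \<otimes> (b \<otimes> s)) \<longleftrightarrow> e b = e a / e s * e t"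
      if c: "b \<in> carrier R" "t \<in> carrier R - P"
    proof -
      have "u \<otimes> (a \<otimes> t) = u \<otimes> (b \<otimes> s) \<longleftrightarrow> e b = e a / e s * e t" if u: "u \<in> carrier R - P" for u
      proof -
        have "u \<otimes> (a \<otimes> t) = u \<otimes> (b \<otimes> s) \<longleftrightarrow> e u * (e a * e t) = e u * (e b * e s)"
          using a c u by (simp add: e_mult[symmetric] e_eq_iff)
        also have "\<dots> \<longleftrightarrow> e b = e a / e s * e t"
          using e_nonzero[OF P u] e_nonzero[OF P a(2)] by (auto simp: field_simps)
        finally show ?thesis .
      qed
      moreover have "\<one> \<in> carrier R - P" using one_notin by simp
      ultimately show ?thesis by blast
    qed
    then show ?thesis using a by (auto simp: fraction_rel_iff germ_def)
  qed
  then show ?thesis by (auto simp: fraction_def)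
qed

lemma germ_value: "P \<in> Spec R \<Longrightarrow> k \<in> loc P \<Longrightarrow> germ_value (germ P k) = k"
  unfolding germ_value_def
proof (rule the_equality)
  assume P: "P \<in> Spec R" and k: "k \<in> loc P"
  have "\<exists>a s. k = e a / e s \<and> (a, s) \<in> germ P k"
  proof -
    obtain a s where "k = e a / e s" "a \<in> carrier R" "s \<in> carrier R - P" using k by (rule locE)
    then show ?thesis using e_nonzero[OF P, of s] by (intro exI[of _ a] exI[of _ s]) (auto simp: germ_def)
  qed
  then show "\<exists>(a, s)\<in>germ P k. k = e a / e s" by auto
  show "k' = k" if "\<exists>(a, s)\<in>germ P k. k' = e a / e s" for k'
    using that e_nonzero[OF P] by (auto simp: germ_def)
qed

lemma germ_eq_iff: "P \<in> Spec R \<Longrightarrow> k \<in> loc P \<Longrightarrow> l \<in> loc P \<Longrightarrow> germ P k = germ P l \<longleftrightarrow> k = l"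
  using germ_value by metis

lemma germ_mult:
  assumes P: "P \<in> Spec R" and k: "k \<in> loc P" and l: "l \<in> loc P"
  shows "germ P k \<otimes>\<^bsub>stalk R P\<^esub> germ P l = germ P (k * l)" "k * l \<in> loc P"
proof -
  interpret primeideal P R using P by (simp add: Spec_def)
  obtain a s where a: "k = e a / e s" "a \<in> carrier R" "s \<in> carrier R - P" using k by (rule locE)
  obtain b t where b: "l = e b / e t" "b \<in> carrier R" "t \<in> carrier R - P" using l by (rule locE)
  have st: "s \<otimes> t \<in> carrier R - P" using mult_notin a b by blast
  have kl: "k * l = e (a \<otimes> b) / e (s \<otimes> t)" using a b by (simp add: e_mult)
  then show "germ P k \<otimes>\<^bsub>stalk R P\<^esub> germ P l = germ P (k * l)"
    using a b st by (simp add: fraction_eq_germ[OF P, symmetric] stalk_mult del: Diff_iff)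
  show "k * l \<in> loc P" using kl a b st unfolding loc_def by blast
qed

lemma germ_add:
  assumes P: "P \<in> Spec R" and k: "k \<in> loc P" and l: "l \<in> loc P"
  shows "germ P k \<oplus>\<^bsub>stalk R P\<^esub> germ P l = germ P (k + l)" "k + l \<in> loc P"
proof -
  interpret primeideal P R using P by (simp add: Spec_def)
  obtain a s where a: "k = e a / e s" "a \<in> carrier R" "s \<in> carrier R - P" using k by (rule locE)
  obtain b t where b: "l = e b / e t" "b \<in> carrier R" "t \<in> carrier R - P" using l by (rule locE)
  have st: "s \<otimes> t \<in> carrier R - P" using mult_notin a b by blast
  have n: "a \<otimes> t \<oplus> b \<otimes> s \<in> carrier R" using a b by simp
  have kl: "k + l = e (a \<otimes> t \<oplus> b \<otimes> s) / e (s \<otimes> t)"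
    using a b e_nonzero[OF P a(3)] e_nonzero[OF P b(3)] by (simp add: e_mult e_add field_simps)
  then show "germ P k \<oplus>\<^bsub>stalk R P\<^esub> germ P l = germ P (k + l)"
    using a b st n by (simp add: fraction_eq_germ[OF P, symmetric] stalk_add del: Diff_iff)
  show "k + l \<in> loc P" using kl n st unfolding loc_def by blast
qed

lemma one_loc: "P \<in> Spec R \<Longrightarrow> 1 \<in> loc P"
  using primeideal.one_notin[of P R] e_one by (force simp: loc_def Spec_def intro!: exI[of _ \<one>])

lemma germ_one: "P \<in> Spec R \<Longrightarrow> \<one>\<^bsub>stalk R P\<^esub> = germ P 1"
  using primeideal.one_notin[of P R] primeideal.stalk_one[of P R] fraction_eq_germ[of P \<one> \<one>]
  by (simp add: Spec_def e_one)

lemma germ_in_stalk: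
  assumes P: "P \<in> Spec R" and k: "k \<in> loc P"
  shows "germ P k \<in> carrier (stalk R P)"
proof -
  obtain a s where "k = e a / e s" "a \<in> carrier R" "s \<in> carrier R - P" using k by (rule locE)
  then show ?thesis
    unfolding primeideal.carrier_stalk[OF Spec_primeideal[OF P]] using fraction_eq_germ[OF P, of a s] by blast
qed

lemma open_zero: "openin (zariski R) V \<Longrightarrow> P \<in> V \<Longrightarrow> {\<zero>} \<in> V"
  using zero_Spec zero_in_Spec by (auto simp: openin_zariski)

lemma germ_section:
  assumes V: "openin (zariski R) V" and k: "\<And>P. P \<in> V \<Longrightarrow> k \<in> loc P"
  shows "(\<lambda>P\<in>V. germ P k) \<in> carrier (structure_sheaf R V)"
proof -
  have VS: "V \<subseteq> Spec R" using openin_subset[OF V] by (simp add: topspace_zariski)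
  have "\<exists>W a b. openin (zariski R) W \<and> P \<in> W \<and> W \<subseteq> V \<and> a \<in> carrier R \<and> b \<in> carrier R \<and>
      (\<forall>Q\<in>W. b \<notin> Q \<and> (\<lambda>P\<in>V. germ P k) Q = fraction R Q a b)" if P: "P \<in> V" for P
  proof -
    obtain a b where ab: "k = e a / e b" "a \<in> carrier R" "b \<in> carrier R - P" using k[OF P] by (rule locE)
    have "fraction R Q a b = germ Q k" if "Q \<in> V" "b \<notin> Q" for Q
      using that VS ab fraction_eq_germ[of Q a b] by auto
    then show ?thesis using openin_basic[OF V, of b] ab P
      by (intro exI[of _ "{Q \<in> V. b \<notin> Q}"] exI[of _ a] exI[of _ b]) auto
  qed
  then show ?thesis using germ_in_stalk VS k unfolding structure_sheaf_def by auto
qed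

text \<open>All nonempty open sets share the generic point \<open>{\<zero>}\<close>, so the
  fractions that describe a section locally have one common value there. This value is
  \<open>k\<close>, and it is regular at each point of \<open>V\<close>.\<close>

lemma section_germ:
  assumes V: "openin (zariski R) V" and s: "s \<in> carrier (structure_sheaf R V)"
  obtains k where "s = (\<lambda>P\<in>V. germ P k)" "\<And>P. P \<in> V \<Longrightarrow> k \<in> loc P"
proof (cases "V = {}")
  case True
  then show ?thesis using s by (intro that[of 0]) (auto simp: structure_sheaf_def)
next
  case False
  have VS: "V \<subseteq> Spec R" using openin_subset[OF V] by (simp add: topspace_zariski)
  have loc: "\<exists>W k. openin (zariski R) W \<and> P \<in> W \<and> W \<subseteq> V \<and> (\<forall>Q\<in>W. s Q = germ Q k \<and> k \<in> loc Q)"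
    if P: "P \<in> V" for P
  proof -
    obtain W a b where W: "openin (zariski R) W" "P \<in> W" "W \<subseteq> V" "a \<in> carrier R" "b \<in> carrier R"
      "\<forall>Q\<in>W. b \<notin> Q \<and> s Q = fraction R Q a b" using s P unfolding structure_sheaf_def by auto
    have "s Q = germ Q (e a / e b) \<and> e a / e b \<in> loc Q" if Q: "Q \<in> W" for Q
    proof -
      have "Q \<in> Spec R" "b \<in> carrier R - Q" "s Q = fraction R Q a b" using W Q VS by auto
      moreover have "e a / e b \<in> loc Q" using W(4) calculation(2) unfolding loc_def by blast
      ultimately show ?thesis using fraction_eq_germ[of Q a b] W(4) by simp
    qed
    then show ?thesis using W by blast
  qed
  have V0: "{\<zero>} \<in> V" using False open_zero[OF V] by blast
  obtain k where k: "s {\<zero>} = germ {\<zero>} k" "k \<in> loc {\<zero>}" using loc[OF V0] by blast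
  have "s P = germ P k \<and> k \<in> loc P" if P: "P \<in> V" for P
  proof -
    obtain W l where W: "openin (zariski R) W" "P \<in> W" "W \<subseteq> V" "\<forall>Q\<in>W. s Q = germ Q l \<and> l \<in> loc Q"
      using loc[OF P] by blast
    have "{\<zero>} \<in> W" using open_zero W by blast
    then have "l = k" using W(4) k germ_eq_iff[OF zero_Spec] by metis
    then show ?thesis using W by blast
  qed
  moreover have "s \<in> extensional V" using s by (auto simp: structure_sheaf_def PiE_def)
  ultimately show ?thesis using that[of k] by (metis (no_types, lifting) extensionalityI restrict_apply restrict_extensional)
qed

lemma section_mult:
  assumes V: "openin (zariski R) V" and k: "\<And>P. P \<in> V \<Longrightarrow> k \<in> loc P" and l: "\<And>P. P \<in> V \<Longrightarrow> l \<in> loc P"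
  shows "(\<lambda>P\<in>V. germ P k) \<otimes>\<^bsub>structure_sheaf R V\<^esub> (\<lambda>P\<in>V. germ P l) = (\<lambda>P\<in>V. germ P (k * l))"
  using openin_subset[OF V] germ_mult(1) k l
  by (auto simp: structure_sheaf_simps topspace_zariski intro!: restrict_ext)

lemma section_add:
  assumes V: "openin (zariski R) V" and k: "\<And>P. P \<in> V \<Longrightarrow> k \<in> loc P" and l: "\<And>P. P \<in> V \<Longrightarrow> l \<in> loc P"
  shows "(\<lambda>P\<in>V. germ P k) \<oplus>\<^bsub>structure_sheaf R V\<^esub> (\<lambda>P\<in>V. germ P l) = (\<lambda>P\<in>V. germ P (k + l))"
  using openin_subset[OF V] germ_add(1) k l
  by (auto simp: structure_sheaf_simps topspace_zariski intro!: restrict_ext)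

lemma section_one:
  assumes V: "openin (zariski R) V"
  shows "\<one>\<^bsub>structure_sheaf R V\<^esub> = (\<lambda>P\<in>V. germ P 1)"
  using openin_subset[OF V] germ_one by (auto simp: structure_sheaf_simps topspace_zariski intro!: restrict_ext)

end

lemma field_embedding_to_fract: "field_embedding (ring_of_type :: 'a::idom ring) to_fract"
  by (intro field_embedding.intro field_embedding_axioms.intro cring_ring_of_type) (auto simp: inj_on_def)

lemma loc_to_fract: "field_embedding.loc ring_of_type to_fract P = local_ring P"
  by (auto simp: field_embedding.loc_def[OF field_embedding_to_fract] local_ring_def Fract_conv_to_fract)

section \<open>Affineness of open subsets\<close>

text \<open>Finite sums of products: the product of two modules, or the extension of an ideal when
  \<open>N\<close> is the whole ring.\<close>

inductive_set prod_span :: "'k::comm_ring set \<Rightarrow> 'k set \<Rightarrow> 'k set" for M N where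
  zero: "0 \<in> prod_span M N"
| step: "x \<in> M \<Longrightarrow> y \<in> N \<Longrightarrow> z \<in> prod_span M N \<Longrightarrow> x * y + z \<in> prod_span M N"

lemma prod_span_add: "u \<in> prod_span M N \<Longrightarrow> v \<in> prod_span M N \<Longrightarrow> u + v \<in> prod_span M N"
  by (induction rule: prod_span.induct) (auto simp: add.assoc intro: prod_span.step)

lemma prod_span_mult: "x \<in> M \<Longrightarrow> y \<in> N \<Longrightarrow> x * y \<in> prod_span M N"
  using prod_span.step[OF _ _ prod_span.zero] by fastforce

lemma prod_span_scale:
  assumes "u \<in> prod_span M N" and "\<And>y. y \<in> N \<Longrightarrow> c * y \<in> N'"
  shows "c * u \<in> prod_span M N'"
  using assms(1)
proof induction
  case (step x y z)
  then show ?case using prod_span.step[of x M "c * y" N' "c * z"] assms(2)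
    by (simp add: distrib_left mult.left_commute)
qed (simp add: prod_span.zero)

lemma prod_span_mono: "M \<subseteq> M' \<Longrightarrow> N \<subseteq> N' \<Longrightarrow> prod_span M N \<subseteq> prod_span M' N'"
proof
  fix u assume "M \<subseteq> M'" "N \<subseteq> N'" "u \<in> prod_span M N"
  from this(3,1,2) show "u \<in> prod_span M' N'"
    by induction (auto intro: prod_span.intros)
qed

text \<open>The ring \<open>B\<close> in \<open>affine_open\<close> is an arbitrary commutative
  ring, so Zorn's lemma replaces the noetherian condition here.\<close>

lemma (in cring) maximal_ideal_exists:
  assumes J: "ideal J R" and "\<one> \<notin> J"
  obtains M where "maximalideal M R" "J \<subseteq> M"
proof -
  define F where "F = {I. ideal I R \<and> J \<subseteq> I \<and> \<one> \<notin> I}"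
  have "F \<noteq> {}" using assms by (auto simp: F_def)
  moreover have "\<Union>C \<in> F" if C: "C \<noteq> {}" "subset.chain F C" for C
  proof -
    have "subset.chain {I. ideal I R} C" using C(2) by (auto simp: subset.chain_def F_def)
    then have "ideal (\<Union>C) R" using chain_Union_is_ideal[of C] C(1) by simp
    then show ?thesis using C by (auto simp: subset.chain_def F_def)
  qed
  ultimately obtain M where M: "M \<in> F" "\<forall>X\<in>F. M \<subseteq> X \<longrightarrow> X = M"
    using subset_Zorn_nonempty[of F] by blast
  have "maximalideal M R"
  proof (rule maximalidealI)
    show "ideal M R" using M by (simp add: F_def)
    show "carrier R \<noteq> M" using M one_closed by (auto simp: F_def)
    fix I assume I: "ideal I R" "M \<subseteq> I" "I \<subseteq> carrier R"
    show "I = M \<or> I = carrier R"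
    proof (cases "\<one> \<in> I")
      case True
      then show ?thesis using ideal.one_imp_carrier[OF I(1)] by blast
    next
      case False
      then have "I \<in> F" using I M(1) by (auto simp: F_def)
      then show ?thesis using M(2) I(2) by blast
    qed
  qed
  moreover have "J \<subseteq> M" using M by (simp add: F_def)
  ultimately show thesis by (rule that)
qed

text \<open>If \<open>U \<cong> Spec B\<close>, the elements of \<open>B\<close> whose sections over \<open>U\<close> lie in \<open>I \<Gamma>(U)\<close> form
  an ideal. It is in no maximal ideal: near the corresponding point of \<open>U\<close> some \<open>a \<in> I\<close> is
  invertible, and the denominator of \<open>1/a\<close> over \<open>B\<close> lies in the ideal.\<close>

lemma affine_open_imp_unit:
  fixes U :: "'a::idom set set"
  assumes aff: "affine_open ring_of_type U" and U0: "{0} \<in> U"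
    and I: "\<And>P. P \<in> U \<Longrightarrow> \<exists>a\<in>I. a \<notin> P"
  shows "1 \<in> prod_span (to_fract ` I) (\<Inter>P\<in>U. local_ring P)"
proof -
  interpret A: field_embedding "ring_of_type :: 'a ring" to_fract by (rule field_embedding_to_fract)
  let ?A = "ring_of_type :: 'a ring"
  let ?\<Gamma> = "\<Inter>P\<in>U. local_ring P"
  let ?S = "prod_span (to_fract ` I) ?\<Gamma>"
  note loc = loc_to_fract[where 'a = 'a]
  have oU: "openin (zariski ?A) U" using aff by (simp add: affine_open_def)
  have US: "U \<subseteq> Spec ?A" using openin_subset[OF oU] by (simp add: topspace_zariski)
  let ?X = "subtopology (zariski ?A) U"
  have tX: "topspace ?X = U" using US by (auto simp: topspace_zariski)
  have oX: "openin ?X W \<longleftrightarrow> openin (zariski ?A) W \<and> W \<subseteq> U" for W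
    by (rule openin_open_subtopology[OF oU])
  obtain B :: "('a set \<Rightarrow> ('a \<times> 'a) set) ring" where B: "cring B"
    and iso: "ringed_space_isomorphic ?X (structure_sheaf ?A) (zariski B) (structure_sheaf B)"
    using aff by (auto simp: affine_open_def)
  interpret B: cring B by (rule B)
  obtain \<phi> \<theta> where iso': "homeomorphic_map ?X (zariski B) \<phi> \<and>
      (\<forall>V. openin (zariski B) V \<longrightarrow>
         \<theta> V \<in> ring_iso (structure_sheaf B V) (structure_sheaf ?A {x \<in> U. \<phi> x \<in> V})) \<and>
      (\<forall>V W. openin (zariski B) V \<longrightarrow> openin (zariski B) W \<longrightarrow> W \<subseteq> V \<longrightarrow>
         (\<forall>s\<in>carrier (structure_sheaf B V).
            \<theta> W (restrict s W) = restrict (\<theta> V s) {x \<in> U. \<phi> x \<in> W}))"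
    using iso unfolding ringed_space_isomorphic_def tX by (elim exE) (rule that)
  have \<phi>: "homeomorphic_map ?X (zariski B) \<phi>"
    and \<theta>: "\<And>V. openin (zariski B) V \<Longrightarrow>
      \<theta> V \<in> ring_iso (structure_sheaf B V) (structure_sheaf ?A {x \<in> U. \<phi> x \<in> V})"
    and \<theta>_res: "\<And>V W s. openin (zariski B) V \<Longrightarrow> openin (zariski B) W \<Longrightarrow> W \<subseteq> V \<Longrightarrow>
      s \<in> carrier (structure_sheaf B V) \<Longrightarrow> \<theta> W (restrict s W) = restrict (\<theta> V s) {x \<in> U. \<phi> x \<in> W}"
    using iso' by simp_all
  let ?SB = "Spec B"
  have oSB: "openin (zariski B) ?SB" using openin_topspace[of "zariski B"] by (simp add: topspace_zariski)
  have img: "\<phi> ` U = ?SB" "inj_on \<phi> U"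
    using homeomorphic_imp_surjective_map[OF \<phi>] homeomorphic_imp_injective_map[OF \<phi>] tX
    by (simp_all add: topspace_zariski)
  then have preSB: "{x \<in> U. \<phi> x \<in> ?SB} = U" by blast
  have pre_open: "openin (zariski ?A) {x \<in> U. \<phi> x \<in> V}" if "openin (zariski B) V" for V
    using homeomorphic_imp_continuous_map[OF \<phi>] that oX unfolding continuous_map_def tX by blast
  \<comment> \<open>The section that an element \<open>d\<close> of \<open>B\<close> defines over
    \<open>V\<close>.\<close>
  define gs where "gs V d = (\<lambda>Q\<in>V. fraction B Q d \<one>\<^bsub>B\<^esub>)" for V d
  have gs_carrier: "gs V d \<in> carrier (structure_sheaf B V)" if "openin (zariski B) V" "d \<in> carrier B" for V d
  proof -
    have "\<one>\<^bsub>B\<^esub> \<notin> Q" if "Q \<in> V" for Q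
      using openin_subset[OF \<open>openin (zariski B) V\<close>] that primeideal.one_notin[OF Spec_primeideal, of Q B]
      by (auto simp: topspace_zariski)
    then show ?thesis unfolding gs_def using that by (intro fraction_section) auto
  qed
  have ex: "\<exists>k. \<theta> ?SB (gs ?SB d) = (\<lambda>P\<in>U. A.germ P k) \<and> k \<in> ?\<Gamma>" if "d \<in> carrier B" for d
  proof -
    have "\<theta> ?SB (gs ?SB d) \<in> carrier (structure_sheaf ?A U)"
      using ring_iso_memE(1)[OF \<theta>[OF oSB] gs_carrier[OF oSB that]] preSB by simp
    then obtain k where "\<theta> ?SB (gs ?SB d) = (\<lambda>P\<in>U. A.germ P k)" "\<And>P. P \<in> U \<Longrightarrow> k \<in> A.loc P"
      using A.section_germ[OF oU] by blast
    then show ?thesis by (auto simp: loc)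
  qed
  \<comment> \<open>\<open>\<psi>\<close> is the ring map from \<open>B\<close> to \<Gamma>(U)
    induced on global sections, with values read in the field of fractions.\<close>
  then obtain \<psi> where \<psi>: "\<And>d. d \<in> carrier B \<Longrightarrow> \<theta> ?SB (gs ?SB d) = (\<lambda>P\<in>U. A.germ P (\<psi> d))"
    "\<And>d. d \<in> carrier B \<Longrightarrow> \<psi> d \<in> ?\<Gamma>" by metis
  have \<psi>_loc: "\<psi> d \<in> A.loc P" if "d \<in> carrier B" "P \<in> U" for d P
    using \<psi>(2)[OF that(1)] that(2) by (auto simp: loc)
  have germ_inj: "k = l" if W: "W \<subseteq> U" "W \<noteq> {}" and kl: "\<And>P. P \<in> W \<Longrightarrow> k \<in> A.loc P \<and> l \<in> A.loc P"
    and eq: "(\<lambda>P\<in>W. A.germ P k) = (\<lambda>P\<in>W. A.germ P l)" for W k l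
  proof -
    obtain P where P: "P \<in> W" using W(2) by blast
    then have "A.germ P k = A.germ P l" using fun_cong[OF eq, of P] by simp
    then show ?thesis using A.germ_eq_iff[of P k l] kl[OF P] P W US by blast
  qed
  have prime: "primeideal Q B" if "Q \<in> ?SB" for Q using that by (rule Spec_primeideal)
  have gs_mult: "gs ?SB (c \<otimes>\<^bsub>B\<^esub> d) = gs ?SB c \<otimes>\<^bsub>structure_sheaf B ?SB\<^esub> gs ?SB d"
    if "c \<in> carrier B" "d \<in> carrier B" for c d
    unfolding gs_def structure_sheaf_simps
    using that prime by (intro restrict_ext) (simp add: primeideal.stalk_mult primeideal.one_notin)
  have gs_add: "gs ?SB (c \<oplus>\<^bsub>B\<^esub> d) = gs ?SB c \<oplus>\<^bsub>structure_sheaf B ?SB\<^esub> gs ?SB d"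
    if "c \<in> carrier B" "d \<in> carrier B" for c d
    unfolding gs_def structure_sheaf_simps
    using that prime by (intro restrict_ext) (simp add: primeideal.stalk_add primeideal.one_notin)
  have gs_one: "gs ?SB \<one>\<^bsub>B\<^esub> = \<one>\<^bsub>structure_sheaf B ?SB\<^esub>"
    unfolding gs_def structure_sheaf_simps
    using prime by (intro restrict_ext) (simp add: primeideal.stalk_one)
  have Une: "U \<noteq> {}" using U0 by blast
  have \<theta>SB: "\<theta> ?SB \<in> ring_iso (structure_sheaf B ?SB) (structure_sheaf ?A U)"
    using \<theta>[OF oSB] preSB by simp
  have \<psi>_mult: "\<psi> (c \<otimes>\<^bsub>B\<^esub> d) = \<psi> c * \<psi> d" if cd: "c \<in> carrier B" "d \<in> carrier B" for c d
  proof (rule germ_inj[OF order_refl Une])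
    show "\<psi> (c \<otimes>\<^bsub>B\<^esub> d) \<in> A.loc P \<and> \<psi> c * \<psi> d \<in> A.loc P" if "P \<in> U" for P
      using cd \<psi>_loc that A.germ_mult(2) US by (simp add: subset_iff)
    have "(\<lambda>P\<in>U. A.germ P (\<psi> (c \<otimes>\<^bsub>B\<^esub> d))) = \<theta> ?SB (gs ?SB c) \<otimes>\<^bsub>structure_sheaf ?A U\<^esub> \<theta> ?SB (gs ?SB d)"
      using cd ring_iso_memE(2)[OF \<theta>SB] gs_carrier[OF oSB] by (simp add: \<psi>(1)[symmetric] gs_mult)
    then show "(\<lambda>P\<in>U. A.germ P (\<psi> (c \<otimes>\<^bsub>B\<^esub> d))) = (\<lambda>P\<in>U. A.germ P (\<psi> c * \<psi> d))"
      using cd \<psi>_loc by (simp add: \<psi>(1) A.section_mult[OF oU])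
  qed
  have \<psi>_add: "\<psi> (c \<oplus>\<^bsub>B\<^esub> d) = \<psi> c + \<psi> d" if cd: "c \<in> carrier B" "d \<in> carrier B" for c d
  proof (rule germ_inj[OF order_refl Une])
    show "\<psi> (c \<oplus>\<^bsub>B\<^esub> d) \<in> A.loc P \<and> \<psi> c + \<psi> d \<in> A.loc P" if "P \<in> U" for P
      using cd \<psi>_loc that A.germ_add(2) US by (simp add: subset_iff)
    have "(\<lambda>P\<in>U. A.germ P (\<psi> (c \<oplus>\<^bsub>B\<^esub> d))) = \<theta> ?SB (gs ?SB c) \<oplus>\<^bsub>structure_sheaf ?A U\<^esub> \<theta> ?SB (gs ?SB d)"
      using cd ring_iso_memE(3)[OF \<theta>SB] gs_carrier[OF oSB] by (simp add: \<psi>(1)[symmetric] gs_add)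
    then show "(\<lambda>P\<in>U. A.germ P (\<psi> (c \<oplus>\<^bsub>B\<^esub> d))) = (\<lambda>P\<in>U. A.germ P (\<psi> c + \<psi> d))"
      using cd \<psi>_loc by (simp add: \<psi>(1) A.section_add[OF oU])
  qed
  have \<psi>_one: "\<psi> \<one>\<^bsub>B\<^esub> = 1"
  proof (rule germ_inj[OF order_refl Une])
    show "\<psi> \<one>\<^bsub>B\<^esub> \<in> A.loc P \<and> 1 \<in> A.loc P" if "P \<in> U" for P
      using \<psi>_loc that A.one_loc US by blast
    show "(\<lambda>P\<in>U. A.germ P (\<psi> \<one>\<^bsub>B\<^esub>)) = (\<lambda>P\<in>U. A.germ P 1)"
      using ring_iso_memE(4)[OF \<theta>SB] by (simp add: \<psi>(1)[symmetric] gs_one A.section_one[OF oU])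
  qed
  have \<Gamma>_mult: "x * y \<in> ?\<Gamma>" if "x \<in> ?\<Gamma>" "y \<in> ?\<Gamma>" for x y
    using that A.germ_mult(2) US by (auto simp: loc)
  define J where "J = {d \<in> carrier B. \<psi> d \<in> ?S}"
  have J_mult: "r \<otimes>\<^bsub>B\<^esub> d \<in> J" if d: "d \<in> J" and r: "r \<in> carrier B" for r d
  proof -
    have "\<psi> r * \<psi> d \<in> ?S"
      by (rule prod_span_scale) (use d r \<Gamma>_mult \<psi>(2) in \<open>auto simp: J_def\<close>)
    then show ?thesis using d r by (simp add: J_def \<psi>_mult)
  qed
  have J_zero: "\<zero>\<^bsub>B\<^esub> \<in> J"
  proof -
    have "\<psi> \<zero>\<^bsub>B\<^esub> = 0" using \<psi>_add[of "\<zero>\<^bsub>B\<^esub>" "\<zero>\<^bsub>B\<^esub>"]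
      by (simp only: B.zero_closed B.r_zero add_cancel_right_right simp_thms)
    then show ?thesis using prod_span.zero by (simp add: J_def)
  qed
  have "ideal J B"
  proof (rule idealI)
    show "ring B" by (rule B.ring_axioms)
    show "subgroup J (add_monoid B)"
    proof (rule group.subgroupI[OF B.a_group])
      show "J \<subseteq> carrier (add_monoid B)" by (auto simp: J_def)
      show "J \<noteq> {}" using J_zero by blast
      show "x \<otimes>\<^bsub>add_monoid B\<^esub> y \<in> J" if "x \<in> J" "y \<in> J" for x y
        using that by (auto simp: J_def \<psi>_add intro!: prod_span_add)
      show "inv\<^bsub>add_monoid B\<^esub> x \<in> J" if "x \<in> J" for x
      proof -
        have "(\<ominus>\<^bsub>B\<^esub> \<one>\<^bsub>B\<^esub>) \<otimes>\<^bsub>B\<^esub> x \<in> J" using J_mult[OF that, of "\<ominus>\<^bsub>B\<^esub> \<one>\<^bsub>B\<^esub>"] by simp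
        then have "\<ominus>\<^bsub>B\<^esub> x \<in> J" using that by (simp add: J_def B.l_minus)
        then show ?thesis by (simp add: a_inv_def)
      qed
    qed
    show "x \<otimes>\<^bsub>B\<^esub> d \<in> J" "d \<otimes>\<^bsub>B\<^esub> x \<in> J" if "d \<in> J" "x \<in> carrier B" for d x
      using J_mult[OF that] that B.m_comm[of d x] by (auto simp: J_def)
  qed
  have "\<one>\<^bsub>B\<^esub> \<in> J"
  proof (rule ccontr)
    assume "\<one>\<^bsub>B\<^esub> \<notin> J"
    then obtain m where m: "maximalideal m B" "J \<subseteq> m" using B.maximal_ideal_exists[OF \<open>ideal J B\<close>] by blast
    have "m \<in> ?SB" using B.maximalideal_prime[OF m(1)] by (simp add: Spec_def)
    then have "m \<in> \<phi> ` U" using img(1) by simp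
    then obtain P where P: "P \<in> U" "\<phi> P = m" by blast
    obtain a where a: "a \<in> I" "a \<notin> P" using I[OF P(1)] by blast
    define W where "W = {Q \<in> U. a \<notin> Q}"
    have W: "openin (zariski ?A) W" "W \<subseteq> U" "P \<in> W" using openin_basic[OF oU, of a] a P by (auto simp: W_def)
    have oV: "openin (zariski B) (\<phi> ` W)"
      using homeomorphic_map_openness_eq[OF \<phi>, of W] W oX by blast
    have preW: "{x \<in> U. \<phi> x \<in> \<phi> ` W} = W" using img(2) W(2) by (auto dest: inj_onD)
    have inv_loc: "1 / to_fract a \<in> A.loc Q" if "Q \<in> W" for Q
    proof -
      have "1 \<in> carrier ?A \<and> a \<in> carrier ?A - Q" using that by (simp add: W_def)
      then have "to_fract 1 / to_fract a \<in> A.loc Q" unfolding A.loc_def by blast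
      then show ?thesis by simp
    qed
    \<comment> \<open>On \<open>W\<close> the element \<open>a\<close> is invertible, so 1/a is a
      section there and corresponds to a section \<open>t\<close> over an open subset of Spec
      B.\<close>
    then have "(\<lambda>Q\<in>W. A.germ Q (1 / to_fract a)) \<in> carrier (structure_sheaf ?A W)"
      by (rule A.germ_section[OF W(1)])
    moreover have "bij_betw (\<theta> (\<phi> ` W)) (carrier (structure_sheaf B (\<phi> ` W))) (carrier (structure_sheaf ?A W))"
      using ring_iso_memE(5)[OF \<theta>[OF oV]] preW by simp
    ultimately obtain t where t: "t \<in> carrier (structure_sheaf B (\<phi> ` W))"
      "\<theta> (\<phi> ` W) t = (\<lambda>Q\<in>W. A.germ Q (1 / to_fract a))" by (metis (no_types, lifting) bij_betw_imp_surj_on imageE)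
    have "m \<in> \<phi> ` W" using P W by blast
    then obtain V c d where V: "openin (zariski B) V" "m \<in> V" "V \<subseteq> \<phi> ` W" "c \<in> carrier B" "d \<in> carrier B"
      "\<forall>Q\<in>V. d \<notin> Q \<and> t Q = fraction B Q c d" using t(1) unfolding structure_sheaf_def by auto
    define W' where "W' = {x \<in> U. \<phi> x \<in> V}"
    have W': "W' \<subseteq> W" "W' \<subseteq> U" using V(3) preW by (auto simp: W'_def)
    have PW': "P \<in> W'" using P V by (auto simp: W'_def)
    have oW': "openin (zariski ?A) W'" unfolding W'_def by (rule pre_open[OF V(1)])
    have VS: "V \<subseteq> ?SB" using openin_subset[OF V(1)] by (simp add: topspace_zariski)
    have \<theta>V: "\<theta> V \<in> ring_iso (structure_sheaf B V) (structure_sheaf ?A W')"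
      using \<theta>[OF V(1)] by (simp add: W'_def)
    have gsV: "\<theta> V (gs V x) = (\<lambda>Q\<in>W'. A.germ Q (\<psi> x))" if "x \<in> carrier B" for x
    proof -
      have "gs V x = restrict (gs ?SB x) V" using VS by (simp add: gs_def Int_absorb1)
      then have "\<theta> V (gs V x) = restrict (\<theta> ?SB (gs ?SB x)) W'"
        using \<theta>_res[OF oSB V(1) VS gs_carrier[OF oSB that]] by (simp add: W'_def)
      then show ?thesis using W'(2) \<psi>(1)[OF that] by (simp add: Int_absorb1)
    qed
    have tV: "\<theta> V (restrict t V) = (\<lambda>Q\<in>W'. A.germ Q (1 / to_fract a))"
      using \<theta>_res[OF oV V(1,3) t(1)] W'(1) unfolding t(2) W'_def[symmetric] by (simp add: Int_absorb1)
    have tVc: "restrict t V \<in> carrier (structure_sheaf B V)"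
    proof -
      have "restrict t V = (\<lambda>Q\<in>V. fraction B Q c d)" using V(6) by (intro restrict_ext) simp
      then show ?thesis using fraction_section[OF V(1,5) _ V(4)] V(6) by simp
    qed
    \<comment> \<open>Transported to \<open>W'\<close>, the identity d * (c/d) = c becomes
      \<open>\<psi> d * (1 / to_fract a) = \<psi> c\<close>.\<close>
    have "gs V d \<otimes>\<^bsub>structure_sheaf B V\<^esub> restrict t V = gs V c"
      unfolding gs_def structure_sheaf_simps
    proof (rule restrict_ext)
      fix Q assume Q: "Q \<in> V"
      then interpret Q: primeideal Q B using VS prime by blast
      have dQ: "d \<in> carrier B - Q" using V(5,6) Q by blast
      have "fraction B Q d \<one>\<^bsub>B\<^esub> \<otimes>\<^bsub>stalk B Q\<^esub> fraction B Q c d = fraction B Q (d \<otimes>\<^bsub>B\<^esub> c) (d \<otimes>\<^bsub>B\<^esub> \<one>\<^bsub>B\<^esub>)"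
        using Q.stalk_mult[of d "\<one>\<^bsub>B\<^esub>" c d] V(4,5) dQ Q.one_notin by simp
      also have "\<dots> = fraction B Q c \<one>\<^bsub>B\<^esub>" using Q.fraction_cancel[of c "\<one>\<^bsub>B\<^esub>" d] V(4) dQ Q.one_notin by simp
      finally show "(\<lambda>Q\<in>V. fraction B Q d \<one>\<^bsub>B\<^esub>) Q \<otimes>\<^bsub>stalk B Q\<^esub> restrict t V Q = fraction B Q c \<one>\<^bsub>B\<^esub>"
        using Q V(6) by simp
    qed
    then have "\<theta> V (gs V d) \<otimes>\<^bsub>structure_sheaf ?A W'\<^esub> \<theta> V (restrict t V) = \<theta> V (gs V c)"
      using ring_iso_memE(2)[OF \<theta>V gs_carrier[OF V(1,5)] tVc] by simp
    moreover have lW': "\<psi> d \<in> A.loc Q" "\<psi> c \<in> A.loc Q" "1 / to_fract a \<in> A.loc Q" if "Q \<in> W'" for Q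
      using that W' V(4,5) \<psi>_loc inv_loc by blast+
    ultimately have eq: "(\<lambda>Q\<in>W'. A.germ Q (\<psi> d * (1 / to_fract a))) = (\<lambda>Q\<in>W'. A.germ Q (\<psi> c))"
      by (simp add: gsV[OF V(4)] gsV[OF V(5)] tV A.section_mult[OF oW'])
    have "\<psi> d * (1 / to_fract a) = \<psi> c"
    proof (rule germ_inj[OF W'(2) _ _ eq])
      show "W' \<noteq> {}" using PW' by blast
      show "\<psi> d * (1 / to_fract a) \<in> A.loc Q \<and> \<psi> c \<in> A.loc Q" if "Q \<in> W'" for Q
        using lW'[OF that] A.germ_mult(2)[of Q] that W'(2) US by blast
    qed
    moreover have "a \<noteq> 0" using a(2) SpecD(4) P(1) US by blast
    ultimately have "\<psi> d = to_fract a * \<psi> c" by (simp add: field_simps)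
    then have "\<psi> d \<in> ?S" using prod_span_mult[of "to_fract a" "to_fract ` I" "\<psi> c" ?\<Gamma>] a(1) \<psi>(2)[OF V(4)] by simp
    \<comment> \<open>This is the contradiction: \<open>m\<close> is a point of \<open>V\<close>,
      where \<open>d\<close> is a denominator.\<close>
    then have "d \<in> m" using V(5) m(2) by (auto simp: J_def)
    then show False using V(2,6) by blast
  qed
  then show ?thesis using \<psi>_one by (simp add: J_def)
qed

subsection \<open>Local rings inside the field of fractions\<close>

lemma local_max_ideal_subset: "local_max_ideal P \<subseteq> local_ring P"
  by (auto simp: local_max_ideal_def local_ring_def)

context
  fixes P :: "'a::idom set"
  assumes P: "P \<in> Spec ring_of_type"
begin

lemma notin_Spec_nonzero: "s \<notin> P \<Longrightarrow> s \<noteq> 0"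
  using SpecD(4)[OF P] by blast

lemma to_fract_local_ring: "to_fract a \<in> local_ring P"
  using SpecD(2)[OF P] by (auto simp: local_ring_def to_fract_def)

lemma Fract_local_ring: "s \<notin> P \<Longrightarrow> Fract a s \<in> local_ring P"
  by (auto simp: local_ring_def)

lemma local_ring_mult: "x \<in> local_ring P \<Longrightarrow> y \<in> local_ring P \<Longrightarrow> x * y \<in> local_ring P"
  using Spec_mult_notin[OF P] by (auto simp: local_ring_def) blast

lemma local_ring_add: "x \<in> local_ring P \<Longrightarrow> y \<in> local_ring P \<Longrightarrow> x + y \<in> local_ring P"
  using Spec_mult_notin[OF P] notin_Spec_nonzero by (auto simp: local_ring_def) blast

lemma local_ring_power: "x \<in> local_ring P \<Longrightarrow> x ^ n \<in> local_ring P"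
  using to_fract_local_ring[of 1] by (induction n) (auto intro: local_ring_mult)

lemma local_ring_iff: "x \<in> local_ring P \<longleftrightarrow> (\<exists>s. s \<notin> P \<and> x * to_fract s \<in> range to_fract)"
proof
  assume "x \<in> local_ring P"
  then obtain a s where "x = Fract a s" "s \<notin> P" by (auto simp: local_ring_def)
  then show "\<exists>s. s \<notin> P \<and> x * to_fract s \<in> range to_fract"
    using notin_Spec_nonzero[of s] by (intro exI[of _ s]) (auto simp: Fract_conv_to_fract)
next
  assume "\<exists>s. s \<notin> P \<and> x * to_fract s \<in> range to_fract"
  then obtain s a where s: "s \<notin> P" "x * to_fract s = to_fract a" by blast
  then have "x = Fract a s" using notin_Spec_nonzero[of s] by (simp add: Fract_conv_to_fract field_simps)
  then show "x \<in> local_ring P" using s by (simp add: Fract_local_ring)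
qed

lemma Fract_local_max_ideal_iff:
  assumes "s \<notin> P"
  shows "Fract a s \<in> local_max_ideal P \<longleftrightarrow> a \<in> P"
proof
  assume "Fract a s \<in> local_max_ideal P"
  then obtain b t where b: "Fract a s = Fract b t" "b \<in> P" "t \<notin> P" by (auto simp: local_max_ideal_def)
  then have "a * t = b * s" using notin_Spec_nonzero[of s] notin_Spec_nonzero[of t] assms by (simp add: eq_fract)
  then show "a \<in> P" using b SpecD(3)[OF P, of a t] SpecD(7)[OF P b(2), of s] by simp
next
  assume "a \<in> P"
  then show "Fract a s \<in> local_max_ideal P" using assms by (auto simp: local_max_ideal_def)
qed

lemma to_fract_local_max_ideal_iff: "to_fract a \<in> local_max_ideal P \<longleftrightarrow> a \<in> P"
  using Fract_local_max_ideal_iff[OF SpecD(2)[OF P], of a] by (simp add: to_fract_def)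

lemma local_max_ideal_add:
  assumes "x \<in> local_max_ideal P" "y \<in> local_max_ideal P"
  shows "x + y \<in> local_max_ideal P"
proof -
  obtain a s where a: "x = Fract a s" "a \<in> P" "s \<notin> P" using assms(1) by (auto simp: local_max_ideal_def)
  obtain b t where b: "y = Fract b t" "b \<in> P" "t \<notin> P" using assms(2) by (auto simp: local_max_ideal_def)
  have "x + y = Fract (a * t + b * s) (s * t)"
    using a b notin_Spec_nonzero[of s] notin_Spec_nonzero[of t] by simp
  moreover have "a * t + b * s \<in> P" using a b SpecD(5,7)[OF P] by blast
  ultimately show ?thesis using Spec_mult_notin[OF P a(3) b(3)] unfolding local_max_ideal_def by blast
qed

lemma local_max_ideal_mult:
  assumes "x \<in> local_max_ideal P" "y \<in> local_ring P"
  shows "y * x \<in> local_max_ideal P"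
proof -
  obtain a s where a: "x = Fract a s" "a \<in> P" "s \<notin> P" using assms(1) by (auto simp: local_max_ideal_def)
  obtain b t where b: "y = Fract b t" "t \<notin> P" using assms(2) by (auto simp: local_ring_def)
  have "y * x = Fract (b * a) (t * s)" using a b by simp
  moreover have "b * a \<in> P" using a SpecD(6)[OF P] by blast
  ultimately show ?thesis using Spec_mult_notin[OF P b(2) a(3)] unfolding local_max_ideal_def by blast
qed

lemma local_max_ideal_prime:
  assumes "x \<in> local_ring P" "y \<in> local_ring P" "x * y \<in> local_max_ideal P"
  shows "x \<in> local_max_ideal P \<or> y \<in> local_max_ideal P"
proof -
  obtain a s where a: "x = Fract a s" "s \<notin> P" using assms(1) by (auto simp: local_ring_def)
  obtain b t where b: "y = Fract b t" "t \<notin> P" using assms(2) by (auto simp: local_ring_def)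
  have "a * b \<in> P" using assms(3) Fract_local_max_ideal_iff[of "s * t" "a * b"] a b Spec_mult_notin[OF P]
    by simp
  then show ?thesis using a b Fract_local_max_ideal_iff SpecD(3)[OF P] by auto
qed

lemma inverse_local_ring:
  assumes "x \<in> local_ring P" "x \<notin> local_max_ideal P"
  shows "inverse x \<in> local_ring P"
proof -
  obtain a s where a: "x = Fract a s" "s \<notin> P" using assms(1) by (auto simp: local_ring_def)
  then have "a \<notin> P" using assms(2) Fract_local_max_ideal_iff by blast
  then show ?thesis using a by (simp add: Fract_local_ring)
qed

lemma one_notin_local_max_ideal: "1 \<notin> local_max_ideal P"
  using to_fract_local_max_ideal_iff[of 1] SpecD(2)[OF P] by simp

end

text \<open>The ring \<open>B\<close> is the copy of \<open>\<Gamma>(U)\<close> on the type that \<open>affine_open\<close> prescribes.\<close>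

lemma unit_imp_affine_open:
  fixes I :: "'a::idom set"
  defines "U \<equiv> {P \<in> Spec ring_of_type. \<not> I \<subseteq> P}"
  assumes U0: "{0} \<in> U"
    and denom: "\<And>a x. a \<in> I \<Longrightarrow> x \<in> (\<Inter>P\<in>U. local_ring P) \<Longrightarrow>
      \<exists>n. to_fract a ^ n * x \<in> range to_fract"
    and unit: "1 \<in> prod_span (to_fract ` I) (\<Inter>P\<in>U. local_ring P)"
  shows "affine_open ring_of_type U"
proof -
  interpret A: field_embedding "ring_of_type :: 'a ring" to_fract by (rule field_embedding_to_fract)
  let ?A = "ring_of_type :: 'a ring"
  define \<Gamma> where "\<Gamma> = (\<Inter>P\<in>U. local_ring P)"
  note loc = loc_to_fract[where 'a = 'a]
  have oU: "openin (zariski ?A) U" unfolding openin_zariski U_def by auto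
  have US: "U \<subseteq> Spec ?A" by (auto simp: U_def)
  have \<Gamma>_fract: "to_fract a \<in> \<Gamma>" for a using US to_fract_local_ring by (auto simp: \<Gamma>_def)
  have \<Gamma>_add: "x + y \<in> \<Gamma>" and \<Gamma>_mult: "x * y \<in> \<Gamma>" if "x \<in> \<Gamma>" "y \<in> \<Gamma>" for x y
    using that US by (auto simp: \<Gamma>_def subset_iff intro!: local_ring_add local_ring_mult)
  have \<Gamma>_01: "0 \<in> \<Gamma>" "1 \<in> \<Gamma>" using \<Gamma>_fract[of 0] \<Gamma>_fract[of 1] by simp_all
  have \<Gamma>_minus: "- x \<in> \<Gamma>" if "x \<in> \<Gamma>" for x
    using \<Gamma>_mult[OF \<Gamma>_fract[of "- 1"] that] by simp

  have denom': "\<exists>n b. to_fract a ^ n * x = to_fract b" if ax: "a \<in> I" "x \<in> \<Gamma>" for a x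
  proof -
    obtain n where "to_fract a ^ n * x \<in> range to_fract" using denom[OF ax(1)] ax(2) unfolding \<Gamma>_def by blast
    then show ?thesis by blast
  qed

  \<comment> \<open>The field of fractions is copied into the prescribed type: \<open>k\<close>
    becomes the constant function whose value is the set of all pairs that represent
    \<open>k\<close>.\<close>
  define j :: "'a fract \<Rightarrow> 'a set \<Rightarrow> ('a \<times> 'a) set" where
    "j k = (\<lambda>_. {(a, s). s \<noteq> 0 \<and> Fract a s = k})" for k
  have inj_j: "inj j"
  proof (rule injI)
    fix k l assume jkl: "j k = j l"
    obtain a s where as: "s \<noteq> 0" "k = Fract a s" by (cases k) auto
    then have "(a, s) \<in> j k {}" by (simp add: j_def)
    then have "(a, s) \<in> j l {}" by (simp only: jkl)
    then show "k = l" using as by (simp add: j_def)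
  qed
  define e where "e = inv_into UNIV j"
  have ej: "e (j k) = k" for k by (simp add: e_def inj_j)
  define B :: "('a set \<Rightarrow> ('a \<times> 'a) set) ring" where
    "B = \<lparr>carrier = j ` \<Gamma>, monoid.mult = (\<lambda>x y. j (e x * e y)), monoid.one = j 1,
          ring.zero = j 0, ring.add = (\<lambda>x y. j (e x + e y))\<rparr>"
  have B_simps: "carrier B = j ` \<Gamma>" "x \<otimes>\<^bsub>B\<^esub> y = j (e x * e y)" "\<one>\<^bsub>B\<^esub> = j 1" "\<zero>\<^bsub>B\<^esub> = j 0"
    "x \<oplus>\<^bsub>B\<^esub> y = j (e x + e y)" for x y by (simp_all add: B_def)
  have cB: "cring B"
  proof (rule cringI)
    show "abelian_group B"
    proof (rule abelian_groupI)
      fix x assume "x \<in> carrier B"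
      then obtain k where "x = j k" "k \<in> \<Gamma>" by (auto simp: B_simps)
      then show "\<exists>y\<in>carrier B. y \<oplus>\<^bsub>B\<^esub> x = \<zero>\<^bsub>B\<^esub>"
        by (intro bexI[of _ "j (- k)"]) (auto simp: B_simps ej \<Gamma>_minus)
    qed (auto simp: B_simps ej \<Gamma>_add \<Gamma>_01 algebra_simps)
    show "comm_monoid B"
      by (rule comm_monoidI) (auto simp: B_simps ej \<Gamma>_mult \<Gamma>_01 algebra_simps)
  qed (auto simp: B_simps ej algebra_simps)
  interpret B: field_embedding B e
  proof (intro field_embedding.intro field_embedding_axioms.intro cB)
    show "inj_on e (carrier B)" by (auto simp: inj_on_def B_simps ej)
  qed (auto simp: B_simps ej)

  \<comment> \<open>The sections over \<open>U\<close> that vanish at \<open>P\<close>. Contracting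
    this prime to A returns \<open>P\<close>.\<close>
  define \<phi> where "\<phi> P = j ` (\<Gamma> \<inter> local_max_ideal P)" for P
  have j_\<phi>: "j x \<in> \<phi> P \<longleftrightarrow> x \<in> \<Gamma> \<and> x \<in> local_max_ideal P" for x P
    using inj_j by (auto simp: \<phi>_def dest: injD)
  have \<phi>_Spec: "\<phi> P \<in> Spec B" if P: "P \<in> U" for P
  proof -
    have PS: "P \<in> Spec ?A" using P US by blast
    have \<Gamma>P: "\<Gamma> \<subseteq> local_ring P" using P by (auto simp: \<Gamma>_def)
    have "ideal (\<phi> P) B"
    proof (rule idealI)
      show "ring B" by (rule B.ring_axioms)
      show "subgroup (\<phi> P) (add_monoid B)"
      proof (rule group.subgroupI[OF B.a_group])
        show "\<phi> P \<subseteq> carrier (add_monoid B)" by (auto simp: \<phi>_def B_simps)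
        show "\<phi> P \<noteq> {}" using j_\<phi>[of 0 P] \<Gamma>_01 to_fract_local_max_ideal_iff[OF PS, of 0] SpecD(4)[OF PS] by auto
        show "x \<otimes>\<^bsub>add_monoid B\<^esub> y \<in> \<phi> P" if "x \<in> \<phi> P" "y \<in> \<phi> P" for x y
          using that by (auto simp: \<phi>_def B_simps ej \<Gamma>_add local_max_ideal_add[OF PS])
        show "inv\<^bsub>add_monoid B\<^esub> x \<in> \<phi> P" if x: "x \<in> \<phi> P" for x
        proof -
          obtain k where k: "x = j k" "k \<in> \<Gamma>" "k \<in> local_max_ideal P" using x by (auto simp: \<phi>_def)
          have "inv\<^bsub>add_monoid B\<^esub> x = j (- k)"
            by (rule group.inv_equality[OF B.a_group]) (use k \<Gamma>_minus in \<open>auto simp: B_simps ej\<close>)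
          moreover have "- k \<in> local_max_ideal P"
            using local_max_ideal_mult[OF PS k(3) to_fract_local_ring[OF PS, of "- 1"]] by simp
          ultimately show ?thesis using k \<Gamma>_minus by (simp add: j_\<phi>)
        qed
      qed
      show "x \<otimes>\<^bsub>B\<^esub> d \<in> \<phi> P" "d \<otimes>\<^bsub>B\<^esub> x \<in> \<phi> P" if "d \<in> \<phi> P" "x \<in> carrier B" for d x
        using that \<Gamma>P local_max_ideal_mult[OF PS] \<Gamma>_mult
        by (auto simp: \<phi>_def B_simps ej mult.commute intro!: imageI)
    qed
    moreover have "carrier B \<noteq> \<phi> P"
      using one_notin_local_max_ideal[OF PS] \<Gamma>_01 j_\<phi>[of 1 P] by (auto simp: B_simps)
    moreover have "x \<in> \<phi> P \<or> y \<in> \<phi> P" if xy: "x \<in> carrier B" "y \<in> carrier B" "x \<otimes>\<^bsub>B\<^esub> y \<in> \<phi> P" for x y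
    proof -
      obtain k l where kl: "x = j k" "y = j l" "k \<in> \<Gamma>" "l \<in> \<Gamma>" using xy by (auto simp: B_simps)
      then have "k * l \<in> local_max_ideal P" using xy(3) by (simp add: B_simps ej j_\<phi>)
      then have "k \<in> local_max_ideal P \<or> l \<in> local_max_ideal P"
        using local_max_ideal_prime[OF PS] kl \<Gamma>P by blast
      then show ?thesis using kl by (simp add: j_\<phi>)
    qed
    ultimately have "primeideal (\<phi> P) B" using cB by (intro primeidealI) auto
    then show ?thesis by (simp add: Spec_def)
  qed
  have contract: "{a. j (to_fract a) \<in> \<phi> P} = P" if "P \<in> U" for P
    using that US to_fract_local_max_ideal_iff \<Gamma>_fract by (auto simp: j_\<phi> subset_iff)
  have \<phi>_surj: "\<exists>P\<in>U. \<phi> P = Q" if Q: "Q \<in> Spec B" for Q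
  proof -
    interpret Q: primeideal Q B using Q by (rule Spec_primeideal)
    define P where "P = {a. j (to_fract a) \<in> Q}"
    have Qs: "Q \<subseteq> j ` \<Gamma>" using Q.a_subset by (simp add: B_simps)
    have Qadd: "j (x + y) \<in> Q" if "j x \<in> Q" "j y \<in> Q" for x y
      using additive_subgroup.a_closed[OF Q.is_additive_subgroup that] by (simp add: B_simps ej)
    have Qmult: "j (x * y) \<in> Q" if "x \<in> \<Gamma>" "j y \<in> Q" for x y
      using Q.I_l_closed[OF that(2), of "j x"] that(1) by (simp add: B_simps ej)
    have Qprime: "j x \<in> Q \<or> j y \<in> Q" if "j (x * y) \<in> Q" "x \<in> \<Gamma>" "y \<in> \<Gamma>" for x y
      using Q.I_prime[of "j x" "j y"] that by (simp add: B_simps ej)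
    have Q0: "j 0 \<in> Q" using additive_subgroup.zero_closed[OF Q.is_additive_subgroup] by (simp add: B_simps)
    have Q1: "j 1 \<notin> Q" using Q.one_notin by (simp add: B_simps)
    have PS: "P \<in> Spec ?A"
      unfolding Spec_ring_of_type_iff
    proof (intro conjI allI impI)
      show "ideal P ?A" using Qadd Qmult Q0 \<Gamma>_fract by (intro ideal_ring_of_typeI) (auto simp: P_def)
      show "1 \<notin> P" using Q1 by (simp add: P_def)
      show "x \<in> P \<or> y \<in> P" if "x * y \<in> P" for x y using that Qprime \<Gamma>_fract by (simp add: P_def)
    qed
    \<comment> \<open>Otherwise every element of I\<Gamma>(U) would lie in \<open>Q\<close>,
      including 1 by the hypothesis \<open>unit\<close>.\<close>
    have "\<not> I \<subseteq> P"
    proof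
      assume IP: "I \<subseteq> P"
      have "j u \<in> Q" if "u \<in> prod_span (to_fract ` I) \<Gamma>" for u
        using that
      proof induction
        case (step x y z)
        have "j (y * x) \<in> Q" using step IP by (intro Qmult) (auto simp: P_def)
        then show ?case using Qadd step.IH by (simp add: mult.commute)
      qed (rule Q0)
      then show False using unit Q1 by (simp add: \<Gamma>_def)
    qed
    then obtain a where a: "a \<in> I" "a \<notin> P" by blast
    have PU: "P \<in> U" using PS \<open>\<not> I \<subseteq> P\<close> by (simp add: U_def)
    \<comment> \<open>Multiplying by a power of \<open>a\<close> moves \<open>x\<close> into A
      without changing membership in either prime, as \<open>a\<close> lies in neither; on A the two
      primes agree.\<close>
    have "j x \<in> \<phi> P \<longleftrightarrow> j x \<in> Q" if x: "x \<in> \<Gamma>" for x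
    proof -
      obtain n b where b: "to_fract a ^ n * x = to_fract b" using denom'[OF a(1) x] by blast
      have pow: "to_fract a ^ n = to_fract (a ^ n)" by (induction n) auto
      have an: "a ^ n \<notin> P" using Spec_power_notin[OF PS a(2)] .
      have "j x \<in> Q \<longleftrightarrow> j (to_fract (a ^ n) * x) \<in> Q"
        using an Qmult[of "to_fract (a ^ n)" x] Qprime[of "to_fract (a ^ n)" x] \<Gamma>_fract x by (auto simp: P_def)
      also have "\<dots> \<longleftrightarrow> b \<in> P" using b by (simp add: P_def pow)
      also have "\<dots> \<longleftrightarrow> to_fract (a ^ n) * x \<in> local_max_ideal P"
        using to_fract_local_max_ideal_iff[OF PS, of b] b by (simp add: pow)
      also have "\<dots> \<longleftrightarrow> x \<in> local_max_ideal P"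
        using local_max_ideal_prime[OF PS, of "to_fract (a ^ n)" x] local_max_ideal_mult[OF PS, of x "to_fract (a ^ n)"]
          to_fract_local_ring[OF PS] to_fract_local_max_ideal_iff[OF PS] an x PU by (auto simp: \<Gamma>_def)
      finally show ?thesis using x by (simp add: j_\<phi>)
    qed
    then have "\<phi> P = Q" using Qs by (auto simp: \<phi>_def)
    then show ?thesis using PU by blast
  qed
  have \<phi>_img: "\<phi> ` U = Spec B" using \<phi>_Spec \<phi>_surj by blast
  have \<phi>_inj: "inj_on \<phi> U" by (rule inj_onI) (metis contract)

  \<comment> \<open>Elements of \<Gamma>(U) outside \<open>\<phi> P\<close> are units at
    \<open>P\<close>, and A lies in \<Gamma>(U), so localizing either ring gives the same subring of
    the field.\<close>
  have BA_loc: "B.loc (\<phi> P) = A.loc P" if P: "P \<in> U" for P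
  proof -
    have PS: "P \<in> Spec ?A" using P US by blast
    have "k \<in> A.loc P" if "k \<in> B.loc (\<phi> P)" for k
    proof -
      obtain x y where xy: "k = e x / e y" "x \<in> carrier B" "y \<in> carrier B - \<phi> P" using \<open>k \<in> B.loc (\<phi> P)\<close> by (rule B.locE)
      then obtain x' y' where x'y': "x = j x'" "y = j y'" "x' \<in> \<Gamma>" "y' \<in> \<Gamma>" by (auto simp: B_simps)
      have "y' \<notin> local_max_ideal P" using xy(3) x'y' by (auto simp: j_\<phi>)
      then have "inverse y' \<in> local_ring P" using inverse_local_ring[OF PS] x'y'(4) P by (auto simp: \<Gamma>_def)
      then have "x' * inverse y' \<in> local_ring P" using local_ring_mult[OF PS] x'y'(3) P by (auto simp: \<Gamma>_def)
      then show ?thesis using xy(1) x'y'(1,2) by (simp add: ej loc divide_inverse)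
    qed
    moreover have "k \<in> B.loc (\<phi> P)" if "k \<in> A.loc P" for k
    proof -
      obtain a s where "k = to_fract a / to_fract s" "s \<in> carrier ?A - P" using \<open>k \<in> A.loc P\<close> by (rule A.locE)
      then have "k = e (j (to_fract a)) / e (j (to_fract s))" "j (to_fract s) \<in> carrier B - \<phi> P"
        using \<Gamma>_fract to_fract_local_max_ideal_iff[OF PS] by (auto simp: ej B_simps j_\<phi>)
      moreover have "j (to_fract a) \<in> carrier B" using \<Gamma>_fract by (simp add: B_simps)
      ultimately show ?thesis unfolding B.loc_def by blast
    qed
    ultimately show ?thesis by blast
  qed

  let ?X = "subtopology (zariski ?A) U"
  have tX: "topspace ?X = U" using US by (auto simp: topspace_zariski)
  have oX: "openin ?X W \<longleftrightarrow> openin (zariski ?A) W \<and> W \<subseteq> U" for W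
    by (rule openin_open_subtopology[OF oU])
  define pre where "pre V = {P \<in> U. \<phi> P \<in> V}" for V
  have pre_open: "openin (zariski ?A) (pre V)" if V: "openin (zariski B) V" for V
  proof -
    obtain E where E: "E \<subseteq> carrier B" "V = {P \<in> Spec B. \<not> E \<subseteq> P}" using V unfolding openin_zariski by blast
    \<comment> \<open>Numerators in A of the elements of \<open>E\<close>, each with a factor from
      \<open>I\<close> that confines the open set of \<open>F\<close> to \<open>U\<close>.\<close>
    define F where "F = {a * c | a c. a \<in> I \<and> (\<exists>x n. j x \<in> E \<and> to_fract c = to_fract a ^ n * x)}"
    have "P \<in> pre V \<longleftrightarrow> \<not> F \<subseteq> P" if PS: "P \<in> Spec ?A" for P
    proof
      assume "P \<in> pre V"
      then have PU: "P \<in> U" and "\<not> E \<subseteq> \<phi> P" using E by (auto simp: pre_def)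
      then obtain y where y: "y \<in> E" "y \<notin> \<phi> P" by blast
      then obtain x where "y = j x" "x \<in> \<Gamma>" using E(1) by (auto simp: B_simps)
      then have x: "j x \<in> E" "x \<in> \<Gamma>" "x \<notin> local_max_ideal P" using y by (auto simp: j_\<phi>)
      obtain a where a: "a \<in> I" "a \<notin> P" using PU by (auto simp: U_def)
      obtain n b where b: "to_fract a ^ n * x = to_fract b" using denom'[OF a(1) x(2)] by blast
      have "to_fract b = to_fract a ^ n * x" using b by simp
      then have "a * b \<in> F" using x(1) a(1) unfolding F_def by blast
      moreover have "b \<notin> P"
      proof
        assume "b \<in> P"
        have pow: "to_fract a ^ n = to_fract (a ^ n)" by (induction n) auto
        have "to_fract (a ^ n) * x \<in> local_max_ideal P"
          using b \<open>b \<in> P\<close> to_fract_local_max_ideal_iff[OF PS, of b] by (simp add: pow)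
        then show False using local_max_ideal_prime[OF PS, of "to_fract (a ^ n)" x] x PU
          to_fract_local_ring[OF PS] to_fract_local_max_ideal_iff[OF PS] Spec_power_notin[OF PS a(2), of n]
          by (auto simp: \<Gamma>_def)
      qed
      ultimately show "\<not> F \<subseteq> P" using Spec_mult_notin[OF PS a(2)] by blast
    next
      assume "\<not> F \<subseteq> P"
      then obtain a c x n where b: "a * c \<notin> P" "j x \<in> E" "a \<in> I" "to_fract c = to_fract a ^ n * x"
        by (auto simp: F_def)
      have pow: "to_fract a ^ n = to_fract (a ^ n)" by (induction n) auto
      have "a \<notin> P" "c \<notin> P" using b(1) SpecD(6,7)[OF PS] by auto
      then have PU: "P \<in> U" using PS b(3) by (auto simp: U_def)
      have "x \<notin> local_max_ideal P"
        using local_max_ideal_mult[OF PS, of x "to_fract (a ^ n)"] to_fract_local_ring[OF PS]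
          to_fract_local_max_ideal_iff[OF PS, of c] b(4) \<open>c \<notin> P\<close> by (auto simp: pow)
      then have "\<not> E \<subseteq> \<phi> P" using b(2) j_\<phi> by blast
      then show "P \<in> pre V" using PU \<phi>_Spec E(2) by (simp add: pre_def)
    qed
    moreover have "pre V \<subseteq> Spec ?A" using US by (auto simp: pre_def)
    ultimately have "pre V = {P \<in> Spec ?A. \<not> F \<subseteq> P}" by auto
    then show ?thesis unfolding openin_zariski by auto
  qed
  have hom: "homeomorphic_map ?X (zariski B) \<phi>"
  proof (rule bijective_open_imp_homeomorphic_map)
    show "continuous_map ?X (zariski B) \<phi>"
      unfolding continuous_map_def tX topspace_zariski
      using \<phi>_Spec pre_open by (auto simp: oX pre_def)
    show "open_map ?X (zariski B) \<phi>"
      unfolding open_map_def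
    proof (intro allI impI)
      fix W assume "openin ?X W"
      then obtain E where E: "W = {P \<in> Spec ?A. \<not> E \<subseteq> P}" and WU: "W \<subseteq> U"
        unfolding oX openin_zariski by blast
      have "\<phi> ` W = {Q \<in> Spec B. \<not> (j \<circ> to_fract) ` E \<subseteq> Q}"
      proof -
        have iff: "P \<in> W \<longleftrightarrow> \<not> (j \<circ> to_fract) ` E \<subseteq> \<phi> P" if "P \<in> U" for P
          using contract[OF that] that US E by auto
        show ?thesis
        proof (intro equalityI subsetI)
          fix Q assume "Q \<in> \<phi> ` W"
          then obtain P where P: "P \<in> W" "Q = \<phi> P" by blast
          then have "P \<in> U" using WU by blast
          then show "Q \<in> {Q \<in> Spec B. \<not> (j \<circ> to_fract) ` E \<subseteq> Q}" using iff[of P] \<phi>_Spec[of P] P by simp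
        next
          fix Q assume Q: "Q \<in> {Q \<in> Spec B. \<not> (j \<circ> to_fract) ` E \<subseteq> Q}"
          then obtain P where P: "P \<in> U" "\<phi> P = Q" using \<phi>_surj[of Q] by blast
          then show "Q \<in> \<phi> ` W" using iff[of P] Q by blast
        qed
      qed
      moreover have "(j \<circ> to_fract) ` E \<subseteq> carrier B" using \<Gamma>_fract by (auto simp: B_simps)
      ultimately show "openin (zariski B) (\<phi> ` W)" unfolding openin_zariski by blast
    qed
    show "\<phi> ` topspace ?X = topspace (zariski B)" unfolding tX topspace_zariski by (rule \<phi>_img)
    show "inj_on \<phi> (topspace ?X)" unfolding tX by (rule \<phi>_inj)
  qed

  \<comment> \<open>A section is carried over by keeping its value in the common field of
    fractions.\<close>
  define \<theta> where "\<theta> V s = (\<lambda>P\<in>pre V. A.germ P (B.germ_value (s (\<phi> P))))" for V s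
  have \<theta>_germ: "\<theta> V (\<lambda>Q\<in>V. B.germ Q k) = (\<lambda>P\<in>pre V. A.germ P k)" if k: "\<And>Q. Q \<in> V \<Longrightarrow> k \<in> B.loc Q" for V k
    unfolding \<theta>_def by (rule restrict_ext) (use B.germ_value[OF \<phi>_Spec] k in \<open>simp add: pre_def\<close>)
  have locV: "k \<in> A.loc P" if "\<And>Q. Q \<in> V \<Longrightarrow> k \<in> B.loc Q" "P \<in> pre V" for k V P
    using that BA_loc by (auto simp: pre_def)
  have pre_image: "\<phi> ` pre V = V" if "openin (zariski B) V" for V
  proof -
    have "V \<subseteq> \<phi> ` U" using openin_subset[OF that] \<phi>_img by (simp add: topspace_zariski)
    then show ?thesis unfolding pre_def by blast
  qed
  have iso: "\<theta> V \<in> ring_iso (structure_sheaf B V) (structure_sheaf ?A (pre V))" if V: "openin (zariski B) V" for V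
  proof (rule ring_iso_memI)
    note W = pre_open[OF V]
    have sec: "\<exists>k. s = (\<lambda>Q\<in>V. B.germ Q k) \<and> (\<forall>Q\<in>V. k \<in> B.loc Q)"
      if "s \<in> carrier (structure_sheaf B V)" for s
      using B.section_germ[OF V that] by metis
    show \<theta>_carrier: "\<theta> V s \<in> carrier (structure_sheaf ?A (pre V))"
      if s: "s \<in> carrier (structure_sheaf B V)" for s
    proof -
      obtain k where k: "s = (\<lambda>Q\<in>V. B.germ Q k)" "\<And>Q. Q \<in> V \<Longrightarrow> k \<in> B.loc Q" using sec[OF s] by blast
      have "k \<in> A.loc P" if "P \<in> pre V" for P using locV[of V k P] k(2) that by blast
      then have "(\<lambda>P\<in>pre V. A.germ P k) \<in> carrier (structure_sheaf ?A (pre V))"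
        by (rule A.germ_section[OF W])
      moreover have "\<theta> V s = (\<lambda>P\<in>pre V. A.germ P k)" unfolding k(1) by (rule \<theta>_germ) (rule k(2))
      ultimately show ?thesis by simp
    qed
    show "\<theta> V (s \<otimes>\<^bsub>structure_sheaf B V\<^esub> t) = \<theta> V s \<otimes>\<^bsub>structure_sheaf ?A (pre V)\<^esub> \<theta> V t"
      if st: "s \<in> carrier (structure_sheaf B V)" "t \<in> carrier (structure_sheaf B V)" for s t
    proof -
      obtain k where k: "s = (\<lambda>Q\<in>V. B.germ Q k)" "\<And>Q. Q \<in> V \<Longrightarrow> k \<in> B.loc Q" using sec[OF st(1)] by blast
      obtain l where l: "t = (\<lambda>Q\<in>V. B.germ Q l)" "\<And>Q. Q \<in> V \<Longrightarrow> l \<in> B.loc Q" using sec[OF st(2)] by blast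
      have "k * l \<in> B.loc Q" if "Q \<in> V" for Q
        using that k(2) l(2) B.germ_mult(2)[of Q] openin_subset[OF V] by (auto simp: topspace_zariski)
      then show ?thesis
        using k l locV[of V k] locV[of V l] by (simp add: B.section_mult[OF V] \<theta>_germ A.section_mult[OF W])
    qed
    show "\<theta> V (s \<oplus>\<^bsub>structure_sheaf B V\<^esub> t) = \<theta> V s \<oplus>\<^bsub>structure_sheaf ?A (pre V)\<^esub> \<theta> V t"
      if st: "s \<in> carrier (structure_sheaf B V)" "t \<in> carrier (structure_sheaf B V)" for s t
    proof -
      obtain k where k: "s = (\<lambda>Q\<in>V. B.germ Q k)" "\<And>Q. Q \<in> V \<Longrightarrow> k \<in> B.loc Q" using sec[OF st(1)] by blast
      obtain l where l: "t = (\<lambda>Q\<in>V. B.germ Q l)" "\<And>Q. Q \<in> V \<Longrightarrow> l \<in> B.loc Q" using sec[OF st(2)] by blast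
      have "k + l \<in> B.loc Q" if "Q \<in> V" for Q
        using that k(2) l(2) B.germ_add(2)[of Q] openin_subset[OF V] by (auto simp: topspace_zariski)
      then show ?thesis
        using k l locV[of V k] locV[of V l] by (simp add: B.section_add[OF V] \<theta>_germ A.section_add[OF W])
    qed
    have "1 \<in> B.loc Q" if "Q \<in> V" for Q
      using that B.one_loc openin_subset[OF V] by (auto simp: topspace_zariski)
    then show "\<theta> V \<one>\<^bsub>structure_sheaf B V\<^esub> = \<one>\<^bsub>structure_sheaf ?A (pre V)\<^esub>"
      by (simp add: B.section_one[OF V] A.section_one[OF W] \<theta>_germ)
    show "bij_betw (\<theta> V) (carrier (structure_sheaf B V)) (carrier (structure_sheaf ?A (pre V)))"
    proof (rule bij_betw_imageI)
      show "inj_on (\<theta> V) (carrier (structure_sheaf B V))"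
      proof (rule inj_onI)
        fix s t assume st: "s \<in> carrier (structure_sheaf B V)" "t \<in> carrier (structure_sheaf B V)" "\<theta> V s = \<theta> V t"
        obtain k where k: "s = (\<lambda>Q\<in>V. B.germ Q k)" "\<And>Q. Q \<in> V \<Longrightarrow> k \<in> B.loc Q" using sec[OF st(1)] by blast
        obtain l where l: "t = (\<lambda>Q\<in>V. B.germ Q l)" "\<And>Q. Q \<in> V \<Longrightarrow> l \<in> B.loc Q" using sec[OF st(2)] by blast
        \<comment> \<open>Over a nonempty set the common value can be read off at one point; over
          the empty set there is only one section.\<close>
        show "s = t"
        proof (cases "V = {}")
          case False
          then obtain P where P: "P \<in> pre V" using pre_image[OF V] by blast
          have "(\<lambda>P\<in>pre V. A.germ P k) = (\<lambda>P\<in>pre V. A.germ P l)" using st(3) k l by (simp add: \<theta>_germ)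
          then have "A.germ P k = A.germ P l" using P by (metis restrict_apply')
          moreover have "k \<in> A.loc P" "l \<in> A.loc P" using locV k(2) l(2) P by blast+
          moreover have "P \<in> Spec ?A" using P US by (auto simp: pre_def)
          ultimately have "k = l" using A.germ_eq_iff by blast
          then show ?thesis using k l by simp
        qed (simp add: k l restrict_def)
      qed
      show "\<theta> V ` carrier (structure_sheaf B V) = carrier (structure_sheaf ?A (pre V))"
      proof (intro equalityI subsetI)
        show "t \<in> carrier (structure_sheaf ?A (pre V))" if "t \<in> \<theta> V ` carrier (structure_sheaf B V)" for t
          using that \<theta>_carrier by blast
        fix t assume "t \<in> carrier (structure_sheaf ?A (pre V))"
        then obtain k where k: "t = (\<lambda>P\<in>pre V. A.germ P k)" "\<And>P. P \<in> pre V \<Longrightarrow> k \<in> A.loc P"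
          using A.section_germ[OF W] by blast
        have "k \<in> B.loc Q" if Q: "Q \<in> V" for Q
        proof -
          obtain P where "P \<in> pre V" "Q = \<phi> P" using Q pre_image[OF V] by blast
          then show ?thesis using k(2) BA_loc by (auto simp: pre_def)
        qed
        then have "(\<lambda>Q\<in>V. B.germ Q k) \<in> carrier (structure_sheaf B V)" "t = \<theta> V (\<lambda>Q\<in>V. B.germ Q k)"
          using B.germ_section[OF V, of k] \<theta>_germ[of V k] k(1) by simp_all
        then show "t \<in> \<theta> V ` carrier (structure_sheaf B V)" by blast
      qed
    qed
  qed
  have res: "\<theta> W (restrict s W) = restrict (\<theta> V s) (pre W)" if "W \<subseteq> V" for V W s
  proof -
    have "pre V \<inter> pre W = pre W" using that by (auto simp: pre_def)
    moreover have "restrict s W (\<phi> P) = s (\<phi> P)" if "P \<in> pre W" for P using that by (simp add: pre_def)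
    ultimately show ?thesis unfolding \<theta>_def restrict_restrict by (simp cong: restrict_cong)
  qed
  have "ringed_space_isomorphic ?X (structure_sheaf ?A) (zariski B) (structure_sheaf B)"
    unfolding ringed_space_isomorphic_def tX
    by (intro exI[of _ \<phi>] exI[of _ \<theta>] conjI)
      (use hom iso[unfolded pre_def] res[unfolded pre_def] in auto)
  then show ?thesis using oU cB unfolding affine_open_def by blast
qed

section \<open>Valuations at the height one primes\<close>

definition unit_at :: "'a::idom set \<Rightarrow> 'a fract \<Rightarrow> bool" where
  "unit_at P u \<longleftrightarrow> u \<noteq> 0 \<and> u \<in> local_ring P \<and> inverse u \<in> local_ring P"

lemma unit_at_inverse: "unit_at P u \<Longrightarrow> unit_at P (inverse u)"
  by (simp add: unit_at_def)

context
  fixes P :: "'a::idom set"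
  assumes P: "P \<in> Spec ring_of_type"
begin

lemma unit_at_mult: "unit_at P u \<Longrightarrow> unit_at P v \<Longrightarrow> unit_at P (u * v)"
  by (simp add: unit_at_def local_ring_mult[OF P])

lemma unit_at_one: "unit_at P 1"
  using to_fract_local_ring[OF P, of 1] by (simp add: unit_at_def)

lemma unit_at_power_int: "unit_at P u \<Longrightarrow> unit_at P (u powi n)"
proof (induction n rule: int_induct[where k = 0])
  case base then show ?case by (simp add: unit_at_one)
next
  case (step1 i)
  then have "u powi (i + 1) = u powi i * u" by (simp add: power_int_add_1 unit_at_def)
  then show ?case using step1 by (simp add: unit_at_mult)
next
  case (step2 i)
  then have "u powi (i - 1) = u powi i * inverse u" by (simp add: power_int_diff unit_at_def divide_inverse)
  then show ?case using step2 by (simp add: unit_at_mult unit_at_inverse)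
qed

lemma unit_at_notin_max: "unit_at P u \<Longrightarrow> u \<notin> local_max_ideal P"
  using local_max_ideal_mult[OF P, of u "inverse u"] one_notin_local_max_ideal[OF P]
  by (auto simp: unit_at_def)

lemma unit_at_iff: "unit_at P u \<longleftrightarrow> u \<in> local_ring P \<and> u \<notin> local_max_ideal P"
proof -
  have "0 \<in> local_max_ideal P" using to_fract_local_max_ideal_iff[OF P, of 0] SpecD(4)[OF P] by simp
  then show ?thesis using unit_at_notin_max inverse_local_ring[OF P] by (auto simp: unit_at_def)
qed

lemma uniformizer_mem: "uniformizer P \<pi> \<Longrightarrow> \<pi> \<in> local_max_ideal P"
  using to_fract_local_ring[OF P, of 1] by (force simp: uniformizer_def)

text \<open>Each uniformizer is a multiple of the other by an element of the local ring. This makes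
  orders independent of the choice.\<close>

lemma uniformizer_unique:
  assumes "uniformizer P \<pi>" "uniformizer P \<rho>" "\<pi> \<noteq> 0"
  obtains v where "unit_at P v" "\<pi> = v * \<rho>"
proof -
  obtain x where x: "x \<in> local_ring P" "\<pi> = \<rho> * x"
    using uniformizer_mem[OF assms(1)] assms(2) by (auto simp: uniformizer_def)
  obtain y where y: "y \<in> local_ring P" "\<rho> = \<pi> * y"
    using uniformizer_mem[OF assms(2)] assms(1) by (auto simp: uniformizer_def)
  have "\<pi> * (y * x) = \<pi> * 1" using x y by (simp add: mult.assoc)
  then have "y * x = 1" using assms(3) by simp
  then have "inverse x = y" by (metis inverse_unique mult.commute)
  then have "unit_at P x" using x y \<open>y * x = 1\<close> by (auto simp: unit_at_def)
  then show thesis using that x by (simp add: mult.commute)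
qed

end

text \<open>Zero is listed separately because \<open>ord_at P 0\<close> is a junk value.\<close>

definition divisor_sections :: "('a::idom set \<Rightarrow> int) \<Rightarrow> 'a fract set" where
  "divisor_sections D = {x. x = 0 \<or> (\<forall>P\<in>height_one_primes. 0 \<le> ord_at P x + D P)}"

context noetherian_normal_domain
begin

text \<open>The uniformizer is found in A itself, where \<open>order_exists\<close> can work with
  divisibility.\<close>

lemma height_one_uniformizer:
  assumes P: "P \<in> height_one_primes"
  obtains \<pi> :: 'a where "\<pi> \<in> P" "\<pi> \<noteq> 0" "uniformizer P (to_fract \<pi>)"
    "\<And>p. p \<in> P \<Longrightarrow> \<exists>s. s \<notin> P \<and> \<pi> dvd s * p"
proof -
  note PS = height_one_primesD(1)[OF P]
  obtain a where a: "a \<in> P" "a \<noteq> 0" using height_one_primesD(3)[OF P] by blast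
  obtain b where b: "P = {r. a dvd r * b}" using height_one_associated[OF P a] by blast
  obtain \<pi> where pi: "\<pi> \<in> P" "\<pi> \<noteq> 0" "\<And>p. p \<in> P \<Longrightarrow> \<exists>s. s \<notin> P \<and> \<pi> dvd s * p"
    using associated_prime_uniformizer[OF PS b a(2)] by blast
  have "x \<in> {to_fract \<pi> * y | y. y \<in> local_ring P}" if "x \<in> local_max_ideal P" for x
  proof -
    obtain p t where p: "x = Fract p t" "p \<in> P" "t \<notin> P" using \<open>x \<in> local_max_ideal P\<close> by (auto simp: local_max_ideal_def)
    obtain s where "s \<notin> P" "\<pi> dvd s * p" using pi(3) p(2) by blast
    then obtain c where s: "s \<notin> P" "s * p = \<pi> * c" by (auto elim: dvdE)
    have "x = to_fract \<pi> * Fract c (s * t)"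
    proof -
      have "to_fract s * to_fract p = to_fract \<pi> * to_fract c" using s(2) by (metis to_fract_mult)
      moreover have "x = (to_fract s * to_fract p) / (to_fract s * to_fract t)"
        using p s notin_Spec_nonzero[OF PS, of s] by (simp add: Fract_conv_to_fract)
      ultimately show ?thesis by (simp add: Fract_conv_to_fract)
    qed
    moreover have "Fract c (s * t) \<in> local_ring P" using Fract_local_ring Spec_mult_notin[OF PS s(1) p(3)] PS by blast
    ultimately show ?thesis by blast
  qed
  moreover have "to_fract \<pi> * y \<in> local_max_ideal P" if "y \<in> local_ring P" for y
    using local_max_ideal_mult[OF PS, of "to_fract \<pi>" y] to_fract_local_max_ideal_iff[OF PS] pi(1) that
    by (simp add: mult.commute)
  ultimately have "uniformizer P (to_fract \<pi>)" unfolding uniformizer_def by blast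
  then show thesis using that pi by blast
qed

lemma uniformizer_nonzero:
  assumes P: "P \<in> height_one_primes" and pi: "uniformizer P (\<pi> :: 'a fract)"
  shows "\<pi> \<noteq> 0"
proof
  assume "\<pi> = 0"
  obtain a where a: "a \<in> P" "a \<noteq> 0" using height_one_primesD(3)[OF P] by blast
  then have "to_fract a \<in> local_max_ideal P"
    using to_fract_local_max_ideal_iff height_one_primesD(1)[OF P] by blast
  then show False using pi \<open>\<pi> = 0\<close> a by (auto simp: uniformizer_def)
qed

lemma order_decomposition:
  assumes P: "P \<in> height_one_primes" and pi: "uniformizer P \<pi>" and x: "(x :: 'a fract) \<noteq> 0"
  obtains n u where "unit_at P u" "x = u * \<pi> powi n"
proof -
  note PS = height_one_primesD(1)[OF P]
  obtain \<rho> where r: "\<rho> \<in> P" "\<rho> \<noteq> 0" "uniformizer P (to_fract \<rho>)"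
    "\<And>p. p \<in> P \<Longrightarrow> \<exists>s. s \<notin> P \<and> \<rho> dvd s * p" using height_one_uniformizer[OF P] by blast
  have fract: "\<exists>n u. unit_at P u \<and> to_fract a = u * to_fract \<rho> ^ n" if a: "a \<noteq> 0" for a
  proof -
    obtain n s t where st: "s \<notin> P" "t \<notin> P" "s * a = t * \<rho> ^ n"
      using order_exists[OF PS r(1,2,4) a] by blast
    have nz: "s \<noteq> 0" "t \<noteq> 0" using notin_Spec_nonzero[OF PS] st by auto
    have pow: "to_fract (\<rho> ^ n) = to_fract \<rho> ^ n" by (induction n) auto
    have "to_fract s * to_fract a = to_fract t * to_fract \<rho> ^ n" using st(3) by (metis to_fract_mult pow)
    then have "to_fract a = Fract t s * to_fract \<rho> ^ n" using nz by (simp add: Fract_conv_to_fract field_simps)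
    moreover have "unit_at P (Fract t s)"
      using st nz Fract_local_ring[OF PS] by (auto simp: unit_at_def Fract_conv_to_fract)
    ultimately show ?thesis by blast
  qed
  obtain a b where ab: "b \<noteq> 0" "x = Fract a b" by (cases x) auto
  then have a: "a \<noteq> 0" using x by (auto simp: Fract_conv_to_fract)
  obtain n u where u: "unit_at P u" "to_fract a = u * to_fract \<rho> ^ n" using fract[OF a] by blast
  obtain m v where v: "unit_at P v" "to_fract b = v * to_fract \<rho> ^ m" using fract[OF ab(1)] by blast
  have rn: "to_fract \<rho> \<noteq> 0" using r(2) by simp
  obtain w where w: "unit_at P w" "to_fract \<rho> = w * \<pi>" using uniformizer_unique[OF PS r(3) pi rn] by blast
  \<comment> \<open>Passing from the special uniformizer \<open>\<rho>\<close> to the given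
    \<open>\<pi>\<close> will cost only a power of the unit \<open>w\<close>.\<close>
  have "x = (u * inverse v) * (to_fract \<rho> powi (int n - int m))"
    using ab u v rn by (simp add: Fract_conv_to_fract power_int_diff divide_inverse)
  also have "\<dots> = (u * inverse v * w powi (int n - int m)) * \<pi> powi (int n - int m)"
    unfolding w(2) power_int_mult_distrib by (simp add: mult.assoc)
  finally have "x = (u * inverse v * w powi (int n - int m)) * \<pi> powi (int n - int m)" .
  moreover have "unit_at P (u * inverse v * w powi (int n - int m))"
    using u v w PS by (intro unit_at_mult unit_at_inverse unit_at_power_int)
  ultimately show thesis using that by blast
qed

text \<open>If the exponents differed, dividing out the smaller power would put a unit into the
  maximal ideal.\<close>

lemma order_unique:
  assumes P: "P \<in> height_one_primes" and pi: "uniformizer P \<pi>"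
    and u: "unit_at P u" "unit_at P v" and eq: "u * \<pi> powi n = v * (\<pi> :: 'a fract) powi m"
  shows "n = m"
proof -
  note PS = height_one_primesD(1)[OF P]
  have nz: "\<pi> \<noteq> 0" using uniformizer_nonzero[OF P pi] .
  have *: "\<not> i < k" if uv: "unit_at P u" "unit_at P v" and eq: "u * \<pi> powi i = v * \<pi> powi k" for u v i k
  proof
    assume "i < k"
    then obtain l where l: "k = i + int (Suc l)" by (metis zless_iff_Suc_zadd)
    have "u * \<pi> powi i = v * (\<pi> powi i * \<pi> ^ Suc l)"
      using eq nz unfolding l by (simp add: power_int_add flip: power_int_of_nat)
    then have "u = v * \<pi> ^ Suc l" using nz by (simp add: algebra_simps)
    also have "\<dots> = (v * \<pi> ^ l) * \<pi>" by (simp add: mult.assoc mult.commute)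
    also have "\<dots> \<in> local_max_ideal P"
      using uniformizer_mem[OF PS pi] uv(2)
      by (intro local_max_ideal_mult[OF PS] local_ring_mult[OF PS] local_ring_power[OF PS])
        (auto simp: unit_at_def local_max_ideal_subset[THEN subsetD])
    finally show False using unit_at_notin_max[OF PS uv(1)] by blast
  qed
  show ?thesis using *[OF u eq] *[OF u(2,1) eq[symmetric]] by simp
qed

text \<open>The definite description in \<open>ord_at\<close> ranges over all uniformizers, so
  uniqueness has to absorb a change of uniformizer besides a change of unit.\<close>

lemma ord_atI:
  assumes P: "P \<in> height_one_primes" and pi: "uniformizer P \<pi>" and u: "unit_at P u"
    and x: "x = u * (\<pi> :: 'a fract) powi n"
  shows "ord_at P x = n"
  unfolding ord_at_def
proof (rule the_equality)
  note PS = height_one_primesD(1)[OF P]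
  show "\<exists>\<pi> u. uniformizer P \<pi> \<and> u \<noteq> 0 \<and> u \<in> local_ring P \<and> inverse u \<in> local_ring P \<and> x = u * \<pi> powi n"
    using pi u x unfolding unit_at_def by blast
  fix m assume "\<exists>\<pi> u. uniformizer P \<pi> \<and> u \<noteq> 0 \<and> u \<in> local_ring P \<and> inverse u \<in> local_ring P \<and> x = u * \<pi> powi m"
  then obtain \<rho> v where r: "uniformizer P \<rho>" "unit_at P v" "x = v * \<rho> powi m" unfolding unit_at_def by blast
  obtain w where w: "unit_at P w" "\<rho> = w * \<pi>"
    using uniformizer_unique[OF PS r(1) pi uniformizer_nonzero[OF P r(1)]] by blast
  have "u * \<pi> powi n = (v * w powi m) * \<pi> powi m"
    using x r(3) w(2) by (simp add: power_int_mult_distrib mult.assoc)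
  then show "m = n" using order_unique[OF P pi u] r(2) w(1) PS
    by (metis unit_at_mult unit_at_power_int)
qed

lemma ord_at_decomposition:
  assumes P: "P \<in> height_one_primes" and pi: "uniformizer P \<pi>" and x: "(x :: 'a fract) \<noteq> 0"
  obtains u where "unit_at P u" "x = u * \<pi> powi ord_at P x"
  using order_decomposition[OF assms] ord_atI[OF P pi] by metis

lemma uniformizer_exists:
  assumes P: "P \<in> height_one_primes"
  obtains \<pi> :: "'a fract" where "uniformizer P \<pi>"
  using height_one_uniformizer[OF P] by blast

context
  fixes P :: "'a set"
  assumes P: "P \<in> height_one_primes"
begin

lemma ord_at_mult:
  assumes "x \<noteq> 0" "y \<noteq> 0"
  shows "ord_at P (x * y) = ord_at P x + ord_at P y"
proof -
  obtain \<pi> :: "'a fract" where pi: "uniformizer P \<pi>" using uniformizer_exists[OF P] .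
  obtain u where u: "unit_at P u" "x = u * \<pi> powi ord_at P x" using ord_at_decomposition[OF P pi assms(1)] .
  obtain v where v: "unit_at P v" "y = v * \<pi> powi ord_at P y" using ord_at_decomposition[OF P pi assms(2)] .
  have "x * y = (u * v) * \<pi> powi (ord_at P x + ord_at P y)"
    using uniformizer_nonzero[OF P pi] by (subst u(2), subst v(2)) (simp add: power_int_add)
  then show ?thesis using ord_atI[OF P pi] unit_at_mult[OF height_one_primesD(1)[OF P] u(1) v(1)] by blast
qed

lemma ord_at_unit: "unit_at P u \<Longrightarrow> ord_at P u = 0"
  using ord_atI[OF P, of _ u u 0] uniformizer_exists[OF P] by (metis power_int_0_right mult_1_right)

lemma ord_at_one: "ord_at P 1 = 0"
  by (rule ord_at_unit[OF unit_at_one[OF height_one_primesD(1)[OF P]]])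

lemma ord_at_inverse: "x \<noteq> 0 \<Longrightarrow> ord_at P (inverse x) = - ord_at P x"
  using ord_at_mult[of x "inverse x"] ord_at_one by simp

lemma ord_at_power: "x \<noteq> 0 \<Longrightarrow> ord_at P (x ^ n) = int n * ord_at P x"
  by (induction n) (auto simp: ord_at_one ord_at_mult algebra_simps)

lemma ord_at_nonneg_iff:
  assumes "x \<noteq> 0"
  shows "0 \<le> ord_at P x \<longleftrightarrow> x \<in> local_ring P"
proof -
  note PS = height_one_primesD(1)[OF P]
  obtain \<pi> :: "'a fract" where pi: "uniformizer P \<pi>" using uniformizer_exists[OF P] .
  have pi0: "\<pi> \<noteq> 0" using uniformizer_nonzero[OF P pi] .
  have pim: "\<pi> \<in> local_max_ideal P" by (rule uniformizer_mem[OF PS pi])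
  then have pir: "\<pi> \<in> local_ring P" using local_max_ideal_subset by blast
  obtain u where u: "unit_at P u" "x = u * \<pi> powi ord_at P x" using ord_at_decomposition[OF P pi assms] .
  show ?thesis
  proof
    assume "0 \<le> ord_at P x"
    then have "x = u * \<pi> ^ nat (ord_at P x)" using u(2) by (simp add: power_int_def)
    also have "\<dots> \<in> local_ring P"
      using u(1) pir by (intro local_ring_mult[OF PS] local_ring_power[OF PS]) (auto simp: unit_at_def)
    finally show "x \<in> local_ring P" .
  next
    assume x: "x \<in> local_ring P"
    show "0 \<le> ord_at P x"
    proof (rule ccontr)
      assume "\<not> ?thesis"
      then obtain l where l: "0 = ord_at P x + int (Suc l)" by (metis linorder_not_le zless_iff_Suc_zadd)
      have "x * \<pi> ^ Suc l = u * (\<pi> powi ord_at P x * \<pi> powi int (Suc l))"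
        by (subst u(2)) (simp only: power_int_of_nat mult.assoc)
      also have "\<dots> = u" using pi0 l by (simp flip: power_int_add)
      finally have "(x * \<pi> ^ l) * \<pi> = u" by (simp add: mult_ac)
      moreover have "(x * \<pi> ^ l) * \<pi> \<in> local_max_ideal P"
        using x pir pim by (intro local_max_ideal_mult[OF PS] local_ring_mult[OF PS] local_ring_power[OF PS])
      ultimately show False using unit_at_notin_max[OF PS u(1)] by simp
    qed
  qed
qed

lemma ord_at_to_fract_nonneg: "a \<noteq> 0 \<Longrightarrow> 0 \<le> ord_at P (to_fract a)"
  using ord_at_nonneg_iff[of "to_fract a"] to_fract_local_ring[OF height_one_primesD(1)[OF P]] by simp

lemma ord_at_to_fract_eq_0_iff: "a \<noteq> 0 \<Longrightarrow> ord_at P (to_fract a) = 0 \<longleftrightarrow> a \<notin> P"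
proof -
  note PS = height_one_primesD(1)[OF P]
  assume a: "a \<noteq> 0"
  have "ord_at P (to_fract a) = 0 \<longleftrightarrow> 0 \<le> ord_at P (inverse (to_fract a))"
    using a ord_at_to_fract_nonneg[OF a] by (simp add: ord_at_inverse)
  also have "\<dots> \<longleftrightarrow> unit_at P (to_fract a)"
    using a ord_at_nonneg_iff[of "inverse (to_fract a)"] to_fract_local_ring[OF PS] by (simp add: unit_at_def)
  also have "\<dots> \<longleftrightarrow> a \<notin> P"
    using unit_at_iff[OF PS] to_fract_local_ring[OF PS] to_fract_local_max_ideal_iff[OF PS] by simp
  finally show ?thesis .
qed

text \<open>Multiplying by the power -n of a uniformizer reduces the claim to closure of the local
  ring under addition.\<close>

lemma ord_at_add:
  assumes "x \<noteq> 0" "y \<noteq> 0" "x + y \<noteq> 0" "n \<le> ord_at P x" "n \<le> ord_at P y"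
  shows "n \<le> ord_at P (x + y)"
proof -
  note PS = height_one_primesD(1)[OF P]
  obtain \<pi> :: "'a fract" where pi: "uniformizer P \<pi>" using uniformizer_exists[OF P] .
  have pi0: "\<pi> \<noteq> 0" using uniformizer_nonzero[OF P pi] .
  let ?t = "\<pi> powi (- n)"
  have t: "?t \<noteq> 0" using pi0 by simp
  have ordt: "ord_at P ?t = - n" by (rule ord_atI[OF P pi unit_at_one[OF PS]]) simp
  have iff: "n \<le> ord_at P z \<longleftrightarrow> z * ?t \<in> local_ring P" if "z \<noteq> 0" for z
    using ord_at_nonneg_iff[of "z * ?t"] that t by (simp add: ord_at_mult ordt)
  have "(x + y) * ?t \<in> local_ring P"
    using assms iff local_ring_add[OF PS] by (simp add: distrib_right)
  then show ?thesis using iff assms(3) by simp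
qed

end

section \<open>Intersection of the local rings, finiteness of zeros and poles, avoidance\<close>

lemma hartogs:
  assumes "\<And>P. P \<in> height_one_primes \<Longrightarrow> x \<in> local_ring P"
  shows "x \<in> range (to_fract :: 'a \<Rightarrow> 'a fract)"
proof -
  obtain b a where x: "a \<noteq> 0" "x = Fract b a" by (cases x) auto
  have "a dvd b"
  proof (rule hartogs_dvd[OF x(1)])
    fix P :: "'a set" assume P: "P \<in> height_one_primes"
    obtain s c where s: "s \<notin> P" "x * to_fract s = to_fract c"
      using assms[OF P] local_ring_iff[OF height_one_primesD(1)[OF P]] by auto
    have "to_fract (s * b) = to_fract (a * c)"
      using x s(2)[symmetric] by (simp add: Fract_conv_to_fract)
    then show "\<exists>s. s \<notin> P \<and> a dvd s * b" using s(1) by (metis dvd_triv_left to_fract_eq_iff)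
  qed
  then obtain c where "b = a * c" by (auto elim: dvdE)
  then have "x = to_fract c" using x by (simp add: Fract_conv_to_fract)
  then show ?thesis by blast
qed

lemma finite_ord_at:
  assumes "(x :: 'a fract) \<noteq> 0"
  shows "finite {P \<in> height_one_primes. ord_at P x \<noteq> 0}"
proof -
  obtain a b where ab: "b \<noteq> 0" "x = Fract a b" by (cases x) auto
  then have a: "a \<noteq> 0" using assms by (auto simp: Fract_conv_to_fract)
  have "P \<in> {P \<in> height_one_primes. a \<in> P} \<union> {P \<in> height_one_primes. b \<in> P}"
    if P: "P \<in> height_one_primes" "ord_at P x \<noteq> 0" for P
  proof -
    have "ord_at P x = ord_at P (to_fract a) - ord_at P (to_fract b)"
      using ab a ord_at_mult[OF P(1), of "to_fract a" "inverse (to_fract b)"] ord_at_inverse[OF P(1), of "to_fract b"]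
      by (simp add: Fract_conv_to_fract divide_inverse)
    then show ?thesis 
      using P ord_at_to_fract_eq_0_iff[OF P(1) a] ord_at_to_fract_eq_0_iff[OF P(1) ab(1)] by auto
  qed
  then show ?thesis
    using finite_height_one_primes_containing[OF a] finite_height_one_primes_containing[OF ab(1)]
    by (auto intro: finite_subset[of _ "{P \<in> height_one_primes. a \<in> P} \<union> {P \<in> height_one_primes. b \<in> P}"])
qed

text \<open>Multiply powers of elements of each \<open>P\<close> outside \<open>Q\<close>; elements
  of A have no poles, so further factors spoil nothing. In the uses \<open>Q\<close> is a point off
  a support, a height one prime, or \<open>{0}\<close>.\<close>

lemma exists_avoiding:
  fixes Q :: "'a set"
  assumes "finite S" "S \<subseteq> height_one_primes" and Q: "Q \<in> Spec ring_of_type"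
    and "\<And>P. P \<in> S \<Longrightarrow> \<not> P \<subseteq> Q"
  shows "\<exists>a. a \<notin> Q \<and> (\<forall>P\<in>S. int (N P) \<le> ord_at P (to_fract a))"
  using assms(1,2,4)
proof (induction S rule: finite_induct)
  case empty
  show ?case using SpecD(2)[OF Q] by blast
next
  case (insert P S)
  obtain a where a: "a \<notin> Q" "\<forall>P\<in>S. int (N P) \<le> ord_at P (to_fract a)" using insert by auto
  obtain g where g: "g \<in> P" "g \<notin> Q" using insert.prems(2) by blast
  have nz: "a \<noteq> 0" "g \<noteq> 0" using a g SpecD(4)[OF Q] by auto
  have pow: "to_fract (a * g ^ n) = to_fract a * to_fract g ^ n" for n by (induction n) (auto simp: mult_ac)
  have ord: "ord_at P' (to_fract (a * g ^ N P)) = ord_at P' (to_fract a) + int (N P) * ord_at P' (to_fract g)"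
    if "P' \<in> height_one_primes" for P'
    unfolding pow using that nz by (simp add: ord_at_mult ord_at_power)
  have P: "P \<in> height_one_primes" using insert.prems by simp
  have "1 \<le> ord_at P (to_fract g)"
    using ord_at_to_fract_nonneg[OF P nz(2)] ord_at_to_fract_eq_0_iff[OF P nz(2)] g(1) by simp
  then have "int (N P) \<le> int (N P) * ord_at P (to_fract g)" by (simp add: mult_le_cancel_left1)
  then have "int (N P) \<le> ord_at P (to_fract (a * g ^ N P))"
    using ord[OF P] ord_at_to_fract_nonneg[OF P nz(1)] by simp
  moreover have "int (N P') \<le> ord_at P' (to_fract (a * g ^ N P))" if P': "P' \<in> S" for P'
  proof -
    have "P' \<in> height_one_primes" using P' insert.prems by auto
    then show ?thesis using ord a(2) P' ord_at_to_fract_nonneg[OF _ nz(2)]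
      by (simp add: add_increasing2)
  qed
  moreover have "a * g ^ N P \<notin> Q" using a g Spec_mult_notin[OF Q] Spec_power_notin[OF Q] by blast
  ultimately show ?case by (intro exI[of _ "a * g ^ N P"]) auto
qed

subsection \<open>Sections of divisors\<close>

lemma sections_zero: "0 \<in> divisor_sections D"
  by (simp add: divisor_sections_def)

lemma sections_iff:
  "x \<noteq> 0 \<Longrightarrow> x \<in> divisor_sections D \<longleftrightarrow> (\<forall>P\<in>height_one_primes. 0 \<le> ord_at P x + D P)"
  by (simp add: divisor_sections_def)

lemma sections_mult:
  assumes "(x :: 'a fract) \<in> divisor_sections D" "y \<in> divisor_sections E"
  shows "x * y \<in> divisor_sections (\<lambda>P. D P + E P)"
proof (cases "x = 0 \<or> y = 0")
  case False
  have "0 \<le> ord_at P (x * y) + (D P + E P)" if P: "P \<in> height_one_primes" for P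
  proof -
    have "0 \<le> ord_at P x + D P" "0 \<le> ord_at P y + E P" using assms False P by (simp_all add: sections_iff)
    then show ?thesis using ord_at_mult[OF P, of x y] False by simp
  qed
  then show ?thesis using False by (simp add: sections_iff)
qed (auto simp: sections_zero)

lemma sections_add:
  assumes "(x :: 'a fract) \<in> divisor_sections D" "y \<in> divisor_sections D"
  shows "x + y \<in> divisor_sections D"
proof (cases "x = 0 \<or> y = 0 \<or> x + y = 0")
  case False
  have "0 \<le> ord_at P (x + y) + D P" if P: "P \<in> height_one_primes" for P
  proof -
    have "0 \<le> ord_at P x + D P" "0 \<le> ord_at P y + D P" using assms False P by (simp_all add: sections_iff)
    then show ?thesis using ord_at_add[OF P, of x y "- D P"] False by simp
  qed
  then show ?thesis using False by (simp add: sections_iff)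
qed (use assms in \<open>auto simp: sections_zero\<close>)

lemma sections_mono: "(\<And>P. P \<in> height_one_primes \<Longrightarrow> D P \<le> E P) \<Longrightarrow> divisor_sections D \<subseteq> divisor_sections E"
  unfolding divisor_sections_def by (auto intro: order_trans add_left_mono)

lemma sections_cong: "(\<And>P. P \<in> height_one_primes \<Longrightarrow> D P = E P) \<Longrightarrow> divisor_sections D = divisor_sections E"
  unfolding divisor_sections_def by auto

lemma sections_zero_divisor: "divisor_sections (\<lambda>_. 0) = range (to_fract :: 'a \<Rightarrow> 'a fract)"
proof (intro equalityI subsetI)
  fix x :: "'a fract" assume x: "x \<in> divisor_sections (\<lambda>_. 0)"
  show "x \<in> range to_fract"
  proof (cases "x = 0")
    case True
    then show ?thesis by (metis rangeI to_fract_0)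
  next
    case False
    then show ?thesis using x ord_at_nonneg_iff by (intro hartogs) (auto simp: sections_iff)
  qed
next
  fix x :: "'a fract" assume "x \<in> range to_fract"
  then show "x \<in> divisor_sections (\<lambda>_. 0)"
    using ord_at_to_fract_nonneg by (auto simp: divisor_sections_def)
qed

lemma sections_scale:
  assumes "x \<in> divisor_sections D"
  shows "to_fract (a::'a) * x \<in> divisor_sections D"
proof -
  have "to_fract a \<in> divisor_sections (\<lambda>_. 0)" by (simp add: sections_zero_divisor)
  from sections_mult[OF this assms] show ?thesis by simp
qed

lemma sections_power:
  assumes "(x :: 'a fract) \<in> divisor_sections D"
  shows "x ^ n \<in> divisor_sections (\<lambda>P. int n * D P)"
proof (induction n)
  case 0
  show ?case using sections_zero_divisor by (auto simp: image_iff intro: exI[of _ 1])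
next
  case (Suc n)
  from sections_mult[OF assms this] show ?case by (simp add: distrib_right)
qed

text \<open>A power of a uniformizer at \<open>P0\<close> has the right order there but may fail
  elsewhere; an element of A outside \<open>P0\<close> repairs the finitely many bad primes. So the
  bound that defines A(-D) is attained at each prime.\<close>

lemma sections_negative_exact:
  assumes fin: "finite {P \<in> height_one_primes. D P \<noteq> 0}" and P0: "P0 \<in> height_one_primes"
  obtains c :: "'a fract" where "c \<noteq> 0" "c \<in> divisor_sections (\<lambda>P. - D P)" "ord_at P0 c = D P0"
proof -
  note PS = height_one_primesD(1)[OF P0]
  obtain \<pi> :: "'a fract" where pi: "uniformizer P0 \<pi>" using uniformizer_exists[OF P0] .
  define t where "t = \<pi> powi D P0"
  have t0: "t \<noteq> 0" using uniformizer_nonzero[OF P0 pi] by (simp add: t_def)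
  have ordt: "ord_at P0 t = D P0" by (rule ord_atI[OF P0 pi unit_at_one[OF PS]]) (simp add: t_def)
  \<comment> \<open>Away from \<open>S\<close> and \<open>P0\<close> both \<open>D\<close> and the
    order of \<open>t\<close> vanish, so only \<open>S\<close> has to be repaired.\<close>
  define S where "S = ({P \<in> height_one_primes. D P \<noteq> 0} \<union> {P \<in> height_one_primes. ord_at P t \<noteq> 0}) - {P0}"
  have "finite S" using fin finite_ord_at[OF t0] by (simp add: S_def)
  moreover have "S \<subseteq> height_one_primes" by (auto simp: S_def)
  moreover have "\<not> P \<subseteq> P0" if "P \<in> S" for P
    using that height_one_primesD(1,2)[of P] height_one_primesD(4)[OF P0, of P] by (auto simp: S_def)
  ultimately obtain a where a: "a \<notin> P0" "\<forall>P\<in>S. int (nat (D P - ord_at P t)) \<le> ord_at P (to_fract a)"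
    using exists_avoiding[OF _ _ PS, of S "\<lambda>P. nat (D P - ord_at P t)"] by blast
  have a0: "a \<noteq> 0" using a(1) SpecD(4)[OF PS] by blast
  have ord: "ord_at P (t * to_fract a) = ord_at P t + ord_at P (to_fract a)" if "P \<in> height_one_primes" for P
    using that t0 a0 by (simp add: ord_at_mult)
  have 1: "ord_at P0 (t * to_fract a) = D P0"
    using ord[OF P0] ordt ord_at_to_fract_eq_0_iff[OF P0 a0] a(1) by simp
  have "0 \<le> ord_at P (t * to_fract a) + - D P" if P: "P \<in> height_one_primes" for P
  proof (cases "P \<in> S")
    case True
    then have "int (nat (D P - ord_at P t)) \<le> ord_at P (to_fract a)" using a(2) by blast
    then show ?thesis using ord[OF P] by linarith
  next
    case False
    then have "P = P0 \<or> D P = 0 \<and> ord_at P t = 0" using P by (auto simp: S_def)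
    then show ?thesis using 1 ord[OF P] ord_at_to_fract_nonneg[OF P a0] by auto
  qed
  then have "t * to_fract a \<in> divisor_sections (\<lambda>P. - D P)" using t0 a0 by (simp add: sections_iff)
  then show thesis using that[of "t * to_fract a"] 1 t0 a0 by simp
qed

text \<open>If \<open>x\<close> violated the bound at \<open>P\<close>, its product with a section
  of -D of exact order \<open>D P\<close> would have a pole there. So A(D) is the dual of A(-D), the
  form in which flatness can be applied.\<close>

lemma sections_dual:
  assumes fin: "finite {P \<in> height_one_primes. D P \<noteq> 0}"
    and x: "\<And>c. c \<in> divisor_sections (\<lambda>P. - D P) \<Longrightarrow> x * c \<in> range to_fract"
  shows "(x :: 'a fract) \<in> divisor_sections D"
proof (cases "x = 0")
  case False
  have "0 \<le> ord_at P x + D P" if P: "P \<in> height_one_primes" for P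
  proof -
    obtain c where c: "c \<noteq> 0" "c \<in> divisor_sections (\<lambda>P. - D P)" "ord_at P c = D P"
      using sections_negative_exact[OF fin P] .
    obtain b where b: "x * c = to_fract b" using x[OF c(2)] by blast
    then have "b \<noteq> 0" using False c(1) by auto
    then show ?thesis using ord_at_to_fract_nonneg[OF P] b ord_at_mult[OF P False c(1)] c(3) by metis
  qed
  then show ?thesis using False by (simp add: sections_iff)
qed (simp add: sections_zero)

lemma sections_common_denominator:
  assumes fin: "finite {P \<in> height_one_primes. D P \<noteq> 0}"
  obtains d :: 'a where "d \<noteq> 0" "\<And>x. x \<in> divisor_sections D \<Longrightarrow> to_fract d * x \<in> range to_fract"
proof -
  have "\<not> P \<subseteq> {0}" if "P \<in> {P \<in> height_one_primes. D P \<noteq> 0}" for P :: "'a set"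
    using that height_one_primesD(3)[of P] by auto
  then obtain d :: 'a where d: "d \<noteq> 0"
    "\<forall>P\<in>{P \<in> height_one_primes. D P \<noteq> 0}. int (nat (D P)) \<le> ord_at P (to_fract d)"
    using exists_avoiding[OF fin _ zero_in_Spec, of "\<lambda>P. nat (D P)"] by auto
  have "D P \<le> ord_at P (to_fract d)" if P: "P \<in> height_one_primes" for P
  proof (cases "D P = 0")
    case True
    then show ?thesis using ord_at_to_fract_nonneg[OF P d(1)] by simp
  next
    case False
    then have "int (nat (D P)) \<le> ord_at P (to_fract d)" using d(2) P by blast
    then show ?thesis by linarith
  qed
  then have "to_fract d \<in> divisor_sections (\<lambda>P. - D P)" using d(1) by (simp add: sections_iff)
  then have "to_fract d * x \<in> range to_fract" if "x \<in> divisor_sections D" for x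
    using sections_mult[OF _ that] sections_zero_divisor by fastforce
  then show thesis using that d(1) by blast
qed

end

section \<open>Coaffine divisors\<close>

lemma prod_span_map:
  assumes "u \<in> prod_span M N" and "\<And>x. x \<in> M \<Longrightarrow> c * x \<in> M'" "\<And>y. y \<in> N \<Longrightarrow> d * y \<in> N'"
  shows "c * d * u \<in> prod_span M' N'"
  using assms(1)
proof induction
  case (step x y z)
  have "(c * x) * (d * y) + c * d * z \<in> prod_span M' N'"
    using step assms(2,3) by (intro prod_span.step)
  then show ?case by (simp add: algebra_simps)
qed (simp add: prod_span.zero)

text \<open>The degree m part of a homogeneous ideal in the direct sum of all A(nD):
  \<open>Suc m\<close> offsets the factor from A(-D), so this is a subset of A(mD).\<close>

definition twist_ideal :: "('a::idom set \<Rightarrow> int) \<Rightarrow> nat \<Rightarrow> 'a fract set" where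
  "twist_ideal D m =
     prod_span (divisor_sections (\<lambda>P. - D P)) (divisor_sections (\<lambda>P. int (Suc m) * D P))"

context noetherian_normal_domain
begin

text \<open>An expression of 1 as an element of the ideal generated in \<Gamma>(U) is a finite sum,
  so it involves sections of a single A(nE).\<close>

lemma affine_complement_iff:
  fixes E :: "'a set \<Rightarrow> int"
  assumes fin: "finite {P \<in> height_one_primes. E P \<noteq> 0}"
    and E: "\<And>P. P \<in> height_one_primes \<Longrightarrow> 0 \<le> E P"
  shows "affine_open ring_of_type {Q \<in> Spec ring_of_type. \<not> (\<exists>P\<in>height_one_primes. E P \<noteq> 0 \<and> P \<subseteq> Q)} \<longleftrightarrow>
    (\<exists>n. 1 \<in> prod_span (divisor_sections (\<lambda>P. - E P)) (divisor_sections (\<lambda>P. int n * E P)))"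
    (is "affine_open _ ?U \<longleftrightarrow> _")
proof -
  define I where "I = {a. to_fract a \<in> divisor_sections (\<lambda>P. - E P)}"
  have "divisor_sections (\<lambda>P. - E P) \<subseteq> range to_fract"
    unfolding sections_zero_divisor[symmetric] using E by (intro sections_mono) auto
  then have I: "to_fract ` I = divisor_sections (\<lambda>P. - E P)" by (auto simp: I_def)
  have avoid: "\<exists>a\<in>I. a \<notin> Q" if Q: "Q \<in> ?U" for Q
  proof -
    have QS: "Q \<in> Spec ring_of_type" using Q by blast
    obtain a where a: "a \<notin> Q" "\<forall>P\<in>{P \<in> height_one_primes. E P \<noteq> 0}. int (nat (E P)) \<le> ord_at P (to_fract a)"
      using exists_avoiding[OF fin _ QS, of "\<lambda>P. nat (E P)"] Q by blast
    have a0: "a \<noteq> 0" using a(1) SpecD(4)[OF QS] by blast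
    have "0 \<le> ord_at P (to_fract a) + - E P" if P: "P \<in> height_one_primes" for P
    proof (cases "E P = 0")
      case True
      then show ?thesis using ord_at_to_fract_nonneg[OF P a0] by simp
    next
      case False
      then have "int (nat (E P)) \<le> ord_at P (to_fract a)" using a(2) P by blast
      then show ?thesis by linarith
    qed
    then have "a \<in> I" using a0 by (simp add: I_def sections_iff)
    then show ?thesis using a(1) by blast
  qed
  have sub: "I \<subseteq> Q" if Q: "Q \<in> Spec ring_of_type" and P: "P \<in> height_one_primes" "E P \<noteq> 0" "P \<subseteq> Q" for P Q
  proof
    fix a assume a: "a \<in> I"
    show "a \<in> Q"
    proof (cases "a = 0")
      case False
      then have "0 \<le> ord_at P (to_fract a) + - E P" using a P(1) by (simp add: I_def sections_iff)
      then have "ord_at P (to_fract a) \<noteq> 0" using E[OF P(1)] P(2) by linarith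
      then show ?thesis using ord_at_to_fract_eq_0_iff[OF P(1) False] P(3) by blast
    qed (simp add: SpecD(4)[OF Q])
  qed
  have U: "?U = {Q \<in> Spec ring_of_type. \<not> I \<subseteq> Q}"
  proof (intro equalityI subsetI)
    fix Q assume "Q \<in> ?U"
    then show "Q \<in> {Q \<in> Spec ring_of_type. \<not> I \<subseteq> Q}" using avoid[of Q] by auto
  next
    fix Q assume "Q \<in> {Q \<in> Spec ring_of_type. \<not> I \<subseteq> Q}"
    then show "Q \<in> ?U" using sub[of Q] by auto
  qed
  have U0: "{0} \<in> ?U" using zero_in_Spec height_one_primesD(3) by auto
  define \<Gamma> where "\<Gamma> = (\<Inter>Q\<in>?U. local_ring Q)"
  have \<Gamma>_iff: "x \<in> \<Gamma> \<longleftrightarrow> (\<exists>n. x \<in> divisor_sections (\<lambda>P. int n * E P))" for x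
  proof
    assume x: "x \<in> \<Gamma>"
    show "\<exists>n. x \<in> divisor_sections (\<lambda>P. int n * E P)"
    proof (cases "x = 0")
      case False
      let ?S = "{P \<in> height_one_primes. E P \<noteq> 0}"
      \<comment> \<open>This bounds the poles of \<open>x\<close> on the support, where
        \<open>E\<close> is at least 1.\<close>
      define n where "n = nat (\<Sum>P\<in>?S. \<bar>ord_at P x\<bar>)"
      have "0 \<le> ord_at P x + int n * E P" if P: "P \<in> height_one_primes" for P
      proof (cases "E P = 0")
        case True
        \<comment> \<open>A height one prime off the support is itself a point of \<open>U\<close>,
          as it contains no other height one prime.\<close>
        have "P \<in> ?U"
        proof -
          have "P' = P" if "P' \<in> height_one_primes" "P' \<subseteq> P" for P'
            using height_one_primesD(4)[OF P] height_one_primesD(1,2)[OF that(1)] that(2) by blast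
          then show ?thesis using True height_one_primesD(1)[OF P] by blast
        qed
        then have "x \<in> local_ring P" using x by (auto simp: \<Gamma>_def)
        then show ?thesis using ord_at_nonneg_iff[OF P False] True by simp
      next
        case nz: False
        have "\<bar>ord_at P x\<bar> \<le> int n"
          unfolding n_def using member_le_sum[of P ?S "\<lambda>P. \<bar>ord_at P x\<bar>"] fin P nz by simp
        moreover have "int n * 1 \<le> int n * E P" using E[OF P] nz by (intro mult_left_mono) auto
        ultimately show ?thesis by linarith
      qed
      then show ?thesis using False by (auto simp: sections_iff)
    qed (use sections_zero in blast)
  next
    assume "\<exists>n. x \<in> divisor_sections (\<lambda>P. int n * E P)"
    then obtain n where x: "x \<in> divisor_sections (\<lambda>P. int n * E P)" by blast
    have "x \<in> local_ring Q" if Q: "Q \<in> ?U" for Q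
    proof -
      have QS: "Q \<in> Spec ring_of_type" using Q by blast
      obtain a where a: "a \<in> I" "a \<notin> Q" using avoid[OF Q] by blast
      have "to_fract a ^ n * x \<in> divisor_sections (\<lambda>P. int n * - E P + int n * E P)"
        using a(1) x by (intro sections_mult sections_power) (simp_all add: I_def)
      then have "to_fract a ^ n * x \<in> range to_fract" by (simp add: sections_zero_divisor)
      moreover have "to_fract a ^ n = to_fract (a ^ n)" by (induction n) auto
      ultimately show ?thesis using local_ring_iff[OF QS, of x] Spec_power_notin[OF QS a(2), of n]
        by (auto simp: mult.commute)
    qed
    then show "x \<in> \<Gamma>" by (simp add: \<Gamma>_def)
  qed
  have mono: "divisor_sections (\<lambda>P. int n * E P) \<subseteq> divisor_sections (\<lambda>P. int m * E P)" if "n \<le> m" for n m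
    using that E by (intro sections_mono mult_right_mono) auto
  have span: "u \<in> prod_span (to_fract ` I) \<Gamma> \<longleftrightarrow>
      (\<exists>n. u \<in> prod_span (to_fract ` I) (divisor_sections (\<lambda>P. int n * E P)))" for u
  proof
    assume "u \<in> prod_span (to_fract ` I) \<Gamma>"
    then show "\<exists>n. u \<in> prod_span (to_fract ` I) (divisor_sections (\<lambda>P. int n * E P))"
    proof induction
      case zero
      show ?case using prod_span.zero by blast
    next
      case (step x y z)
      obtain n where n: "y \<in> divisor_sections (\<lambda>P. int n * E P)" using step \<Gamma>_iff by blast
      obtain m where m: "z \<in> prod_span (to_fract ` I) (divisor_sections (\<lambda>P. int m * E P))" using step by blast
      have "y \<in> divisor_sections (\<lambda>P. int (max n m) * E P)" using n mono[of n "max n m"] by auto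
      moreover have "z \<in> prod_span (to_fract ` I) (divisor_sections (\<lambda>P. int (max n m) * E P))"
        using m prod_span_mono[OF order_refl mono[of m "max n m"]] by auto
      ultimately show ?case using prod_span.step[OF step(1)] by blast
    qed
  next
    assume "\<exists>n. u \<in> prod_span (to_fract ` I) (divisor_sections (\<lambda>P. int n * E P))"
    then obtain n where "u \<in> prod_span (to_fract ` I) (divisor_sections (\<lambda>P. int n * E P))" by blast
    moreover have "divisor_sections (\<lambda>P. int n * E P) \<subseteq> \<Gamma>" using \<Gamma>_iff by blast
    ultimately show "u \<in> prod_span (to_fract ` I) \<Gamma>" using prod_span_mono[OF order_refl] by blast
  qed
  have "affine_open ring_of_type ?U \<longleftrightarrow> 1 \<in> prod_span (to_fract ` I) \<Gamma>"
  proof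
    assume "affine_open ring_of_type ?U"
    then show "1 \<in> prod_span (to_fract ` I) \<Gamma>"
      unfolding \<Gamma>_def using U0 avoid by (rule affine_open_imp_unit)
  next
    assume unit: "1 \<in> prod_span (to_fract ` I) \<Gamma>"
    have denom: "\<exists>n. to_fract a ^ n * x \<in> range to_fract" if a: "a \<in> I" and x: "x \<in> \<Gamma>" for a x
    proof -
      obtain n where n: "x \<in> divisor_sections (\<lambda>P. int n * E P)" using x \<Gamma>_iff by blast
      have "to_fract a ^ n * x \<in> divisor_sections (\<lambda>P. int n * - E P + int n * E P)"
        using a n by (intro sections_mult sections_power) (simp_all add: I_def)
      then show ?thesis by (auto simp: sections_zero_divisor)
    qed
    show "affine_open ring_of_type ?U"
      unfolding U
    proof (rule unit_imp_affine_open)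
      show "{0} \<in> {P \<in> Spec ring_of_type. \<not> I \<subseteq> P}" using U0 unfolding U .
      show "\<exists>n. to_fract a ^ n * x \<in> range to_fract"
        if "a \<in> I" "x \<in> (\<Inter>P\<in>{P \<in> Spec ring_of_type. \<not> I \<subseteq> P}. local_ring P)" for a x
        using denom[OF that(1)] that(2) unfolding \<Gamma>_def U by blast
      show "1 \<in> prod_span (to_fract ` I) (\<Inter>P\<in>{P \<in> Spec ring_of_type. \<not> I \<subseteq> P}. local_ring P)"
        using unit unfolding \<Gamma>_def U .
    qed
  qed
  also have "\<dots> \<longleftrightarrow> (\<exists>n. 1 \<in> prod_span (divisor_sections (\<lambda>P. - E P)) (divisor_sections (\<lambda>P. int n * E P)))"
    using span[of 1] unfolding I .
  finally show ?thesis .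
qed

lemma sections_shift:
  fixes x :: "'a fract"
  assumes x: "x \<noteq> 0" and E: "\<And>P. P \<in> height_one_primes \<Longrightarrow> E P = D P + ord_at P x"
  shows "h \<in> divisor_sections (\<lambda>P. - E P) \<longleftrightarrow> inverse x * h \<in> divisor_sections (\<lambda>P. - D P)"
    and "h \<in> divisor_sections (\<lambda>P. int n * E P) \<longleftrightarrow> x ^ n * h \<in> divisor_sections (\<lambda>P. int n * D P)"
  using x E
  by (cases "h = 0";
      simp add: sections_zero sections_iff ord_at_mult ord_at_inverse ord_at_power algebra_simps)+

lemma unit_twist_iff:
  fixes x :: "'a fract"
  assumes x: "x \<noteq> 0" and E: "\<And>P. P \<in> height_one_primes \<Longrightarrow> E P = D P + ord_at P x"
    and E0: "\<And>P. P \<in> height_one_primes \<Longrightarrow> 0 \<le> E P"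
  shows "(\<exists>n. 1 \<in> prod_span (divisor_sections (\<lambda>P. - E P)) (divisor_sections (\<lambda>P. int n * E P))) \<longleftrightarrow>
    (\<exists>m. x ^ m \<in> twist_ideal D m)"
proof
  assume "\<exists>n. 1 \<in> prod_span (divisor_sections (\<lambda>P. - E P)) (divisor_sections (\<lambda>P. int n * E P))"
  then obtain n where n: "1 \<in> prod_span (divisor_sections (\<lambda>P. - E P)) (divisor_sections (\<lambda>P. int n * E P))" by blast
  \<comment> \<open>\<open>twist_ideal\<close> has \<open>Suc m\<close> in its second factor; since
    \<open>E\<close> is effective, n may be raised by one.\<close>
  have "divisor_sections (\<lambda>P. int n * E P) \<subseteq> divisor_sections (\<lambda>P. int (Suc n) * E P)"
    using E0 by (intro sections_mono mult_right_mono) auto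
  then have "1 \<in> prod_span (divisor_sections (\<lambda>P. - E P)) (divisor_sections (\<lambda>P. int (Suc n) * E P))"
    using n prod_span_mono[OF order_refl] by blast
  \<comment> \<open>Scaling the two factors by \<open>inverse x\<close> and \<open>x ^ Suc n\<close>
    passes from \<open>E\<close> to \<open>D\<close>; the net effect on 1 is
    \<open>x ^ n\<close>.\<close>
  then have "inverse x * x ^ Suc n * 1 \<in> prod_span (divisor_sections (\<lambda>P. - D P)) (divisor_sections (\<lambda>P. int (Suc n) * D P))"
    by (rule prod_span_map) (simp_all only: sections_shift[OF x E])
  moreover have "inverse x * x ^ Suc n * 1 = x ^ n" using x by simp
  ultimately have "x ^ n \<in> twist_ideal D n" by (simp only: twist_ideal_def)
  then show "\<exists>m. x ^ m \<in> twist_ideal D m" by blast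
next
  assume "\<exists>m. x ^ m \<in> twist_ideal D m"
  then obtain m where m: "x ^ m \<in> twist_ideal D m" by blast
  have "x * inverse (x ^ Suc m) * x ^ m \<in>
      prod_span (divisor_sections (\<lambda>P. - E P)) (divisor_sections (\<lambda>P. int (Suc m) * E P))"
    using m unfolding twist_ideal_def
  proof (rule prod_span_map)
    show "x * h \<in> divisor_sections (\<lambda>P. - E P)" if "h \<in> divisor_sections (\<lambda>P. - D P)" for h
      using that x sections_shift(1)[OF x E, of "x * h"] by (simp add: mult.assoc[symmetric])
    show "inverse (x ^ Suc m) * h \<in> divisor_sections (\<lambda>P. int (Suc m) * E P)"
      if "h \<in> divisor_sections (\<lambda>P. int (Suc m) * D P)" for h
      using that x sections_shift(2)[OF x E, of "inverse (x ^ Suc m) * h" "Suc m"]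
      by (simp add: mult.assoc[symmetric] del: power_Suc)
  qed
  moreover have "x * inverse (x ^ Suc m) * x ^ m = 1" using x by (simp add: field_simps)
  ultimately have "1 \<in> prod_span (divisor_sections (\<lambda>P. - E P)) (divisor_sections (\<lambda>P. int (Suc m) * E P))"
    by (simp only:)
  then show "\<exists>n. 1 \<in> prod_span (divisor_sections (\<lambda>P. - E P)) (divisor_sections (\<lambda>P. int n * E P))" by blast
qed

lemma weil_divisor_finite:
  "finite {P \<in> height_one_primes. Poly_Mapping.lookup D P \<noteq> 0}"
  by (rule finite_subset[OF _ finite_keys[of D]]) (auto simp: in_keys_iff)

theorem coaffine_iff:
  fixes D :: "'a set \<Rightarrow>\<^sub>0 int"
  assumes D: "D \<in> weil_divisors"
  shows "coaffine D \<longleftrightarrow>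
    (\<forall>q\<in>divisor_sections (Poly_Mapping.lookup D). q \<noteq> 0 \<longrightarrow> (\<exists>m. q ^ m \<in> twist_ideal (Poly_Mapping.lookup D) m))"
proof -
  let ?D = "Poly_Mapping.lookup D"
  have keys: "Poly_Mapping.keys E \<subseteq> height_one_primes" if "E \<in> weil_divisors" for E :: "'a set \<Rightarrow>\<^sub>0 int"
    using that by (simp add: weil_divisors_def)
  have main: "affine_open ring_of_type (Spec ring_of_type - divisor_support E) \<longleftrightarrow>
      (\<exists>m. x ^ m \<in> twist_ideal ?D m)"
    if E: "E \<in> weil_divisors" "effective E" and x: "x \<noteq> 0"
      "\<forall>P\<in>height_one_primes. Poly_Mapping.lookup (E - D) P = ord_at P x" for E x
  proof -
    let ?E = "Poly_Mapping.lookup E"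
    have "Spec ring_of_type - divisor_support E =
        {Q \<in> Spec ring_of_type. \<not> (\<exists>P\<in>height_one_primes. ?E P \<noteq> 0 \<and> P \<subseteq> Q)}"
      using keys[OF E(1)] by (auto simp: divisor_support_def in_keys_iff)
    moreover have ED: "?E P = ?D P + ord_at P x" if "P \<in> height_one_primes" for P
    proof -
      have "?E P - ?D P = ord_at P x" using x(2) that by (simp add: lookup_minus)
      then show ?thesis by simp
    qed
    moreover have E0: "0 \<le> ?E P" for P using E(2) by (simp add: effective_def)
    ultimately show ?thesis
      using affine_complement_iff[OF weil_divisor_finite E0] unit_twist_iff[OF x(1) ED E0] by simp
  qed
  show ?thesis
  proof
    assume co: "coaffine D"
    show "\<forall>q\<in>divisor_sections ?D. q \<noteq> 0 \<longrightarrow> (\<exists>m. q ^ m \<in> twist_ideal ?D m)"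
    proof (intro ballI impI)
      fix q assume q: "q \<in> divisor_sections ?D" "q \<noteq> 0"
      \<comment> \<open>The divisor div q + D, cut off outside the height one primes, where
        \<open>ord_at\<close> carries no meaning.\<close>
      let ?g = "\<lambda>P. if P \<in> height_one_primes then ?D P + ord_at P q else 0"
      have "finite {P. ?g P \<noteq> 0}"
        by (rule finite_subset[OF _ finite_UnI[OF weil_divisor_finite[of D] finite_ord_at[OF q(2)]]]) auto
      then have "Poly_Mapping.lookup (Abs_poly_mapping ?g) = ?g" by (rule lookup_Abs_poly_mapping)
      then obtain E where E: "Poly_Mapping.lookup E = ?g" by blast
      have "E \<in> weil_divisors"
        using E by (auto simp: weil_divisors_def in_keys_iff split: if_splits)
      moreover have "effective E" using q by (simp add: effective_def E sections_iff add.commute)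
      moreover have "\<forall>P\<in>height_one_primes. Poly_Mapping.lookup (E - D) P = ord_at P q"
        by (simp add: lookup_minus E)
      moreover from this q(2) have "linearly_equivalent E D" unfolding linearly_equivalent_def by blast
      ultimately show "\<exists>m. q ^ m \<in> twist_ideal ?D m"
        using main[of E q] q(2) co by (simp add: coaffine_def)
    qed
  next
    assume R: "\<forall>q\<in>divisor_sections ?D. q \<noteq> 0 \<longrightarrow> (\<exists>m. q ^ m \<in> twist_ideal ?D m)"
    have "affine_open ring_of_type (Spec ring_of_type - divisor_support E)"
      if E: "E \<in> weil_divisors" "effective E" "linearly_equivalent E D" for E
    proof -
      obtain x where x: "x \<noteq> 0" "\<forall>P\<in>height_one_primes. Poly_Mapping.lookup (E - D) P = ord_at P x"
        using E(3) by (auto simp: linearly_equivalent_def)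
      have "0 \<le> ord_at P x + ?D P" if "P \<in> height_one_primes" for P
      proof -
        have "ord_at P x + ?D P = Poly_Mapping.lookup E P" using x(2) that by (simp add: lookup_minus flip: x(2))
        then show ?thesis using E(2) by (simp add: effective_def)
      qed
      then have "x \<in> divisor_sections ?D" using x(1) by (simp add: sections_iff)
      then show ?thesis using main[OF E(1,2) x] R x(1) by blast
    qed
    then show "coaffine D" using D by (simp add: coaffine_def)
  qed
qed

subsection \<open>Radicals of twist ideals\<close>

lemma twist_ideal_zero: "0 \<in> twist_ideal D m"
  by (simp add: twist_ideal_def prod_span.zero)

lemma twist_ideal_add: "u \<in> twist_ideal D m \<Longrightarrow> v \<in> twist_ideal D m \<Longrightarrow> u + v \<in> twist_ideal D m"
  by (simp add: twist_ideal_def prod_span_add)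

lemma twist_ideal_mult:
  fixes y :: "'a fract"
  assumes u: "u \<in> twist_ideal D m" and y: "y \<in> divisor_sections (\<lambda>P. int k * D P)"
  shows "y * u \<in> twist_ideal D (m + k)"
  using u unfolding twist_ideal_def
proof (rule prod_span_scale)
  fix h assume "h \<in> divisor_sections (\<lambda>P. int (Suc m) * D P)"
  from sections_mult[OF y this] show "y * h \<in> divisor_sections (\<lambda>P. int (Suc (m + k)) * D P)"
    by (simp add: algebra_simps)
qed

lemma twist_ideal_scale:
  assumes u: "u \<in> twist_ideal D m"
  shows "to_fract (a::'a) * u \<in> twist_ideal D m"
  using twist_ideal_mult[OF u, of "to_fract a" 0] by (simp add: sections_zero_divisor)

text \<open>In each term of the binomial expansion the exponent of \<open>u\<close> is at least m or
  that of \<open>v\<close> is at least k.\<close>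

lemma twist_ideal_power_add:
  fixes u v :: "'a fract"
  assumes u: "u \<in> divisor_sections D" "u ^ m \<in> twist_ideal D m"
    and v: "v \<in> divisor_sections D" "v ^ k \<in> twist_ideal D k"
  shows "(u + v) ^ (m + k) \<in> twist_ideal D (m + k)"
proof -
  \<comment> \<open>Only \<open>a ^ l\<close> has to lie in the twist ideal; the surplus factors
    form a section of a multiple of \<open>D\<close> and raise the degree.\<close>
  have split: "b ^ j * a ^ i \<in> twist_ideal D (i + j)"
    if ab: "a \<in> divisor_sections D" "b \<in> divisor_sections D" and a: "a ^ l \<in> twist_ideal D l" "l \<le> i"
    for a b :: "'a fract" and i j l
  proof -
    have "a ^ (i - l) * b ^ j \<in> divisor_sections (\<lambda>P. int (i - l) * D P + int j * D P)"
      using ab by (intro sections_mult sections_power)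
    then have "a ^ (i - l) * b ^ j \<in> divisor_sections (\<lambda>P. int (i - l + j) * D P)"
      by (simp add: distrib_right)
    from twist_ideal_mult[OF a(1) this] have "a ^ (i - l) * b ^ j * a ^ l \<in> twist_ideal D (l + (i - l + j))" .
    moreover have "a ^ (i - l) * b ^ j * a ^ l = b ^ j * a ^ i"
      using a(2) by (simp add: mult.assoc mult.commute[of "b ^ j"] flip: power_add)
    ultimately show ?thesis using a(2) by simp
  qed
  have "u ^ i * v ^ (m + k - i) \<in> twist_ideal D (m + k)" if i: "i \<le> m + k" for i
  proof (cases "m \<le> i")
    case True
    from split[OF u(1) v(1) u(2) True, of "m + k - i"] show ?thesis using i by (simp add: mult.commute)
  next
    case False
    then have "k \<le> m + k - i" by simp
    from split[OF v(1) u(1) v(2) this, of i] show ?thesis using i by simp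
  qed
  then have "to_fract (of_nat ((m + k) choose i)) * (u ^ i * v ^ (m + k - i)) \<in> twist_ideal D (m + k)"
    if "i \<le> m + k" for i using that by (intro twist_ideal_scale)
  moreover have "to_fract (of_nat n) = of_nat n" for n by (induction n) auto
  ultimately have summand: "of_nat ((m + k) choose i) * u ^ i * v ^ (m + k - i) \<in> twist_ideal D (m + k)"
    if "i \<le> m + k" for i using that by (metis mult.assoc)
  have "(\<Sum>i\<in>S. of_nat ((m + k) choose i) * u ^ i * v ^ (m + k - i)) \<in> twist_ideal D (m + k)"
    if "finite S" "S \<subseteq> {..m + k}" for S
    using that by (induction S rule: finite_induct) (auto intro: twist_ideal_zero twist_ideal_add summand)
  then show ?thesis by (simp add: binomial_ring)
qed

end

section \<open>Flatness\<close>

lemma coset_free_Abelian_group: "T #>\<^bsub>free_Abelian_group S\<^esub> x = {t + x | t. t \<in> T}"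
  by (auto simp: r_coset_def)

lemma keys_diff_subset: "Poly_Mapping.keys x \<subseteq> S \<Longrightarrow> Poly_Mapping.keys y \<subseteq> S \<Longrightarrow> Poly_Mapping.keys (x - y) \<subseteq> S"
  using keys_diff[of x y] by blast

locale tensor_product = M: module R M + L: module R L
  for R :: "('r, 'k) ring_scheme" and M :: "('r, 'm) module" and L :: "('r, 'l) module"
begin

abbreviation "\<T> \<equiv> tensor_relations R M L"

lemma relators_carrier: "tensor_relators R M L \<subseteq> carrier (free_Abelian_group (carrier M \<times> carrier L))"
  unfolding tensor_relators_def
  by (auto simp: keys_frag_of dest!: subsetD[OF keys_diff])

lemma subgroup_relations: "subgroup \<T> (free_Abelian_group (carrier M \<times> carrier L))"
  unfolding tensor_relations_def by (rule group.generate_is_subgroup[OF _ relators_carrier]) simp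

lemma relations_zero: "0 \<in> \<T>"
  using subgroup.one_closed[OF subgroup_relations] by simp

lemma relations_add: "u \<in> \<T> \<Longrightarrow> v \<in> \<T> \<Longrightarrow> u + v \<in> \<T>"
  using subgroup.m_closed[OF subgroup_relations] by simp

lemma relations_minus: "u \<in> \<T> \<Longrightarrow> - u \<in> \<T>"
  using subgroup.m_inv_closed[OF subgroup_relations] subgroup.mem_carrier[OF subgroup_relations] by fastforce

lemma relations_diff: "u \<in> \<T> \<Longrightarrow> v \<in> \<T> \<Longrightarrow> u - v \<in> \<T>"
  using relations_add[OF _ relations_minus] by fastforce

lemma relations_swap: "u - v \<in> \<T> \<Longrightarrow> v - u \<in> \<T>"
  using relations_minus[of "u - v"] by simp

lemma relations_diff_iff: "u - v \<in> \<T> \<Longrightarrow> u \<in> \<T> \<longleftrightarrow> v \<in> \<T>"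
  using relations_add[of "u - v" v] relations_diff[of u "u - v"] by auto

lemma relator_add_left:
  "x \<in> carrier M \<Longrightarrow> y \<in> carrier M \<Longrightarrow> l \<in> carrier L \<Longrightarrow>
     frag_of (x \<oplus>\<^bsub>M\<^esub> y, l) - frag_of (x, l) - frag_of (y, l) \<in> \<T>"
  unfolding tensor_relations_def by (rule generate.incl) (auto simp: tensor_relators_def)

lemma relator_add_right:
  "x \<in> carrier M \<Longrightarrow> k \<in> carrier L \<Longrightarrow> l \<in> carrier L \<Longrightarrow>
     frag_of (x, k \<oplus>\<^bsub>L\<^esub> l) - frag_of (x, k) - frag_of (x, l) \<in> \<T>"
  unfolding tensor_relations_def by (rule generate.incl) (auto simp: tensor_relators_def)

lemma relator_smult:
  "r \<in> carrier R \<Longrightarrow> x \<in> carrier M \<Longrightarrow> l \<in> carrier L \<Longrightarrow>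
     frag_of (r \<odot>\<^bsub>M\<^esub> x, l) - frag_of (x, r \<odot>\<^bsub>L\<^esub> l) \<in> \<T>"
  unfolding tensor_relations_def by (rule generate.incl) (auto simp: tensor_relators_def)

lemma tensor_zero_left: "l \<in> carrier L \<Longrightarrow> frag_of (\<zero>\<^bsub>M\<^esub>, l) \<in> \<T>"
  using relations_minus[OF relator_add_left[of "\<zero>\<^bsub>M\<^esub>" "\<zero>\<^bsub>M\<^esub>" l]] by simp

lemma tensor_zero_right: "x \<in> carrier M \<Longrightarrow> frag_of (x, \<zero>\<^bsub>L\<^esub>) \<in> \<T>"
  using relations_minus[OF relator_add_right[of x "\<zero>\<^bsub>L\<^esub>" "\<zero>\<^bsub>L\<^esub>"]] by simp

text \<open>\<open>S\<close> is arbitrary because a coset depends only on the addition of formal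
  sums, which is the same for all generating sets.\<close>

lemma coset_eq_iff: "\<T> #>\<^bsub>free_Abelian_group S\<^esub> u = \<T> #>\<^bsub>free_Abelian_group S\<^esub> v \<longleftrightarrow> u - v \<in> \<T>"
proof
  assume "\<T> #>\<^bsub>free_Abelian_group S\<^esub> u = \<T> #>\<^bsub>free_Abelian_group S\<^esub> v"
  moreover have "u \<in> \<T> #>\<^bsub>free_Abelian_group S\<^esub> u"
    using relations_zero by (force simp: coset_free_Abelian_group)
  ultimately obtain t where "t \<in> \<T>" "u = t + v" by (auto simp: coset_free_Abelian_group)
  then show "u - v \<in> \<T>" by simp
next
  assume uv: "u - v \<in> \<T>"
  have "t + u \<in> {t + v | t. t \<in> \<T>}" if "t \<in> \<T>" for t
    using relations_add[OF that uv] by (intro CollectI exI[of _ "t + (u - v)"]) simp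
  moreover have "t + v \<in> {t + u | t. t \<in> \<T>}" if "t \<in> \<T>" for t
    using relations_diff[OF that uv] by (intro CollectI exI[of _ "t - (u - v)"]) simp
  ultimately show "\<T> #>\<^bsub>free_Abelian_group S\<^esub> u = \<T> #>\<^bsub>free_Abelian_group S\<^esub> v"
    unfolding coset_free_Abelian_group by blast
qed

lemma carrier_tensor:
  "carrier (tensor R M L) = {\<T> #>\<^bsub>free_Abelian_group (carrier M \<times> carrier L)\<^esub> c | c.
     Poly_Mapping.keys c \<subseteq> carrier M \<times> carrier L}"
  by (auto simp: tensor_def FactGroup_def RCOSETS_def)

lemma one_tensor: "\<one>\<^bsub>tensor R M L\<^esub> = \<T>"
  by (simp add: tensor_def FactGroup_def)

end

abbreviation frag_map :: "('m \<Rightarrow> 'n) \<Rightarrow> ('m \<times> 'l \<Rightarrow>\<^sub>0 int) \<Rightarrow> ('n \<times> 'l \<Rightarrow>\<^sub>0 int)" where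
  "frag_map g \<equiv> frag_extend (\<lambda>(x, l). frag_of (g x, l))"

lemma frag_map_diff: "frag_map g (u - v) = frag_map g u - frag_map g v"
  using frag_extend_add[of _ u "- v"] by (simp add: frag_extend_minus)

lemma frag_map_id: "frag_map id d = d"
proof -
  have "(\<lambda>(x, l). frag_of (id x, l)) = frag_of" by auto
  then have "frag_map id d = frag_extend frag_of d" by (rule arg_cong)
  also have "\<dots> = d" by (rule frag_expansion[symmetric])
  finally show ?thesis .
qed

text \<open>Linearity of \<open>g\<close> sends each relator to one of the same shape, so
  \<open>g\<close> tensored with the identity is well defined.\<close>

lemma frag_map_relations:
  assumes "tensor_product R M L" "tensor_product R N L" "linear_map R M N g"
    and "u \<in> tensor_relations R M L"
  shows "frag_map g u \<in> tensor_relations R N L"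
proof -
  interpret TM: tensor_product R M L by fact
  interpret TN: tensor_product R N L by fact
  have g: "\<And>x. x \<in> carrier M \<Longrightarrow> g x \<in> carrier N"
    "\<And>x y. x \<in> carrier M \<Longrightarrow> y \<in> carrier M \<Longrightarrow> g (x \<oplus>\<^bsub>M\<^esub> y) = g x \<oplus>\<^bsub>N\<^esub> g y"
    "\<And>r x. r \<in> carrier R \<Longrightarrow> x \<in> carrier M \<Longrightarrow> g (r \<odot>\<^bsub>M\<^esub> x) = r \<odot>\<^bsub>N\<^esub> g x"
    using assms(3) by (auto simp: linear_map_def)
  have rel: "frag_map g h \<in> tensor_relations R N L" if "h \<in> tensor_relators R M L" for h
    using that unfolding tensor_relators_def
    by (auto simp: frag_map_diff g TN.relator_add_left TN.relator_add_right TN.relator_smult)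
  show ?thesis
    using assms(4) unfolding tensor_relations_def[of R M L]
  proof (induction rule: generate.induct)
    case one
    then show ?case by (simp add: TN.relations_zero)
  next
    case (incl h)
    then show ?case by (rule rel)
  next
    case (inv h)
    have "Poly_Mapping.keys h \<subseteq> carrier M \<times> carrier L" using subsetD[OF TM.relators_carrier inv] by simp
    then show ?case using TN.relations_minus[OF rel[OF inv]] by (simp add: frag_extend_minus)
  next
    case (eng u v)
    then show ?case by (simp add: frag_extend_add TN.relations_add)
  qed
qed

lemma tensor_map_coset:
  assumes M: "tensor_product R M L" and N: "tensor_product R N L" and g: "linear_map R M N g"
  shows "tensor_map R N L g (tensor_relations R M L #>\<^bsub>free_Abelian_group S\<^esub> c) =
    tensor_relations R N L #>\<^bsub>free_Abelian_group (carrier N \<times> carrier L)\<^esub> frag_map g c"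
proof -
  interpret TM: tensor_product R M L by fact
  interpret TN: tensor_product R N L by fact
  have "tensor_relations R N L #>\<^bsub>free_Abelian_group (carrier N \<times> carrier L)\<^esub> frag_map g c' =
      tensor_relations R N L #>\<^bsub>free_Abelian_group (carrier N \<times> carrier L)\<^esub> frag_map g c"
    if c': "c' \<in> tensor_relations R M L #>\<^bsub>free_Abelian_group S\<^esub> c" for c'
  proof -
    obtain t where t: "t \<in> tensor_relations R M L" "c' = t + c"
      using c' by (auto simp: coset_free_Abelian_group)
    then show ?thesis using frag_map_relations[OF M N g t(1)]
      by (simp add: TN.coset_eq_iff frag_extend_add)
  qed
  moreover have "c \<in> tensor_relations R M L #>\<^bsub>free_Abelian_group S\<^esub> c"
    using TM.relations_zero by (force simp: coset_free_Abelian_group)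
  ultimately show ?thesis unfolding tensor_map_def by blast
qed

text \<open>Restating exactness through formal sums modulo relations lets the flatness arguments
  below avoid cosets.\<close>

lemma exact_tensored_iff:
  assumes M: "tensor_product R M L" and N: "tensor_product R N L" and P: "tensor_product R P L"
    and g: "linear_map R M N g" and h: "linear_map R N P h"
  shows "exact_tensored R L M N P g h \<longleftrightarrow>
    (\<forall>c. Poly_Mapping.keys c \<subseteq> carrier N \<times> carrier L \<longrightarrow>
      (\<exists>d. Poly_Mapping.keys d \<subseteq> carrier M \<times> carrier L \<and> frag_map g d - c \<in> tensor_relations R N L) \<longleftrightarrow>
      frag_map h c \<in> tensor_relations R P L)"
proof -
  interpret TM: tensor_product R M L by fact
  interpret TN: tensor_product R N L by fact
  interpret TP: tensor_product R P L by fact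
  let ?cN = "\<lambda>c. tensor_relations R N L #>\<^bsub>free_Abelian_group (carrier N \<times> carrier L)\<^esub> c"
  have keys_map: "Poly_Mapping.keys (frag_map g d) \<subseteq> carrier N \<times> carrier L"
    if "Poly_Mapping.keys d \<subseteq> carrier M \<times> carrier L" for d
  proof (rule free_Abelian_group_induct[OF that])
    show "Poly_Mapping.keys (frag_map g (frag_of a)) \<subseteq> carrier N \<times> carrier L"
      if "a \<in> carrier M \<times> carrier L" for a using that g by (auto simp: linear_map_def)
  qed (simp_all add: frag_map_diff keys_diff_subset)
  have image: "tensor_map R N L g ` carrier (tensor R M L) =
      {?cN (frag_map g d) | d. Poly_Mapping.keys d \<subseteq> carrier M \<times> carrier L}"
    unfolding TM.carrier_tensor using tensor_map_coset[OF M N g] by (auto simp: image_iff)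
  have kernel: "{y \<in> carrier (tensor R N L). tensor_map R P L h y = \<one>\<^bsub>tensor R P L\<^esub>} =
      {?cN c | c. Poly_Mapping.keys c \<subseteq> carrier N \<times> carrier L \<and> frag_map h c \<in> tensor_relations R P L}"
  proof -
    have "tensor_map R P L h (?cN c) = \<one>\<^bsub>tensor R P L\<^esub> \<longleftrightarrow> frag_map h c \<in> tensor_relations R P L" for c
    proof -
      have "tensor_relations R P L = tensor_relations R P L #>\<^bsub>free_Abelian_group (carrier P \<times> carrier L)\<^esub> 0"
        by (simp add: coset_free_Abelian_group)
      then show ?thesis unfolding tensor_map_coset[OF N P h] TP.one_tensor
        using TP.coset_eq_iff[of "carrier P \<times> carrier L" "frag_map h c" 0] by simp
    qed
    then show ?thesis unfolding TN.carrier_tensor by auto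
  qed
  have hrel: "frag_map h c \<in> tensor_relations R P L \<longleftrightarrow> frag_map h c' \<in> tensor_relations R P L"
    if "c - c' \<in> tensor_relations R N L" for c c'
    using frag_map_relations[OF N P h that] TP.relations_diff_iff by (simp add: frag_map_diff)
  show ?thesis
    unfolding exact_tensored_def image kernel
  proof
    assume eq: "{?cN (frag_map g d) | d. Poly_Mapping.keys d \<subseteq> carrier M \<times> carrier L} =
      {?cN c | c. Poly_Mapping.keys c \<subseteq> carrier N \<times> carrier L \<and> frag_map h c \<in> tensor_relations R P L}"
    show "\<forall>c. Poly_Mapping.keys c \<subseteq> carrier N \<times> carrier L \<longrightarrow>
      (\<exists>d. Poly_Mapping.keys d \<subseteq> carrier M \<times> carrier L \<and> frag_map g d - c \<in> tensor_relations R N L) \<longleftrightarrow>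
      frag_map h c \<in> tensor_relations R P L"
    proof (intro allI impI)
      fix c :: "_ \<Rightarrow>\<^sub>0 int" assume c: "Poly_Mapping.keys c \<subseteq> carrier N \<times> carrier L"
      have "(\<exists>d. Poly_Mapping.keys d \<subseteq> carrier M \<times> carrier L \<and> frag_map g d - c \<in> tensor_relations R N L) \<longleftrightarrow>
        ?cN c \<in> {?cN (frag_map g d) | d. Poly_Mapping.keys d \<subseteq> carrier M \<times> carrier L}"
        by (auto simp: TN.coset_eq_iff intro: TN.relations_swap)
      also have "\<dots> \<longleftrightarrow> (\<exists>c'. Poly_Mapping.keys c' \<subseteq> carrier N \<times> carrier L \<and>
          c - c' \<in> tensor_relations R N L \<and> frag_map h c' \<in> tensor_relations R P L)"
        unfolding eq using TN.coset_eq_iff by auto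
      also have "\<dots> \<longleftrightarrow> frag_map h c \<in> tensor_relations R P L"
        using hrel c TN.relations_zero by (metis diff_self)
      finally show "(\<exists>d. Poly_Mapping.keys d \<subseteq> carrier M \<times> carrier L \<and> frag_map g d - c \<in> tensor_relations R N L) \<longleftrightarrow>
        frag_map h c \<in> tensor_relations R P L" .
    qed
  next
    assume R: "\<forall>c. Poly_Mapping.keys c \<subseteq> carrier N \<times> carrier L \<longrightarrow>
      (\<exists>d. Poly_Mapping.keys d \<subseteq> carrier M \<times> carrier L \<and> frag_map g d - c \<in> tensor_relations R N L) \<longleftrightarrow>
      frag_map h c \<in> tensor_relations R P L"
    show "{?cN (frag_map g d) | d. Poly_Mapping.keys d \<subseteq> carrier M \<times> carrier L} =
      {?cN c | c. Poly_Mapping.keys c \<subseteq> carrier N \<times> carrier L \<and> frag_map h c \<in> tensor_relations R P L}"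
    proof (intro equalityI subsetI)
      fix X assume "X \<in> {?cN (frag_map g d) | d. Poly_Mapping.keys d \<subseteq> carrier M \<times> carrier L}"
      then obtain d where d: "X = ?cN (frag_map g d)" "Poly_Mapping.keys d \<subseteq> carrier M \<times> carrier L" by blast
      have "frag_map g d - frag_map g d \<in> tensor_relations R N L" by (simp add: TN.relations_zero)
      then have "frag_map h (frag_map g d) \<in> tensor_relations R P L"
        using R keys_map[OF d(2)] d(2) by blast
      then show "X \<in> {?cN c | c. Poly_Mapping.keys c \<subseteq> carrier N \<times> carrier L \<and> frag_map h c \<in> tensor_relations R P L}"
        using d keys_map[OF d(2)] by blast
    next
      fix X assume "X \<in> {?cN c | c. Poly_Mapping.keys c \<subseteq> carrier N \<times> carrier L \<and> frag_map h c \<in> tensor_relations R P L}"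
      then obtain c where c: "X = ?cN c" "Poly_Mapping.keys c \<subseteq> carrier N \<times> carrier L"
        "frag_map h c \<in> tensor_relations R P L" by blast
      then obtain d where d: "Poly_Mapping.keys d \<subseteq> carrier M \<times> carrier L" "frag_map g d - c \<in> tensor_relations R N L"
        using R by blast
      then have "X = ?cN (frag_map g d)" using c(1) TN.coset_eq_iff by metis
      then show "X \<in> {?cN (frag_map g d) | d. Poly_Mapping.keys d \<subseteq> carrier M \<times> carrier L}" using d by blast
    qed
  qed
qed

subsection \<open>Test modules\<close>

text \<open>The module \<open>C/S\<close> with classes named by \<open>\<kappa>\<close>, where \<open>\<kappa> x = \<kappa> y \<longleftrightarrow> x - y \<in> S\<close>.\<close>

definition quotient_module :: "'x::ab_group_add set \<Rightarrow> ('x \<Rightarrow> 'k) \<Rightarrow> ('a \<Rightarrow> 'x \<Rightarrow> 'x) \<Rightarrow> ('a, 'k) module" where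
  "quotient_module C \<kappa> sc = \<lparr>carrier = \<kappa> ` C, monoid.mult = (\<lambda>X Y. X), monoid.one = \<kappa> 0, ring.zero = \<kappa> 0,
     ring.add = (\<lambda>X Y. \<kappa> (inv_into C \<kappa> X + inv_into C \<kappa> Y)),
     module.smult = (\<lambda>r X. \<kappa> (sc r (inv_into C \<kappa> X)))\<rparr>"

text \<open>\<open>S = {0}\<close> gives the module \<open>C\<close> itself and
  \<open>C = UNIV\<close> a quotient. The axiom \<open>kappa\<close> makes the operations
  independent of the representatives chosen by \<open>inv_into\<close>.\<close>

locale class_module =
  fixes C :: "'x::ab_group_add set" and \<kappa> :: "'x \<Rightarrow> 'k" and sc :: "'a::comm_ring_1 \<Rightarrow> 'x \<Rightarrow> 'x" and S :: "'x set"
  assumes zero_C: "0 \<in> C" and add_C: "x \<in> C \<Longrightarrow> y \<in> C \<Longrightarrow> x + y \<in> C" and sc_C: "x \<in> C \<Longrightarrow> sc r x \<in> C"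
    and kappa: "\<kappa> x = \<kappa> y \<longleftrightarrow> x - y \<in> S"
    and add_S: "x \<in> S \<Longrightarrow> y \<in> S \<Longrightarrow> x + y \<in> S" and sc_S: "x \<in> S \<Longrightarrow> sc r x \<in> S"
    and sc_right: "sc r (x + y) = sc r x + sc r y" and sc_left: "sc (r + s) x = sc r x + sc s x"
    and sc_assoc: "sc (r * s) x = sc r (sc s x)" and sc_one: "sc 1 x = x"
begin

abbreviation "\<M> \<equiv> quotient_module C \<kappa> sc"

lemma carrier_class: "carrier \<M> = \<kappa> ` C"
  by (simp add: quotient_module_def)

lemma zero_class: "\<zero>\<^bsub>\<M>\<^esub> = \<kappa> 0"
  by (simp add: quotient_module_def)

lemma rep: "x \<in> C \<Longrightarrow> inv_into C \<kappa> (\<kappa> x) - x \<in> S"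
  using f_inv_into_f[of "\<kappa> x" \<kappa> C] by (simp flip: kappa)

lemma add_class: "x \<in> C \<Longrightarrow> y \<in> C \<Longrightarrow> \<kappa> x \<oplus>\<^bsub>\<M>\<^esub> \<kappa> y = \<kappa> (x + y)"
proof -
  assume "x \<in> C" "y \<in> C"
  then have "(inv_into C \<kappa> (\<kappa> x) - x) + (inv_into C \<kappa> (\<kappa> y) - y) \<in> S" by (intro add_S rep)
  then show ?thesis by (simp add: quotient_module_def kappa algebra_simps)
qed

lemma sc_diff: "sc r (x - y) = sc r x - sc r y"
  using sc_right[of r "x - y" y] by simp

lemma smult_class: "x \<in> C \<Longrightarrow> r \<odot>\<^bsub>\<M>\<^esub> \<kappa> x = \<kappa> (sc r x)"
  using sc_S[OF rep[of x], of r] by (simp add: quotient_module_def kappa sc_diff)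

lemma sc_uminus: "sc (- 1) x + x = 0"
proof -
  have "sc 0 x = 0" using sc_left[of 0 0 x] by simp
  then show ?thesis using sc_left[of "- 1" 1 x] by (simp add: sc_one)
qed

lemma module_class: "module ring_of_type \<M>"
proof (rule moduleI)
  show "abelian_group \<M>"
  proof (rule abelian_groupI)
    fix X assume "X \<in> carrier \<M>"
    then obtain x where x: "X = \<kappa> x" "x \<in> C" by (auto simp: carrier_class)
    show "\<exists>Y\<in>carrier \<M>. Y \<oplus>\<^bsub>\<M>\<^esub> X = \<zero>\<^bsub>\<M>\<^esub>"
      using x sc_C by (intro bexI[of _ "\<kappa> (sc (- 1) x)"]) (auto simp: add_class zero_class carrier_class sc_uminus)
  qed (auto simp: carrier_class add_class zero_class zero_C add_C add_ac)
qed (auto simp: cring_ring_of_type carrier_class add_class smult_class sc_C add_C sc_left sc_right sc_assoc sc_one)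

end

lemma module_along_module:
  assumes "f \<in> ring_hom ring_of_type ring_of_type"
  shows "module ring_of_type (module_along f)"
proof -
  have f: "f (a + b) = f a + f b" "f (a * b) = f a * f b" "f 1 = 1" for a b
    using assms by (auto simp: ring_hom_def)
  show ?thesis
    by (intro moduleI abelian_groupI cring_ring_of_type)
      (auto simp: module_along_def f algebra_simps intro: exI[of _ "- x" for x])
qed

section \<open>Evaluation of formal sums\<close>

definition frag_eval :: "('k \<Rightarrow> 'b::comm_ring_1) \<Rightarrow> ('k \<Rightarrow>\<^sub>0 int) \<Rightarrow> 'b" where
  "frag_eval \<phi> u = (\<Sum>k\<in>Poly_Mapping.keys u. of_int (Poly_Mapping.lookup u k) * \<phi> k)"

lemma frag_eval_superset:
  "finite S \<Longrightarrow> Poly_Mapping.keys u \<subseteq> S \<Longrightarrow>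
     frag_eval \<phi> u = (\<Sum>k\<in>S. of_int (Poly_Mapping.lookup u k) * \<phi> k)"
  unfolding frag_eval_def by (rule sum.mono_neutral_left) (auto simp: in_keys_iff)

lemma frag_eval_add: "frag_eval \<phi> (u + v) = frag_eval \<phi> u + frag_eval \<phi> v"
proof -
  let ?S = "Poly_Mapping.keys u \<union> Poly_Mapping.keys v"
  have S: "finite ?S" "Poly_Mapping.keys (u + v) \<subseteq> ?S" using keys_add[of u v] by auto
  show ?thesis
    using frag_eval_superset[OF S, of \<phi>] frag_eval_superset[OF S(1), of u \<phi>] frag_eval_superset[OF S(1), of v \<phi>]
    by (simp add: lookup_add distrib_right sum.distrib)
qed

lemma frag_eval_minus: "frag_eval \<phi> (- u) = - frag_eval \<phi> u"
  using frag_eval_add[of \<phi> u "- u"] by (simp add: frag_eval_def eq_neg_iff_add_eq_0 add.commute)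

lemma frag_eval_diff: "frag_eval \<phi> (u - v) = frag_eval \<phi> u - frag_eval \<phi> v"
  using frag_eval_add[of \<phi> u "- v"] by (simp add: frag_eval_minus)

lemma frag_eval_of: "frag_eval \<phi> (frag_of k) = \<phi> k"
  by (simp add: frag_eval_def)

lemma frag_eval_sum: "frag_eval \<phi> (\<Sum>i\<in>I. u i) = (\<Sum>i\<in>I. frag_eval \<phi> (u i))"
  by (induction I rule: infinite_finite_induct) (simp_all add: frag_eval_add, simp_all add: frag_eval_def)

text \<open>The universal property of the tensor product: a balanced biadditive map kills every
  relator and so factors through it.\<close>

lemma (in tensor_product) frag_eval_relations:
  assumes "\<And>x y l. x \<in> carrier M \<Longrightarrow> y \<in> carrier M \<Longrightarrow> l \<in> carrier L \<Longrightarrow> \<phi> (x \<oplus>\<^bsub>M\<^esub> y, l) = \<phi> (x, l) + \<phi> (y, l)"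
    and "\<And>x k l. x \<in> carrier M \<Longrightarrow> k \<in> carrier L \<Longrightarrow> l \<in> carrier L \<Longrightarrow> \<phi> (x, k \<oplus>\<^bsub>L\<^esub> l) = \<phi> (x, k) + \<phi> (x, l)"
    and "\<And>r x l. r \<in> carrier R \<Longrightarrow> x \<in> carrier M \<Longrightarrow> l \<in> carrier L \<Longrightarrow> \<phi> (r \<odot>\<^bsub>M\<^esub> x, l) = \<phi> (x, r \<odot>\<^bsub>L\<^esub> l)"
    and "u \<in> \<T>"
  shows "frag_eval \<phi> u = 0"
proof -
  have rel: "frag_eval \<phi> h = 0" if "h \<in> tensor_relators R M L" for h
    using that assms(1-3) by (auto simp: tensor_relators_def frag_eval_diff frag_eval_of)
  show ?thesis
    using assms(4) unfolding tensor_relations_def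
  proof (induction rule: generate.induct)
    case (inv h)
    have "Poly_Mapping.keys h \<subseteq> carrier M \<times> carrier L" using subsetD[OF relators_carrier inv] by simp
    then show ?case using rel[OF inv] by (simp add: frag_eval_minus)
  qed (simp_all add: rel frag_eval_add, simp add: frag_eval_def)
qed

lemma module_along_simps:
  "carrier (module_along f) = UNIV" "r \<odot>\<^bsub>module_along f\<^esub> l = f r * l"
  "k \<oplus>\<^bsub>module_along f\<^esub> l = k + l" "\<zero>\<^bsub>module_along f\<^esub> = 0"
  by (simp_all add: module_along_def)

section \<open>Flatness and colon ideals, faithful flatness and contraction of ideals\<close>

context
  fixes f :: "'a::comm_ring_1 \<Rightarrow> 'b::comm_ring_1"
  assumes f: "f \<in> ring_hom ring_of_type ring_of_type"
begin

lemma ring_hom_type: "f (a + b) = f a + f b" "f (a * b) = f a * f b" "f 1 = 1" "f 0 = 0" "f (- a) = - f a"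
proof -
  show add: "f (a + b) = f a + f b" and "f (a * b) = f a * f b" and "f 1 = 1" for a b
    using f by (auto simp: ring_hom_def)
  show "f 0 = 0" using add[of 0 0] by simp
  then show "f (- a) = - f a" using add[of a "- a"] by (simp add: eq_neg_iff_add_eq_0 add.commute)
qed

text \<open>Equational flatness for the system \<open>b\<^sub>i x = a z\<^sub>i\<close>: its module of solutions over \<open>B\<close> is spanned
  by the solutions over \<open>A\<close>. Polynomials serve as the free module \<open>A\<^sup>n\<close>.\<close>

lemma flat_colon:
  assumes flat: "flat_module ring_of_type (module_along f)" and "finite B"
    and y: "\<And>b. b \<in> B \<Longrightarrow> f a dvd y * f b"
  shows "y \<in> prod_span (f ` {c. \<forall>b\<in>B. a dvd c * b}) UNIV"
proof -
  let ?R = "ring_of_type :: 'a ring" and ?L = "module_along f"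
  obtain n and bs :: "nat \<Rightarrow> 'a" where B: "B = bs ` {..<n}"
    using finite_imp_nat_seg_image_inj_on[OF \<open>finite B\<close>] by (auto simp: lessThan_def)
  have "\<exists>z. y * f (bs i) = f a * z" if "i < n" for i using y[of "bs i"] that B by (auto elim: dvdE)
  then obtain z where z: "\<And>i. i < n \<Longrightarrow> y * f (bs i) = f a * z i" by metis
  \<comment> \<open>Singletons fit the free module into the type of the test modules.\<close>
  define \<kappa> :: "'a poly \<Rightarrow> (nat \<Rightarrow> 'a) set" where "\<kappa> p = {coeff p}" for p
  have \<kappa>_eq: "\<kappa> p = \<kappa> q \<longleftrightarrow> p = q" for p q by (simp add: \<kappa>_def coeff_inject)
  \<comment> \<open>The solutions over A: coefficient 0 holds the unknown x, and coefficient
    \<open>Suc i\<close> the unknown \<open>z\<^sub>i\<close>.\<close>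
  define C where "C = {p. \<forall>i<n. bs i * coeff p 0 = a * coeff p (Suc i)}"
  interpret N: class_module UNIV \<kappa> smult "{0}"
    by unfold_locales (auto simp: \<kappa>_eq smult_add_right smult_add_left)
  interpret M: class_module C \<kappa> smult "{0}"
    by unfold_locales (auto simp: \<kappa>_eq C_def smult_add_right smult_add_left algebra_simps)
  \<comment> \<open>Coefficient i records the defect of equation i, so \<open>C\<close> is the
    kernel.\<close>
  define hp where "hp p = (\<Sum>i<n. monom (bs i * coeff p 0 - a * coeff p (Suc i)) i)" for p
  define h where "h X = \<kappa> (hp (inv_into UNIV \<kappa> X))" for X
  have inj: "inj \<kappa>" by (simp add: inj_def \<kappa>_eq)
  have h: "h (\<kappa> p) = \<kappa> (hp p)" for p by (simp add: h_def inj)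
  have hp_add: "hp (p + q) = hp p + hp q" for p q
    by (simp add: hp_def algebra_simps add_monom sum.distrib[symmetric])
  have coeff_hp: "coeff (hp p) i = (if i < n then bs i * coeff p 0 - a * coeff p (Suc i) else 0)" for p i
    by (simp add: hp_def coeff_sum)
  have hp_smult: "hp (smult r p) = smult r (hp p)" for r p
    by (simp add: poly_eq_iff coeff_hp algebra_simps)
  have hp_0: "hp p = 0 \<longleftrightarrow> p \<in> C" for p
    by (auto simp: poly_eq_iff coeff_hp C_def)
  have id: "linear_map ?R M.\<M> N.\<M> id"
    by (auto simp: linear_map_def M.carrier_class N.carrier_class M.add_class N.add_class M.smult_class N.smult_class)
  have lin: "linear_map ?R N.\<M> N.\<M> h"
    by (auto simp: linear_map_def N.carrier_class N.add_class N.smult_class h hp_add hp_smult)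
  have exact: "exact_modules M.\<M> N.\<M> N.\<M> id h"
    unfolding exact_modules_def
  proof (intro equalityI subsetI)
    fix Y assume "Y \<in> id ` carrier M.\<M>"
    then obtain p where "p \<in> C" "Y = \<kappa> p" by (auto simp: M.carrier_class)
    then show "Y \<in> {Y \<in> carrier N.\<M>. h Y = \<zero>\<^bsub>N.\<M>\<^esub>}"
      by (simp add: N.carrier_class N.zero_class h \<kappa>_eq hp_0)
  next
    fix Y assume "Y \<in> {Y \<in> carrier N.\<M>. h Y = \<zero>\<^bsub>N.\<M>\<^esub>}"
    then obtain p where "hp p = 0" "Y = \<kappa> p" by (auto simp: N.carrier_class N.zero_class h \<kappa>_eq)
    then show "Y \<in> id ` carrier M.\<M>" using hp_0[of p] by (simp add: M.carrier_class)
  qed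
  have L: "module ?R ?L" by (rule module_along_module[OF f])
  have TM: "tensor_product ?R M.\<M> ?L" and TN: "tensor_product ?R N.\<M> ?L"
    using L M.module_class N.module_class by (simp_all add: tensor_product_def)
  interpret TN: tensor_product ?R N.\<M> ?L by (rule TN)
  have "exact_tensored ?R ?L M.\<M> N.\<M> N.\<M> id h"
    using flat M.module_class N.module_class id lin exact unfolding flat_module_def by blast
  note exact' = this[unfolded exact_tensored_iff[OF TM TN TN id lin]]
  define e where "e i = (monom 1 i :: 'a poly)" for i
  \<comment> \<open>The given solution over B, as an element of the free module tensored with
    B.\<close>
  define c where "c = frag_of (\<kappa> (e 0), y) + (\<Sum>i<n. frag_of (\<kappa> (e (Suc i)), z i))"
  have "carrier N.\<M> \<times> carrier ?L = range \<kappa> \<times> UNIV" by (simp add: N.carrier_class module_along_simps)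
  then have keys_c: "Poly_Mapping.keys c \<subseteq> carrier N.\<M> \<times> carrier ?L"
  proof -
    have "frag_of (\<kappa> p, l) \<in> carrier (free_Abelian_group (range \<kappa> \<times> (UNIV :: 'b set)))" for p l by simp
    then have "c \<in> carrier (free_Abelian_group (range \<kappa> \<times> (UNIV :: 'b set)))"
      unfolding c_def using monoid.m_closed[OF group.is_monoid[OF group_free_Abelian_group], of _ "range \<kappa> \<times> (UNIV :: 'b set)"]
        sum_closed_free_Abelian_group[of "{..<n}" "\<lambda>i. frag_of (\<kappa> (e (Suc i)), z i)" "range \<kappa> \<times> (UNIV :: 'b set)"]
      by (metis (no_types, lifting) mult_free_Abelian_group)
    then show ?thesis by (simp add: N.carrier_class module_along_simps)
  qed
  have add_l: "frag_of (\<kappa> (p + q), l) - frag_of (\<kappa> p, l) - frag_of (\<kappa> q, l) \<in> TN.\<T>" for p q l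
    using TN.relator_add_left[of "\<kappa> p" "\<kappa> q" l] by (simp add: N.carrier_class N.add_class module_along_simps)
  have add_r: "frag_of (\<kappa> p, k + l) - frag_of (\<kappa> p, k) - frag_of (\<kappa> p, l) \<in> TN.\<T>" for p k l
    using TN.relator_add_right[of "\<kappa> p" k l] by (simp add: N.carrier_class module_along_simps)
  have sm: "frag_of (\<kappa> (smult r p), l) - frag_of (\<kappa> p, f r * l) \<in> TN.\<T>" for r p l
    using TN.relator_smult[of r "\<kappa> p" l] by (simp add: N.carrier_class N.smult_class module_along_simps)
  have sum_l: "frag_of (\<kappa> (\<Sum>i<k. p i), l) - (\<Sum>i<k. frag_of (\<kappa> (p i), l)) \<in> TN.\<T>" for p :: "nat \<Rightarrow> 'a poly" and k l
  proof (induction k)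
    case 0
    show ?case using TN.tensor_zero_left[of l] by (simp add: N.zero_class module_along_simps)
  next
    case (Suc k)
    from TN.relations_add[OF Suc add_l[of "\<Sum>i<k. p i" "p k" l]] show ?case by (simp add: algebra_simps)
  qed
  \<comment> \<open>Moving the scalars to the right factor leaves
    \<open>f (bs i) * y - f a * z i\<close>, which is 0.\<close>
  have pair: "frag_of (\<kappa> (monom (bs i) i), y) + frag_of (\<kappa> (monom (- a) i), z i) \<in> TN.\<T>" if i: "i < n" for i
  proof -
    have mon: "monom r i = smult r (e i)" for r by (simp add: e_def smult_monom)
    have "f (bs i) * y + f (- a) * z i = 0" using z[OF i] by (simp add: ring_hom_type mult.commute)
    then have "frag_of (\<kappa> (e i), f (bs i) * y + f (- a) * z i) \<in> TN.\<T>"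
      using TN.tensor_zero_right[of "\<kappa> (e i)"] by (simp add: N.carrier_class module_along_simps)
    from TN.relations_add[OF TN.relations_diff[OF this add_r[of "e i" "f (bs i) * y" "f (- a) * z i"]]
        TN.relations_add[OF sm[of "bs i" "e i" y] sm[of "- a" "e i" "z i"]]]
    show ?thesis unfolding mon by (simp add: algebra_simps)
  qed
  have "frag_map h c \<in> TN.\<T>"
  proof -
    have e0: "hp (e 0) = (\<Sum>i<n. monom (bs i) i)" by (simp add: hp_def e_def)
    have eS: "hp (e (Suc i)) = monom (- a) i" if "i < n" for i
      using that by (auto simp: poly_eq_iff coeff_hp e_def)
    have "frag_map h c = frag_of (\<kappa> (hp (e 0)), y) + (\<Sum>i<n. frag_of (\<kappa> (hp (e (Suc i))), z i))"
      unfolding c_def by (simp add: frag_extend_add frag_extend_sum h)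
    also have "\<dots> = (frag_of (\<kappa> (\<Sum>i<n. monom (bs i) i), y) - (\<Sum>i<n. frag_of (\<kappa> (monom (bs i) i), y))) +
        (\<Sum>i<n. frag_of (\<kappa> (monom (bs i) i), y) + frag_of (\<kappa> (monom (- a) i), z i))"
      by (simp add: e0 eS sum.distrib)
    also have "\<dots> \<in> TN.\<T>"
    proof (rule TN.relations_add[OF sum_l])
      have "(\<Sum>i\<in>S. frag_of (\<kappa> (monom (bs i) i), y) + frag_of (\<kappa> (monom (- a) i), z i)) \<in> TN.\<T>"
        if "finite S" "S \<subseteq> {..<n}" for S
        using that by (induction S rule: finite_induct) (auto intro!: TN.relations_add TN.relations_zero pair)
      then show "(\<Sum>i<n. frag_of (\<kappa> (monom (bs i) i), y) + frag_of (\<kappa> (monom (- a) i), z i)) \<in> TN.\<T>" by simp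
    qed
    finally show ?thesis .
  qed
  then obtain d where d: "Poly_Mapping.keys d \<subseteq> carrier M.\<M> \<times> carrier ?L" "frag_map id d - c \<in> TN.\<T>"
    using exact' keys_c by blast
  then have d': "d - c \<in> TN.\<T>" by (simp only: frag_map_id)
  \<comment> \<open>Reading off coefficient 0 is well defined on the tensor product. It recovers
    \<open>y\<close> from \<open>c\<close>, while \<open>d\<close>, built from solutions over A,
    lands in the span of the colon ideal.\<close>
  define \<phi> where "\<phi> = (\<lambda>(X, l). f (coeff (inv_into UNIV \<kappa> X) 0) * l)"
  have \<phi>: "\<phi> (\<kappa> p, l) = f (coeff p 0) * l" for p l by (simp add: \<phi>_def inj)
  have "frag_eval \<phi> (d - c) = 0"
    by (rule TN.frag_eval_relations[OF _ _ _ d'])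
      (auto simp: N.carrier_class N.add_class N.smult_class module_along_simps \<phi> ring_hom_type algebra_simps)
  then have "frag_eval \<phi> d = frag_eval \<phi> c" by (simp add: frag_eval_diff)
  also have "frag_eval \<phi> c = y"
    by (simp add: c_def frag_eval_add frag_eval_sum frag_eval_of \<phi> e_def ring_hom_type)
  finally have yd: "y = frag_eval \<phi> d" ..
  let ?K = "f ` {c. \<forall>b\<in>B. a dvd c * b}"
  have "frag_eval \<phi> d \<in> prod_span ?K UNIV"
  proof (rule free_Abelian_group_induct[OF d(1)])
    show "frag_eval \<phi> 0 \<in> prod_span ?K UNIV" by (simp add: frag_eval_def prod_span.zero)
    show "frag_eval \<phi> (u - v) \<in> prod_span ?K UNIV"
      if "frag_eval \<phi> u \<in> prod_span ?K UNIV" "frag_eval \<phi> v \<in> prod_span ?K UNIV" for u v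
      using prod_span_add[OF that(1) prod_span_scale[OF that(2), of "- 1" UNIV]] by (simp add: frag_eval_diff)
    fix k assume "k \<in> carrier M.\<M> \<times> carrier ?L"
    then obtain p l where p: "k = (\<kappa> p, l)" "p \<in> C" by (auto simp: M.carrier_class)
    have "a dvd coeff p 0 * b" if b: "b \<in> B" for b
    proof -
      obtain i where i: "i < n" "b = bs i" using b B by auto
      then have "coeff p 0 * b = a * coeff p (Suc i)" using p(2) by (simp add: C_def mult.commute)
      then show ?thesis by simp
    qed
    then show "frag_eval \<phi> (frag_of k) \<in> prod_span ?K UNIV"
      unfolding frag_eval_of p(1) \<phi> by (intro prod_span_mult) auto
  qed
  then show ?thesis using yd by simp
qed

text \<open>\<open>A \<rightarrow> A \<rightarrow> A/J\<close>, the identity followed by multiplication by \<open>x\<close>, is exact iff \<open>x \<in> J\<close>.\<close>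

lemma faithfully_flat_contract:
  assumes ff: "faithfully_flat_module ring_of_type (module_along f)" and J: "ideal J ring_of_type"
    and x: "f x \<in> prod_span (f ` J) UNIV"
  shows "x \<in> J"
proof -
  let ?R = "ring_of_type :: 'a ring" and ?L = "module_along f"
  note JD = ideal_ring_of_typeD[OF J]
  \<comment> \<open>The residue class of \<open>x\<close> modulo \<open>J\<close>, encoded by
    constant functions; \<open>{0}\<close> in place of \<open>J\<close> gives A itself.\<close>
  define \<kappa> where "\<kappa> J x = {\<lambda>_::nat. y | y. y - x \<in> J}" for J and x :: 'a
  have \<kappa>: "\<kappa> J u = \<kappa> J v \<longleftrightarrow> u - v \<in> J" if J: "ideal J ?R" for J u v
  proof
    assume "\<kappa> J u = \<kappa> J v"
    moreover have "(\<lambda>_. u) \<in> \<kappa> J u" using ideal_ring_of_typeD(1)[OF J] by (auto simp: \<kappa>_def)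
    ultimately show "u - v \<in> J" by (auto simp: \<kappa>_def dest: fun_cong)
  next
    assume uv: "u - v \<in> J"
    then have vu: "v - u \<in> J" using ideal_ring_of_typeD(3)[OF J uv, of "- 1"] by simp
    have "y - u \<in> J \<longleftrightarrow> y - v \<in> J" for y
      using ideal_ring_of_typeD(2)[OF J, of "y - u" "u - v"] ideal_ring_of_typeD(2)[OF J, of "y - v" "v - u"] uv vu
      by auto
    then show "\<kappa> J u = \<kappa> J v" by (simp add: \<kappa>_def)
  qed
  have zero: "ideal {0::'a} ?R" by (rule ideal_ring_of_typeI) auto
  interpret N: class_module UNIV "\<kappa> {0}" "(*)" "{0::'a}"
    by unfold_locales (auto simp: \<kappa>[OF zero] algebra_simps)
  interpret P: class_module UNIV "\<kappa> J" "(*)" J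
    by unfold_locales (use JD in \<open>auto simp: \<kappa>[OF J] algebra_simps\<close>)
  define h where "h X = \<kappa> J (x * inv_into UNIV (\<kappa> {0}) X)" for X
  have inj: "inj (\<kappa> {0})" by (simp add: inj_def \<kappa>[OF zero])
  have h: "h (\<kappa> {0} u) = \<kappa> J (x * u)" for u by (simp add: h_def inj)
  have id: "linear_map ?R N.\<M> N.\<M> id" by (simp add: linear_map_def)
  have lin: "linear_map ?R N.\<M> P.\<M> h"
    by (auto simp: linear_map_def N.carrier_class P.carrier_class N.add_class P.add_class N.smult_class P.smult_class
        h algebra_simps)
  have L: "module ?R ?L" by (rule module_along_module[OF f])
  have TN: "tensor_product ?R N.\<M> ?L" and TP: "tensor_product ?R P.\<M> ?L"
    using L N.module_class P.module_class by (simp_all add: tensor_product_def)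
  interpret TN: tensor_product ?R N.\<M> ?L by (rule TN)
  interpret TP: tensor_product ?R P.\<M> ?L by (rule TP)
  have add_r: "frag_of (\<kappa> J u, k + l) - frag_of (\<kappa> J u, k) - frag_of (\<kappa> J u, l) \<in> TP.\<T>" for u k l
    using TP.relator_add_right[of "\<kappa> J u" k l] by (simp add: P.carrier_class module_along_simps)
  have sm: "frag_of (\<kappa> J (r * u), l) - frag_of (\<kappa> J u, f r * l) \<in> TP.\<T>" for r u l
    using TP.relator_smult[of r "\<kappa> J u" l] by (simp add: P.carrier_class P.smult_class module_along_simps)
  \<comment> \<open>Elements of \<open>J\<close> can be moved to the left factor, where they act as
    zero on A/J.\<close>
  have J0: "frag_of (\<kappa> J u, l) \<in> TP.\<T>" if "l \<in> prod_span (f ` J) UNIV" for u l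
    using that
  proof induction
    case zero
    show ?case using TP.tensor_zero_right[of "\<kappa> J u"] by (simp add: P.carrier_class module_along_simps)
  next
    case (step v w l)
    then obtain r where r: "v = f r" "r \<in> J" by blast
    have "\<kappa> J (r * u) = \<zero>\<^bsub>P.\<M>\<^esub>" using JD(4)[OF r(2)] by (simp add: P.zero_class \<kappa>[OF J])
    then have "frag_of (\<kappa> J (r * u), w) \<in> TP.\<T>" using TP.tensor_zero_left[of w] by (simp add: module_along_simps)
    then have "frag_of (\<kappa> J u, f r * w) \<in> TP.\<T>" using sm[of r u w] TP.relations_diff_iff by blast
    from TP.relations_add[OF TP.relations_add[OF this step.IH] add_r[of u "f r * w" l]]
    show ?case by (simp add: r algebra_simps)
  qed
  \<comment> \<open>As \<open>f x\<close> lies in JB, multiplication by \<open>x\<close> becomes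
    zero after tensoring. The tensored sequence is then exact, its first map being the
    identity.\<close>
  have hrel: "frag_map h c \<in> TP.\<T>" if "Poly_Mapping.keys c \<subseteq> carrier N.\<M> \<times> carrier ?L" for c
  proof (rule free_Abelian_group_induct[OF that])
    fix k assume "k \<in> carrier N.\<M> \<times> carrier ?L"
    then obtain u l where k: "k = (\<kappa> {0} u, l)" by (auto simp: N.carrier_class)
    have "l * f x \<in> prod_span (f ` J) UNIV" using prod_span_scale[OF x, of l UNIV] by simp
    then have "frag_of (\<kappa> J u, f x * l) \<in> TP.\<T>" by (intro J0) (simp add: mult.commute)
    then have "frag_of (\<kappa> J (x * u), l) \<in> TP.\<T>" using sm[of x u l] TP.relations_diff_iff by blast
    then show "frag_map h (frag_of k) \<in> TP.\<T>" by (simp add: k h)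
  qed (simp_all add: TP.relations_zero frag_map_diff TP.relations_diff)
  have "exact_tensored ?R ?L N.\<M> N.\<M> P.\<M> id h"
    unfolding exact_tensored_iff[OF TN TN TP id lin] using hrel TN.relations_zero by (metis diff_self frag_map_id)
  then have "exact_modules N.\<M> N.\<M> P.\<M> id h"
    using ff N.module_class P.module_class id lin unfolding faithfully_flat_module_def by blast
  \<comment> \<open>Exactness before tensoring applies to the class of 1, whose image is the class
    of \<open>x\<close> modulo \<open>J\<close>.\<close>
  then have "h (\<kappa> {0} 1) = \<zero>\<^bsub>P.\<M>\<^esub>" by (auto simp: exact_modules_def N.carrier_class)
  then show "x \<in> J" by (simp add: h P.zero_class \<kappa>[OF J])
qed

end

section \<open>Pull back of divisors along a flat extension\<close>

lemma prod_span_mult_mult: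
  assumes "x \<in> prod_span M W" "y \<in> prod_span N W"
    and W: "\<And>v w. v \<in> W \<Longrightarrow> w \<in> W \<Longrightarrow> v * w \<in> W"
  shows "x * y \<in> prod_span {m * n | m n. m \<in> M \<and> n \<in> N} W"
  using assms(1)
proof induction
  case (step a v z)
  have "a * v * y \<in> prod_span {m * n | m n. m \<in> M \<and> n \<in> N} W"
    using assms(2)
  proof induction
    case (step b w z)
    have "(a * b) * (v * w) + a * v * z \<in> prod_span {m * n | m n. m \<in> M \<and> n \<in> N} W"
      using step \<open>a \<in> M\<close> \<open>v \<in> W\<close> W by (intro prod_span.step) auto
    then show ?case by (simp add: algebra_simps)
  qed (simp add: prod_span.zero)
  then show ?case using step prod_span_add by (simp add: distrib_right)
qed (simp add: prod_span.zero)

lemma (in noetherian_normal_domain) ord_at_power_int: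
  assumes P: "P \<in> height_one_primes" and x: "(x :: 'a fract) \<noteq> 0"
  shows "ord_at P (x powi n) = n * ord_at P x"
  using ord_at_power[OF P x] ord_at_power[OF P, of "inverse x"] ord_at_inverse[OF P x] x
  by (cases "0 \<le> n") (auto simp: power_int_def)

locale flat_normal_extension =
  fixes f :: "'a::idom \<Rightarrow> 'b::idom"
  assumes noetherian_A: "noetherian_ring (ring_of_type :: 'a ring)" and normal_A: "normal_domain TYPE('a)"
    and noetherian_B: "noetherian_ring (ring_of_type :: 'b ring)" and normal_B: "normal_domain TYPE('b)"
    and hom: "f \<in> ring_hom ring_of_type ring_of_type" and inj: "inj f"
    and flat: "flat_module ring_of_type (module_along f)"
begin

sublocale A: noetherian_normal_domain "TYPE('a)"
  by (rule noetherian_normal_domain.intro[OF noetherian_A normal_A])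

sublocale B: noetherian_normal_domain "TYPE('b)"
  by (rule noetherian_normal_domain.intro[OF noetherian_B normal_B])

lemmas f_simps = ring_hom_type[OF hom]

lemma f_eq_0_iff: "f a = 0 \<longleftrightarrow> a = 0"
  using inj f_simps(4) by (metis injD)

section \<open>The induced map of fields of fractions and its effect on orders\<close>

definition fr :: "'a fract \<Rightarrow> 'b fract" where
  "fr x = (let p = (SOME p. snd p \<noteq> 0 \<and> x = Fract (fst p) (snd p)) in Fract (f (fst p)) (f (snd p)))"

lemma fr_Fract:
  assumes "s \<noteq> 0"
  shows "fr (Fract a s) = Fract (f a) (f s)"
proof -
  define p where "p = (SOME p. snd p \<noteq> 0 \<and> Fract a s = Fract (fst p) (snd p))"
  have "\<exists>p. snd p \<noteq> 0 \<and> Fract a s = Fract (fst p) (snd p)" using assms by (intro exI[of _ "(a, s)"]) simp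
  then have p: "snd p \<noteq> 0" "Fract a s = Fract (fst p) (snd p)" unfolding p_def by (metis (mono_tags, lifting) someI_ex)+
  then have "f (a * snd p) = f (fst p * s)" using assms by (simp add: eq_fract)
  then have "Fract (f (fst p)) (f (snd p)) = Fract (f a) (f s)"
    using p(1) assms by (simp add: eq_fract f_simps f_eq_0_iff)
  then show ?thesis by (simp add: fr_def p_def)
qed

lemma fr_to_fract: "fr (to_fract a) = to_fract (f a)"
  by (simp add: to_fract_def fr_Fract f_simps)

lemma fr_mult: "fr (x * y) = fr x * fr y"
proof -
  obtain a s where "s \<noteq> 0" "x = Fract a s" by (cases x) auto
  moreover obtain b t where "t \<noteq> 0" "y = Fract b t" by (cases y) auto
  ultimately show ?thesis by (simp add: fr_Fract f_simps)
qed

lemma fr_add: "fr (x + y) = fr x + fr y"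
proof -
  obtain a s where "s \<noteq> 0" "x = Fract a s" by (cases x) auto
  moreover obtain b t where "t \<noteq> 0" "y = Fract b t" by (cases y) auto
  ultimately show ?thesis by (simp add: fr_Fract f_simps f_eq_0_iff)
qed

lemma fr_0: "fr 0 = 0" and fr_1: "fr 1 = 1"
  using fr_to_fract[of 0] fr_to_fract[of 1] by (simp_all add: f_simps)

lemma fr_eq_0_iff: "fr x = 0 \<longleftrightarrow> x = 0"
proof
  assume "fr x = 0"
  then show "x = 0" using fr_mult[of x "inverse x"] fr_1 by (cases "x = 0") auto
qed (simp add: fr_0)

lemma fr_inverse: "fr (inverse x) = inverse (fr x)"
proof (cases "x = 0")
  case False
  then have "fr x * fr (inverse x) = 1" by (simp add: fr_1 flip: fr_mult)
  then show ?thesis by (metis inverse_unique)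
qed (simp add: fr_0)

lemma fr_power: "fr (x ^ n) = fr x ^ n"
  by (induction n) (simp_all add: fr_1 fr_mult)

lemma fr_power_int: "fr (x powi n) = fr x powi n"
  by (simp add: power_int_def fr_power fr_inverse)

lemma contraction_Spec:
  assumes "Q \<in> Spec (ring_of_type :: 'b ring)"
  shows "f -` Q \<in> Spec (ring_of_type :: 'a ring)"
  unfolding Spec_ring_of_type_iff
  using SpecD[OF assms] by (auto simp: f_simps intro!: ideal_ring_of_typeI)

lemma fr_local_ring:
  assumes Q: "Q \<in> Spec ring_of_type" and x: "x \<in> local_ring (f -` Q)"
  shows "fr x \<in> local_ring Q"
proof -
  obtain a s where a: "x = Fract a s" "f s \<notin> Q" using x by (auto simp: local_ring_def)
  then have "s \<noteq> 0" using SpecD(4)[OF Q] f_simps(4) by metis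
  then show ?thesis using a by (simp add: fr_Fract Fract_local_ring[OF Q])
qed

lemma fr_unit_at:
  assumes "Q \<in> Spec ring_of_type" and "unit_at (f -` Q) u"
  shows "unit_at Q (fr u)"
  using assms fr_local_ring[OF assms(1)] by (auto simp: unit_at_def fr_eq_0_iff simp flip: fr_inverse)

text \<open>If \<open>p = P \<inter> A\<close> had height at least two, then \<open>(a : p) = aA\<close> for \<open>a \<in> p\<close> by normality, and by
  flatness this would persist in \<open>B\<close>, where \<open>P\<close> is associated to \<open>aB\<close>.\<close>

lemma contraction_height_one:
  assumes P: "P \<in> (height_one_primes :: 'b set set)" and nz: "f -` P \<noteq> {0}"
  shows "f -` P \<in> height_one_primes"
proof (rule ccontr)
  assume n: "\<not> ?thesis"
  note PS = height_one_primesD(1)[OF P]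
  have pS: "f -` P \<in> Spec ring_of_type" by (rule contraction_Spec[OF PS])
  obtain a where a: "f a \<in> P" "a \<noteq> 0" using nz SpecD(4)[OF pS] by auto
  then have fa: "f a \<noteq> 0" by (simp add: f_eq_0_iff)
  obtain b where b: "P = {r. f a dvd r * b}" using B.height_one_associated[OF P a(1) fa] by blast
  obtain S where S: "finite S" "S \<subseteq> f -` P" "\<And>J. ideal J ring_of_type \<Longrightarrow> S \<subseteq> J \<Longrightarrow> f -` P \<subseteq> J"
    using A.ideal_finitely_generated[OF SpecD(1)[OF pS]] by blast
  have "f a dvd b * f s" if s: "s \<in> S" for s
  proof -
    have "f s \<in> P" using s S(2) by blast
    then have "f a dvd f s * b" using b by blast
    then show ?thesis by (simp add: mult.commute)
  qed
  then have span: "b \<in> prod_span (f ` {c. \<forall>s\<in>S. a dvd c * s}) UNIV"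
    by (rule flat_colon[OF hom flat S(1)])
  \<comment> \<open>No height one prime \<open>Q\<close> contains the contraction of
    \<open>P\<close>, so some element of the contraction lies outside \<open>Q\<close> and
    \<open>a\<close> divides \<open>c\<close> locally at \<open>Q\<close>.\<close>
  have colon: "a dvd c" if c: "\<forall>s\<in>S. a dvd c * s" for c
  proof (rule A.hartogs_dvd[OF a(2)])
    fix Q :: "'a set" assume Q: "Q \<in> height_one_primes"
    have "f -` P \<subseteq> {r. a dvd r * c}"
      using c by (intro S(3) A.ideal_colon) (auto simp: mult.commute)
    moreover have "\<not> f -` P \<subseteq> Q"
      using height_one_primesD(4)[OF Q pS nz] n Q by blast
    ultimately show "\<exists>s. s \<notin> Q \<and> a dvd s * c" by blast
  qed
  have "f a dvd u" if "u \<in> prod_span (f ` {c. \<forall>s\<in>S. a dvd c * s}) UNIV" for u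
    using that
  proof induction
    case (step x y z)
    then obtain c where c: "x = f c" "\<forall>s\<in>S. a dvd c * s" by blast
    then obtain k where "c = a * k" using colon[OF c(2)] by (auto elim: dvdE)
    then show ?case using step c(1) by (simp add: f_simps mult.assoc)
  qed simp
  \<comment> \<open>Flatness has made \<open>b\<close> a multiple of \<open>f a\<close>, so the
    colon ideal \<open>P\<close> would be the unit ideal.\<close>
  then have "f a dvd 1 * b" using span by simp
  then have "1 \<in> P" using b by blast
  then show False using SpecD(2)[OF PS] by blast
qed

text \<open>\<open>fr\<close> maps units at the contraction to units at \<open>P\<close>, so only
  the image of a uniformizer counts. The same fact makes the definite description in
  \<open>ramification_index\<close> independent of the uniformizer.\<close>

lemma ord_at_fr:
  assumes P: "P \<in> (height_one_primes :: 'b set set)" and p: "f -` P \<in> height_one_primes"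
  shows "0 \<le> ramification_index f P (f -` P)"
    and "x \<noteq> 0 \<Longrightarrow> ord_at P (fr x) = ramification_index f P (f -` P) * ord_at (f -` P) x"
proof -
  note PS = height_one_primesD(1)[OF P] and pS = height_one_primesD(1)[OF p]
  obtain \<pi> where pi: "\<pi> \<in> f -` P" "\<pi> \<noteq> 0" "uniformizer (f -` P) (to_fract \<pi>)"
    by (rule A.height_one_uniformizer[OF p]) (rule that)
  define e where "e = ord_at P (fr (to_fract \<pi>))"
  have "e = ramification_index f P (f -` P)"
    unfolding ramification_index_def
  proof (rule the_equality[symmetric])
    show "\<exists>a s. s \<notin> f -` P \<and> uniformizer (f -` P) (Fract a s) \<and> e = ord_at P (Fract (f a) (f s))"
    proof (rule exI[of _ \<pi>], rule exI[of _ 1], intro conjI)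
      show "1 \<notin> f -` P" by (rule SpecD(2)[OF pS])
      show "uniformizer (f -` P) (Fract \<pi> 1)" using pi(3) by (simp add: to_fract_def)
      show "e = ord_at P (Fract (f \<pi>) (f 1))" by (simp add: e_def fr_Fract to_fract_def)
    qed
    fix e' assume "\<exists>a s. s \<notin> f -` P \<and> uniformizer (f -` P) (Fract a s) \<and> e' = ord_at P (Fract (f a) (f s))"
    then obtain a s where as: "s \<notin> f -` P" "uniformizer (f -` P) (Fract a s)" "e' = ord_at P (Fract (f a) (f s))"
      by blast
    have "s \<noteq> 0" using as(1) SpecD(4)[OF pS] by blast
    then have e': "e' = ord_at P (fr (Fract a s))" using as(3) by (simp add: fr_Fract)
    obtain v where v: "unit_at (f -` P) v" "Fract a s = v * to_fract \<pi>"
      using uniformizer_unique[OF pS as(2) pi(3) A.uniformizer_nonzero[OF p as(2)]] by blast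
    have "fr v \<noteq> 0" using fr_unit_at[OF PS v(1)] by (simp add: unit_at_def)
    then show "e' = e"
      using e' v(2) B.ord_at_unit[OF P fr_unit_at[OF PS v(1)]] pi(2) B.ord_at_mult[OF P, of "fr v" "fr (to_fract \<pi>)"]
      by (simp add: e_def fr_mult fr_eq_0_iff)
  qed
  moreover have "0 \<le> e"
    using B.ord_at_to_fract_nonneg[OF P, of "f \<pi>"] pi(2) by (simp add: e_def fr_to_fract f_eq_0_iff)
  moreover have "ord_at P (fr x) = e * ord_at (f -` P) x" if x: "x \<noteq> 0"
  proof -
    obtain u where u: "unit_at (f -` P) u" "x = u * to_fract \<pi> powi ord_at (f -` P) x"
      using A.ord_at_decomposition[OF p pi(3) x] .
    have nz: "fr (to_fract \<pi>) \<noteq> 0" "fr u \<noteq> 0"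
      using pi(2) fr_unit_at[OF PS u(1)] by (simp_all add: fr_eq_0_iff unit_at_def)
    have "fr x = fr u * fr (to_fract \<pi>) powi ord_at (f -` P) x"
      by (subst u(2)) (simp add: fr_mult fr_power_int)
    then have "ord_at P (fr x) = ord_at P (fr u) + ord_at P (fr (to_fract \<pi>) powi ord_at (f -` P) x)"
      using B.ord_at_mult[OF P nz(2), of "fr (to_fract \<pi>) powi ord_at (f -` P) x"] nz by simp
    then show ?thesis
      using B.ord_at_unit[OF P fr_unit_at[OF PS u(1)]] B.ord_at_power_int[OF P nz(1)] by (simp add: e_def)
  qed
  ultimately show "0 \<le> ramification_index f P (f -` P)"
    and "x \<noteq> 0 \<Longrightarrow> ord_at P (fr x) = ramification_index f P (f -` P) * ord_at (f -` P) x" by simp_all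
qed

text \<open>When \<open>P\<close> contracts to zero, every nonzero element of A becomes a unit at
  \<open>P\<close>.\<close>

lemma ord_at_fr_contraction_zero:
  assumes P: "P \<in> (height_one_primes :: 'b set set)" and p: "f -` P = {0}" and x: "x \<noteq> 0"
  shows "ord_at P (fr x) = 0"
proof -
  obtain a s where a: "s \<noteq> 0" "x = Fract a s" by (cases x) auto
  then have "a \<noteq> 0" using x by (auto simp: Fract_conv_to_fract)
  then have "f a \<notin> P" "f s \<notin> P" using p a(1) by auto
  then have "unit_at P (fr x)"
    using a \<open>a \<noteq> 0\<close> x fr_eq_0_iff[of x] Fract_local_ring[OF height_one_primesD(1)[OF P]]
    by (auto simp: unit_at_def fr_Fract)
  then show ?thesis by (rule B.ord_at_unit[OF P])
qed

text \<open>The coefficient of p*D at a height one prime \<open>P\<close>. If \<open>P\<close>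
  contracts to zero, the first factor vanishes for \<open>D\<close> supported on height one primes,
  whatever the ramification index is there.\<close>

definition pullback_coeff :: "('a set \<Rightarrow> int) \<Rightarrow> 'b set \<Rightarrow> int" where
  "pullback_coeff D P = D (f -` P) * ramification_index f P (f -` P)"

lemma pullback_coeff_simps:
  "pullback_coeff (\<lambda>P. - D P) = (\<lambda>P. - pullback_coeff D P)"
  "pullback_coeff (\<lambda>P. k * D P) = (\<lambda>P. k * pullback_coeff D P)"
  by (auto simp: pullback_coeff_def)

lemma fr_sections:
  assumes D: "\<And>P. P \<notin> height_one_primes \<Longrightarrow> D P = 0" and x: "x \<in> divisor_sections D"
  shows "fr x \<in> divisor_sections (pullback_coeff D)"
proof (cases "x = 0")
  case False
  have "0 \<le> ord_at P (fr x) + pullback_coeff D P" if P: "P \<in> height_one_primes" for P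
  proof (cases "f -` P = {0}")
    case True
    have "{0} \<notin> (height_one_primes :: 'a set set)" using height_one_primesD(2) by blast
    then show ?thesis using ord_at_fr_contraction_zero[OF P True False] D by (simp add: pullback_coeff_def True)
  next
    case nz: False
    note p = contraction_height_one[OF P nz]
    have "0 \<le> ramification_index f P (f -` P) * (ord_at (f -` P) x + D (f -` P))"
      using ord_at_fr(1)[OF P p] x p False by (intro mult_nonneg_nonneg) (auto simp: divisor_sections_def)
    then show ?thesis using ord_at_fr(2)[OF P p False] by (simp add: pullback_coeff_def algebra_simps)
  qed
  then show ?thesis by (simp add: divisor_sections_def)
qed (simp add: fr_0 divisor_sections_def)

text \<open>\<open>B(p\<^sup>*D)\<close> is contained in \<open>(B : A(-D)B) = (A : A(-D))B = A(D)B\<close>.\<close>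

lemma sections_pullback:
  assumes D: "\<And>P. P \<notin> height_one_primes \<Longrightarrow> D P = 0" and fin: "finite {P \<in> height_one_primes. D P \<noteq> 0}"
    and y: "y \<in> divisor_sections (pullback_coeff D)"
  shows "y \<in> prod_span (fr ` divisor_sections D) (range to_fract)"
proof -
  let ?D' = "\<lambda>P. - D P"
  have fin': "finite {P \<in> height_one_primes. ?D' P \<noteq> 0}" using fin by simp
  have D': "\<And>P. P \<notin> height_one_primes \<Longrightarrow> ?D' P = 0" using D by simp
  obtain d :: 'a where d: "d \<noteq> 0" "\<And>x. x \<in> divisor_sections ?D' \<Longrightarrow> to_fract d * x \<in> range to_fract"
    using A.sections_common_denominator[OF fin'] by blast
  \<comment> \<open>The fractional ideal A(-D) multiplied by \<open>d\<close>: an ideal of A, hence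
    finitely generated.\<close>
  define I where "I = {a. to_fract a / to_fract d \<in> divisor_sections ?D'}"
  have "ideal I ring_of_type"
  proof (rule ideal_ring_of_typeI)
    show "0 \<in> I" by (simp add: I_def A.sections_zero)
    show "u + v \<in> I" if "u \<in> I" "v \<in> I" for u v
      using that A.sections_add by (simp add: I_def add_divide_distrib)
    show "r * u \<in> I" if "u \<in> I" for r u
      using that A.sections_scale[of "to_fract u / to_fract d" _ r] by (simp add: I_def)
  qed
  then obtain S where S: "finite S" "S \<subseteq> I" "\<And>J. ideal J ring_of_type \<Longrightarrow> S \<subseteq> J \<Longrightarrow> I \<subseteq> J"
    using A.ideal_finitely_generated by blast
  have I_prod: "y * fr (to_fract a / to_fract d) \<in> range to_fract" if "a \<in> I" for a
  proof -
    have "fr (to_fract a / to_fract d) \<in> divisor_sections (pullback_coeff ?D')"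
      using that by (intro fr_sections D') (simp_all add: I_def)
    from B.sections_mult[OF y this] show ?thesis
      by (simp add: pullback_coeff_simps B.sections_zero_divisor)
  qed
  have fr_div: "fr (to_fract a / to_fract d) = to_fract (f a) / to_fract (f d)" for a
    by (simp add: divide_inverse fr_mult fr_inverse fr_to_fract)
  \<comment> \<open>By duality a common denominator \<open>c\<close> of A(D) lies in A(-D), which
    provides a nonzero element.\<close>
  obtain b where b: "b \<in> I" "b \<noteq> 0"
  proof -
    obtain c where c: "c \<noteq> 0" "\<And>x. x \<in> divisor_sections D \<Longrightarrow> to_fract c * x \<in> range to_fract"
      using A.sections_common_denominator[OF fin] by blast
    then have "to_fract c \<in> divisor_sections ?D'"
      using A.sections_dual[OF fin', of "to_fract c"] by simp
    then have "c * d \<in> I" using d(1) by (simp add: I_def)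
    moreover have "c * d \<noteq> 0" using c(1) d(1) by simp
    ultimately show thesis by (rule that)
  qed
  obtain y' where y': "y * fr (to_fract b / to_fract d) = to_fract y'" using I_prod[OF b(1)] by blast
  have fb: "to_fract (f b) \<noteq> 0" using b(2) by (simp add: f_eq_0_iff)
  have fd': "to_fract (f d) \<noteq> 0" using d(1) by (simp add: f_eq_0_iff)
  \<comment> \<open>Clearing denominators turns the condition that \<open>y\<close> maps A(-D) into
    B into divisibility of \<open>y' * f s\<close> by \<open>f b\<close>, the form that
    \<open>flat_colon\<close> handles.\<close>
  have y_eq: "y = to_fract y' * to_fract (f d) / to_fract (f b)"
    using y' fb fd' by (simp add: fr_div field_simps)
  have "f b dvd y' * f s" if s: "s \<in> S" for s
  proof -
    obtain w where w: "y * fr (to_fract s / to_fract d) = to_fract w" using I_prod s S(2) by blast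
    have "to_fract (y' * f s) = to_fract (f b * w)"
      using y'[symmetric] w[symmetric] by (simp add: fr_div)
    then show ?thesis by (metis dvd_triv_left to_fract_eq_iff)
  qed
  then have span: "y' \<in> prod_span (f ` {c. \<forall>s\<in>S. b dvd c * s}) UNIV"
    by (rule flat_colon[OF hom flat S(1)])
  \<comment> \<open>A solution over A maps A(-D) into A after multiplication by d / b, so it gives
    an element of the dual A(D).\<close>
  have quot: "to_fract c * to_fract d / to_fract b \<in> divisor_sections D" if c: "\<forall>s\<in>S. b dvd c * s" for c
  proof (rule A.sections_dual[OF fin])
    fix x assume x: "x \<in> divisor_sections ?D'"
    then obtain a where a: "to_fract d * x = to_fract a" using d(2) by blast
    then have "x = to_fract a / to_fract d" using d(1) by (simp add: field_simps)
    then have "a \<in> I" using x by (simp add: I_def)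
    moreover have "I \<subseteq> {r. b dvd r * c}"
      using c by (intro S(3) A.ideal_colon) (auto simp: mult.commute)
    ultimately obtain k where k: "a * c = b * k" by (auto elim: dvdE)
    have "to_fract c * to_fract d / to_fract b * x = to_fract (a * c) / to_fract b"
      using a by (simp add: mult_ac)
    also have "\<dots> = to_fract k" using k b(2) by simp
    finally show "to_fract c * to_fract d / to_fract b * x \<in> range to_fract" by blast
  qed
  have "to_fract u * to_fract (f d) / to_fract (f b) \<in> prod_span (fr ` divisor_sections D) (range to_fract)"
    if "u \<in> prod_span (f ` {c. \<forall>s\<in>S. b dvd c * s}) UNIV" for u
    using that
  proof induction
    case zero
    show ?case by (simp add: prod_span.zero)
  next
    case (step x v z)
    then obtain c where c: "x = f c" "\<forall>s\<in>S. b dvd c * s" by blast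
    have "fr (to_fract c * to_fract d / to_fract b) = to_fract (f c) * to_fract (f d) / to_fract (f b)"
      by (simp add: divide_inverse fr_mult fr_inverse fr_to_fract)
    then have "to_fract (x * v + z) * to_fract (f d) / to_fract (f b) =
        fr (to_fract c * to_fract d / to_fract b) * to_fract v + to_fract z * to_fract (f d) / to_fract (f b)"
      by (simp add: c(1) add_divide_distrib algebra_simps)
    also have "\<dots> \<in> prod_span (fr ` divisor_sections D) (range to_fract)"
      using quot[OF c(2)] step.IH by (intro prod_span.step) auto
    finally show ?case .
  qed
  then show ?thesis using span y_eq by simp
qed

lemma fr_twist_ideal:
  assumes D: "\<And>P. P \<notin> height_one_primes \<Longrightarrow> D P = 0" and t: "t \<in> twist_ideal D m"
  shows "fr t \<in> twist_ideal (pullback_coeff D) m"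
  using t unfolding twist_ideal_def
proof induction
  case (step x y z)
  have "fr x \<in> divisor_sections (pullback_coeff (\<lambda>P. - D P))" using step D by (intro fr_sections) auto
  moreover have "fr y \<in> divisor_sections (pullback_coeff (\<lambda>P. int (Suc m) * D P))"
    using step D by (intro fr_sections) auto
  ultimately show ?case
    using step.IH by (simp only: fr_add fr_mult pullback_coeff_simps) (rule prod_span.step)
qed (simp add: fr_0 prod_span.zero)

text \<open>A section of the pull back is a B-combination of images of sections of \<open>D\<close>.
  The summands come with different exponents, which \<open>twist_ideal_power_add\<close>
  combines.\<close>

lemma pullback_radical:
  assumes D: "\<And>P. P \<notin> height_one_primes \<Longrightarrow> D P = 0" and fin: "finite {P \<in> height_one_primes. D P \<noteq> 0}"
    and R: "\<And>q. q \<in> divisor_sections D \<Longrightarrow> q \<noteq> 0 \<Longrightarrow> \<exists>m. q ^ m \<in> twist_ideal D m"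
    and y: "y \<in> divisor_sections (pullback_coeff D)"
  shows "\<exists>m. y ^ m \<in> twist_ideal (pullback_coeff D) m"
proof -
  have "z \<in> divisor_sections (pullback_coeff D) \<and> (\<exists>m. z ^ m \<in> twist_ideal (pullback_coeff D) m)"
    if "z \<in> prod_span (fr ` divisor_sections D) (range to_fract)" for z
    using that
  proof induction
    case zero
    have "0 ^ 1 \<in> twist_ideal (pullback_coeff D) 1" using B.twist_ideal_zero by simp
    then show ?case using B.sections_zero by blast
  next
    case (step x v z)
    obtain q where q: "x = fr q" "q \<in> divisor_sections D" using step by blast
    obtain w where w: "v = to_fract w" using step by blast
    have "\<exists>m. q ^ m \<in> twist_ideal D m"
    proof (cases "q = 0")
      case True
      have "0 ^ 1 \<in> twist_ideal D 1" using A.twist_ideal_zero by simp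
      then show ?thesis using True by blast
    qed (use R q in blast)
    then obtain m where m: "q ^ m \<in> twist_ideal D m" by blast
    have u: "x * v \<in> divisor_sections (pullback_coeff D)"
      using B.sections_scale[OF fr_sections[OF D q(2)], of w] by (simp add: q w mult.commute)
    have "to_fract (w ^ m) * fr (q ^ m) \<in> twist_ideal (pullback_coeff D) m"
      by (rule B.twist_ideal_scale[OF fr_twist_ideal[OF D m]])
    moreover have "to_fract (w ^ m) = to_fract w ^ m" by (induction m) auto
    ultimately have um: "(x * v) ^ m \<in> twist_ideal (pullback_coeff D) m"
      by (simp add: q w fr_power power_mult_distrib mult.commute)
    obtain k where k: "z ^ k \<in> twist_ideal (pullback_coeff D) k" using step.IH by blast
    have z: "z \<in> divisor_sections (pullback_coeff D)" using step.IH by blast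
    show ?case using B.sections_add[OF u z] B.twist_ideal_power_add[OF u um z k] by blast
  qed
  then show ?thesis using sections_pullback[OF D fin y] by blast
qed

text \<open>Applying \<open>sections_pullback\<close> to both factors puts the twist ideal of the
  pull back inside the extension of the one over A; contraction then keeps the exponent m.\<close>

lemma descent_radical:
  assumes ff: "faithfully_flat_module ring_of_type (module_along f)"
    and D: "\<And>P. P \<notin> height_one_primes \<Longrightarrow> D P = 0" and fin: "finite {P \<in> height_one_primes. D P \<noteq> 0}"
    and q: "q \<in> divisor_sections D" and m: "fr q ^ m \<in> twist_ideal (pullback_coeff D) m"
  shows "q ^ m \<in> twist_ideal D m"
proof -
  let ?T = "twist_ideal D m" and ?W = "range (to_fract :: 'b \<Rightarrow> 'b fract)"
  have W: "v * w \<in> ?W" if "v \<in> ?W" "w \<in> ?W" for v w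
    using that by (auto simp flip: to_fract_mult)
  have T_span: "u \<in> prod_span (fr ` ?T) ?W" if "u \<in> twist_ideal (pullback_coeff D) m" for u
    using that unfolding twist_ideal_def[of "pullback_coeff D"]
  proof induction
    case zero
    show ?case by (rule prod_span.zero)
  next
    case (step x y z)
    have "x \<in> prod_span (fr ` divisor_sections (\<lambda>P. - D P)) ?W"
      using step(1) D fin by (intro sections_pullback) (auto simp: pullback_coeff_simps)
    moreover have "finite {P \<in> height_one_primes. int (Suc m) * D P \<noteq> 0}"
      by (rule finite_subset[OF _ fin]) auto
    then have "y \<in> prod_span (fr ` divisor_sections (\<lambda>P. int (Suc m) * D P)) ?W"
    proof (rule sections_pullback[rotated])
      show "y \<in> divisor_sections (pullback_coeff (\<lambda>P. int (Suc m) * D P))"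
        using step(2) by (simp only: pullback_coeff_simps)
    qed (simp add: D)
    ultimately have "x * y \<in> prod_span {u * v | u v. u \<in> fr ` divisor_sections (\<lambda>P. - D P) \<and>
        v \<in> fr ` divisor_sections (\<lambda>P. int (Suc m) * D P)} ?W"
      using W by (rule prod_span_mult_mult)
    moreover have "{u * v | u v. u \<in> fr ` divisor_sections (\<lambda>P. - D P) \<and>
        v \<in> fr ` divisor_sections (\<lambda>P. int (Suc m) * D P)} \<subseteq> fr ` ?T"
      unfolding twist_ideal_def by (auto simp: image_iff simp flip: fr_mult intro: prod_span_mult)
    ultimately have "x * y \<in> prod_span (fr ` ?T) ?W" using prod_span_mono[OF _ order_refl] by blast
    then show ?case using step.IH by (rule prod_span_add)
  qed
  have fin_m: "finite {P \<in> height_one_primes. int m * D P \<noteq> 0}"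
    by (rule finite_subset[OF _ fin]) auto
  obtain d :: 'a where d: "d \<noteq> 0" "\<And>x. x \<in> divisor_sections (\<lambda>P. int m * D P) \<Longrightarrow> to_fract d * x \<in> range to_fract"
    using A.sections_common_denominator[OF fin_m] by blast
  have T_sub: "t \<in> divisor_sections (\<lambda>P. int m * D P)" if "t \<in> ?T" for t
    using that unfolding twist_ideal_def
  proof induction
    case (step x y z)
    from A.sections_mult[OF step(1,2)] have "x * y \<in> divisor_sections (\<lambda>P. int m * D P)"
      by (simp add: algebra_simps)
    then show ?case using step.IH by (rule A.sections_add)
  qed (rule A.sections_zero)
  \<comment> \<open>\<open>faithfully_flat_contract\<close> needs an ideal of A, so the twist ideal
    is multiplied by a common denominator of A(mD), which contains it.\<close>
  define J where "J = {a. \<exists>t\<in>?T. to_fract a = to_fract d * t}"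
  have J: "ideal J ring_of_type"
  proof (rule ideal_ring_of_typeI)
    show "0 \<in> J" using A.twist_ideal_zero by (auto simp: J_def)
    show "u + v \<in> J" if "u \<in> J" "v \<in> J" for u v
    proof -
      obtain s t where st: "s \<in> ?T" "t \<in> ?T" "to_fract u = to_fract d * s" "to_fract v = to_fract d * t"
        using \<open>u \<in> J\<close> \<open>v \<in> J\<close> by (auto simp: J_def)
      then have "to_fract (u + v) = to_fract d * (s + t)" by (simp add: distrib_left)
      then show ?thesis using A.twist_ideal_add[OF st(1,2)] unfolding J_def by blast
    qed
    show "r * u \<in> J" if "u \<in> J" for r u
    proof -
      obtain s where s: "s \<in> ?T" "to_fract u = to_fract d * s" using \<open>u \<in> J\<close> by (auto simp: J_def)
      then have "to_fract (r * u) = to_fract d * (to_fract r * s)" by (simp add: mult_ac)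
      then show ?thesis using A.twist_ideal_scale[OF s(1), of r] unfolding J_def by blast
    qed
  qed
  have lift: "\<exists>v\<in>prod_span (f ` J) UNIV. to_fract v = to_fract (f d) * u" if "u \<in> prod_span (fr ` ?T) ?W" for u
    using that
  proof induction
    case zero
    then show ?case by (auto intro!: bexI[of _ 0] prod_span.zero)
  next
    case (step x y z)
    obtain t where t: "t \<in> ?T" "x = fr t" using step by blast
    obtain w where w: "y = to_fract w" using step by blast
    obtain v where v: "v \<in> prod_span (f ` J) UNIV" "to_fract v = to_fract (f d) * z" using step.IH by blast
    obtain a where a: "to_fract d * t = to_fract a" using d(2)[OF T_sub[OF t(1)]] by blast
    then have "a \<in> J" unfolding J_def mem_Collect_eq by (intro bexI[OF _ t(1)]) simp
    then have "f a * w + v \<in> prod_span (f ` J) UNIV" using v(1) by (intro prod_span.step) auto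
    moreover have "to_fract (f a) = to_fract (f d) * x"
      using t(2) fr_mult[of "to_fract d" t] by (simp add: a fr_to_fract)
    then have "to_fract (f a * w + v) = to_fract (f d) * (x * y + z)"
      by (simp add: w v(2) distrib_left mult.assoc)
    ultimately show ?case by blast
  qed
  obtain a where a: "to_fract d * q ^ m = to_fract a" using d(2)[OF A.sections_power[OF q]] by blast
  obtain v where v: "v \<in> prod_span (f ` J) UNIV" "to_fract v = to_fract (f d) * fr q ^ m"
    using lift[OF T_span[OF m]] by blast
  have "to_fract (f a) = to_fract v"
    using v(2) fr_mult[of "to_fract d" "q ^ m"] by (simp add: a fr_to_fract fr_power)
  then have "a \<in> J" using faithfully_flat_contract[OF hom ff J, of a] v(1) by simp
  then obtain t where "t \<in> ?T" "to_fract a = to_fract d * t" by (auto simp: J_def)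
  then have "q ^ m = t" using a d(1) by simp
  then show ?thesis using \<open>t \<in> ?T\<close> by simp
qed

section \<open>Both directions for Weil divisors\<close>

lemma weil_lookup_zero:
  "D \<in> weil_divisors \<Longrightarrow> P \<notin> height_one_primes \<Longrightarrow> Poly_Mapping.lookup D P = 0"
  by (auto simp: weil_divisors_def in_keys_iff)

text \<open>The height one primes of B over \<open>p\<close> all contain the image of one nonzero
  element of \<open>p\<close>, so there are finitely many, and the sum in
  \<open>divisor_pullback\<close> is genuine rather than the default 0 of an infinite sum.\<close>

lemma lookup_divisor_pullback:
  assumes D: "D \<in> weil_divisors"
  shows "Poly_Mapping.lookup (divisor_pullback f D) P =
    (if P \<in> height_one_primes then pullback_coeff (Poly_Mapping.lookup D) P else 0)"
proof -
  have fin: "finite {P \<in> height_one_primes. f -` P = p}" if p: "p \<in> height_one_primes" for p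
  proof -
    obtain a where a: "a \<in> p" "a \<noteq> 0" using height_one_primesD(3)[OF p] by blast
    then have "finite {P \<in> height_one_primes. f a \<in> P}"
      by (intro B.finite_height_one_primes_containing) (simp add: f_eq_0_iff)
    then show ?thesis by (rule rev_finite_subset) (use a in auto)
  qed
  have inner: "Poly_Mapping.lookup (\<Sum>Q | Q \<in> height_one_primes \<and> f -` Q = p.
      frag_cmul (ramification_index f Q p) (frag_of Q)) P =
      (if P \<in> height_one_primes \<and> f -` P = p then ramification_index f P p else 0)"
    if p: "p \<in> height_one_primes" for p
  proof -
    have "Poly_Mapping.lookup (\<Sum>Q | Q \<in> height_one_primes \<and> f -` Q = p.
        frag_cmul (ramification_index f Q p) (frag_of Q)) P =
        (\<Sum>Q | Q \<in> height_one_primes \<and> f -` Q = p. if P = Q then ramification_index f Q p else 0)"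
      by (simp add: lookup_sum if_distrib[of "\<lambda>x. _ * x"] cong: if_cong)
    also have "\<dots> = (if P \<in> height_one_primes \<and> f -` P = p then ramification_index f P p else 0)"
      using fin[OF p] by (simp add: sum.delta')
    finally show ?thesis .
  qed
  have keys: "Poly_Mapping.keys D \<subseteq> height_one_primes" using D by (simp add: weil_divisors_def)
  have "Poly_Mapping.lookup (divisor_pullback f D) P =
      (\<Sum>p\<in>Poly_Mapping.keys D. Poly_Mapping.lookup D p *
        (if P \<in> height_one_primes \<and> f -` P = p then ramification_index f P p else 0))"
    unfolding divisor_pullback_def frag_extend_def
  proof (subst lookup_sum, rule sum.cong[OF refl])
    fix p assume "p \<in> Poly_Mapping.keys D"
    then have "p \<in> height_one_primes" using keys by blast
    then show "Poly_Mapping.lookup (frag_cmul (Poly_Mapping.lookup D p)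
        (\<Sum>Q | Q \<in> height_one_primes \<and> f -` Q = p. frag_cmul (ramification_index f Q p) (frag_of Q))) P =
      Poly_Mapping.lookup D p * (if P \<in> height_one_primes \<and> f -` P = p then ramification_index f P p else 0)"
      by (simp only: lookup_frag_cmul inner)
  qed
  also have "\<dots> = (\<Sum>p\<in>Poly_Mapping.keys D. if f -` P = p then
        (if P \<in> height_one_primes then pullback_coeff (Poly_Mapping.lookup D) P else 0) else 0)"
    by (intro sum.cong) (auto simp: pullback_coeff_def)
  also have "\<dots> = (if P \<in> height_one_primes then pullback_coeff (Poly_Mapping.lookup D) P else 0)"
    by (auto simp: pullback_coeff_def in_keys_iff)
  finally show ?thesis .
qed

lemma pullback_weil: "D \<in> weil_divisors \<Longrightarrow> divisor_pullback f D \<in> weil_divisors"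
  by (auto simp: weil_divisors_def[where 'a = 'b] in_keys_iff lookup_divisor_pullback split: if_splits)

text \<open>Sections and twist ideals see only coefficients at height one primes, where the pull
  back agrees with \<open>pullback_coeff\<close>.\<close>

theorem coaffine_pullback_iff:
  assumes D: "D \<in> weil_divisors"
  shows "coaffine (divisor_pullback f D) \<longleftrightarrow>
    (\<forall>y\<in>divisor_sections (pullback_coeff (Poly_Mapping.lookup D)). y \<noteq> 0 \<longrightarrow>
      (\<exists>m. y ^ m \<in> twist_ideal (pullback_coeff (Poly_Mapping.lookup D)) m))"
proof -
  have "divisor_sections (Poly_Mapping.lookup (divisor_pullback f D)) =
      divisor_sections (pullback_coeff (Poly_Mapping.lookup D))"
    by (rule B.sections_cong) (simp add: lookup_divisor_pullback[OF D])
  moreover have "twist_ideal (Poly_Mapping.lookup (divisor_pullback f D)) =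
      twist_ideal (pullback_coeff (Poly_Mapping.lookup D))"
    unfolding twist_ideal_def
    by (intro ext arg_cong2[of _ _ _ _ prod_span] B.sections_cong) (simp_all add: lookup_divisor_pullback[OF D])
  ultimately show ?thesis using B.coaffine_iff[OF pullback_weil[OF D]] by simp
qed

lemma coaffine_pullback:
  assumes D: "D \<in> weil_divisors" and co: "coaffine D"
  shows "coaffine (divisor_pullback f D)"
  unfolding coaffine_pullback_iff[OF D]
  using pullback_radical[OF weil_lookup_zero[OF D] A.weil_divisor_finite] co
  unfolding A.coaffine_iff[OF D] by blast

lemma coaffine_descent:
  assumes D: "D \<in> weil_divisors" and ff: "faithfully_flat_module ring_of_type (module_along f)"
    and co: "coaffine (divisor_pullback f D)"
  shows "coaffine D"
  unfolding A.coaffine_iff[OF D]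
proof (intro ballI impI)
  fix q assume q: "q \<in> divisor_sections (Poly_Mapping.lookup D)" "q \<noteq> 0"
  have "fr q \<in> divisor_sections (pullback_coeff (Poly_Mapping.lookup D))" "fr q \<noteq> 0"
    using fr_sections[OF weil_lookup_zero[OF D] q(1)] q(2) by (simp_all add: fr_eq_0_iff)
  then obtain m where "fr q ^ m \<in> twist_ideal (pullback_coeff (Poly_Mapping.lookup D)) m"
    using co unfolding coaffine_pullback_iff[OF D] by blast
  then show "\<exists>m. q ^ m \<in> twist_ideal (Poly_Mapping.lookup D) m"
    using descent_radical[OF ff weil_lookup_zero[OF D] A.weil_divisor_finite q(1)] by blast
qed

end

theorem mainTheorem9:
  fixes f :: "'a::idom \<Rightarrow> 'b::idom" and D :: "'a set \<Rightarrow>\<^sub>0 int"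
  assumes "noetherian_ring (ring_of_type :: 'a ring)" and "normal_domain TYPE('a)"
    and "noetherian_ring (ring_of_type :: 'b ring)" and "normal_domain TYPE('b)"
    and "f \<in> ring_hom ring_of_type ring_of_type" and "inj f"
    and "flat_module ring_of_type (module_along f)"
    and "D \<in> weil_divisors"
  shows "(coaffine D \<longrightarrow> coaffine (divisor_pullback f D)) \<and>
    (faithfully_flat_module ring_of_type (module_along f) \<longrightarrow>
       coaffine (divisor_pullback f D) \<longrightarrow> coaffine D)"
proof -
  interpret flat_normal_extension f
    by (rule flat_normal_extension.intro[OF assms(1-7)])
  show ?thesis using coaffine_pullback[OF assms(8)] coaffine_descent[OF assms(8)] by blast
qed

end
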